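(* Let $(M,g)$ be a Riemannian manifold of dimension $n\ge 3$, let $TM$ be its tangent bundle, and let $a,b,c\in\mathbb{R}$ be constants with $a>0$ and $a(a+c)-b^2>0$. Let $G=a\,g^s+b\,g^h+c\,g^v$ be the Riemannian metric on $TM$ determined, at every $(x,y)\in TM$ and for all vector fields $X,Y$ on $M$, by $$G_{(x,y)}(X^h,Y^h)=(a+c)\,g_x(X,Y),\quad G_{(x,y)}(X^h,Y^v)=G_{(x,y)}(X^v,Y^h)=b\,g_x(X,Y),\quad G_{(x,y)}(X^v,Y^v)=a\,g_x(X,Y).$$ Then each of the following three conditions is equivalent to $(M,g)$ being flat: (i) $(TM,G)$ is recurrent; (ii) $(TM,G)$ is pseudo-symmetric; (iii) $(TM,G)$ is locally symmetric. Hence, in each of these cases, $(TM,G)$ is flat.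
   Context: Lifts. Let $\nabla$ be the Levi-Civita connection of $g$, with Christoffel symbols $\Gamma_{ij}^k$ in local coordinates $(x^i)$ on $M$, and let $(x^i,y^i)$ be the induced coordinates on $TM$. Put $\frac{\delta}{\delta x^i}=\frac{\partial}{\partial x^i}-y^a\Gamma_{ai}^j\frac{\partial}{\partial y^j}$. For a vector field $X=X^i\frac{\partial}{\partial x^i}$ on $M$, its horizontal lift is $X^h=X^i\frac{\delta}{\delta x^i}$ and its vertical lift is $X^v=X^i\frac{\partial}{\partial y^i}$; both are vector fields on $TM$, and at each point of $TM$ such lifts span the tangent space of $TM$. The Sasaki lift $g^s$, the horizontal lift $g^h$ and the vertical lift $g^v$ of $g$ are the symmetric $(0,2)$-tensor fields on $TM$ given by: $g^s(X^h,Y^h)=g^s(X^v,Y^v)=g(X,Y)$, $g^s(X^h,Y^v)=0$; $g^h(X^h,Y^h)=g^h(X^v,Y^v)=0$, $g^h(X^h,Y^v)=g(X,Y)$; $g^v(X^h,Y^h)=g(X,Y)$, $g^v(X^h,Y^v)=g^v(X^v,Y^v)=0$. The metric $G$ is Riemannian if and only if $a>0$ and $a(a+c)-b^2>0$. Curvature convention: $R(X,Y)Z=\nabla_X\nabla_YZ-\nabla_Y\nabla_XZ-\nabla_{[X,Y]}Z$. Flat means that the Riemannian curvature tensor vanishes identically. Symmetry conditions. For a Riemannian manifold $(N,k)$ with Levi-Civita connection $\nabla$ and curvature tensor $R$, consider, for 1-forms $\alpha_1,\alpha_2$ on $N$, the identity $$(\nabla_WR)(X,Y)Z=\alpha_1(W)R(X,Y)Z+\alpha_2(X)R(W,Y)Z+\alpha_2(Y)R(X,W)Z+\alpha_2(Z)R(X,Y)W+k(R(X,Y)Z,W)(\alpha_2)^\sharp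 \quad ( * )$$ for all vector fields $W,X,Y,Z$ on $N$, where $\sharp$ denotes the metric dual with respect to $k$. The manifold $(N,k)$ is called recurrent if $( * )$ holds for some $\alpha_1$ with $\alpha_2=0$, i.e. $\nabla_WR=\alpha_1(W)R$; pseudo-symmetric if $( * )$ holds for some $\alpha_1,\alpha_2$ with $\alpha_1=2\alpha_2$; locally symmetric if $\nabla R=0$, i.e. $( * )$ holds with $\alpha_1=\alpha_2=0$. The 1-forms are allowed to be zero. *)

theory Defs
  imports "HOL-Analysis.Analysis"
begin

section \<open>Smooth maps between Euclidean spaces\<close>

fun Ck_on :: "nat \<Rightarrow> 'a::euclidean_space set \<Rightarrow> ('a \<Rightarrow> 'b::real_normed_vector) \<Rightarrow> bool" where
  "Ck_on 0 S f \<longleftrightarrow> continuous_on S f"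
| "Ck_on (Suc k) S f \<longleftrightarrow> (\<forall>x\<in>S. f differentiable (at x)) \<and>
     (\<forall>v. Ck_on k S (\<lambda>x. frechet_derivative f (at x) v))"

text \<open>Only used for open \<open>S\<close>.\<close>

definition smooth_on :: "'a::euclidean_space set \<Rightarrow> ('a \<Rightarrow> 'b::real_normed_vector) \<Rightarrow> bool" where
  "smooth_on S f \<longleftrightarrow> (\<forall>k. Ck_on k S f)"

section \<open>Smooth manifolds\<close>

text \<open>
  A manifold modelled on a Euclidean space \<open>'e\<close> (so of dimension \<open>DIM('e)\<close>) is given by an
  atlas \<open>A\<close>, a set of charts \<open>c = (U, \<phi>)\<close>. Its underlying set is the union of the chart domains
  and its topology is the one that makes the charts homeomorphisms onto open sets.
  Values of \<open>\<phi>\<close> outside \<open>U\<close> are irrelevant.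
\<close>

type_synonym ('a, 'e) chart = "'a set \<times> ('a \<Rightarrow> 'e)"

abbreviation chart_dom :: "('a, 'e) chart \<Rightarrow> 'a set" where
  "chart_dom c \<equiv> fst c"

abbreviation coord :: "('a, 'e) chart \<Rightarrow> 'a \<Rightarrow> 'e" where
  "coord c \<equiv> snd c"

definition chart_ran :: "('a, 'e) chart \<Rightarrow> 'e set" where
  "chart_ran c = coord c ` chart_dom c"

definition chart_inv :: "('a, 'e) chart \<Rightarrow> 'e \<Rightarrow> 'a" where
  "chart_inv c = inv_into (chart_dom c) (coord c)"

definition points :: "('a, 'e) chart set \<Rightarrow> 'a set" where
  "points A = (\<Union>c\<in>A. chart_dom c)"

definition smooth_atlas :: "('a, 'e::euclidean_space) chart set \<Rightarrow> bool" where
  "smooth_atlas A \<longleftrightarrow>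
     (\<forall>c\<in>A. inj_on (coord c) (chart_dom c) \<and> open (chart_ran c)) \<and>
     (\<forall>c\<in>A. \<forall>c'\<in>A. open (coord c ` (chart_dom c \<inter> chart_dom c')) \<and>
        smooth_on (coord c ` (chart_dom c \<inter> chart_dom c')) (coord c' \<circ> chart_inv c))"

definition atlas_topology :: "('a, 'e::euclidean_space) chart set \<Rightarrow> 'a topology" where
  "atlas_topology A =
     topology (\<lambda>W. W \<subseteq> points A \<and> (\<forall>c\<in>A. open (coord c ` (W \<inter> chart_dom c))))"

lemma istopology_atlas:
  fixes A :: "('a, 'e::euclidean_space) chart set"
  assumes "smooth_atlas A"
  shows "istopology (\<lambda>W. W \<subseteq> points A \<and> (\<forall>c\<in>A. open (coord c ` (W \<inter> chart_dom c))))"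
proof -
  have *: "open (coord c ` (S \<inter> T \<inter> chart_dom c))"
    if "c \<in> A" "open (coord c ` (S \<inter> chart_dom c))" "open (coord c ` (T \<inter> chart_dom c))" for S T c
  proof -
    have "inj_on (coord c) (chart_dom c)"
      using assms that by (auto simp: smooth_atlas_def)
    hence "coord c ` (S \<inter> T \<inter> chart_dom c) =
        coord c ` (S \<inter> chart_dom c) \<inter> coord c ` (T \<inter> chart_dom c)"
      by (auto simp: inj_on_def)
    thus ?thesis using that by auto
  qed
  have **: "open (coord c ` (\<Union>K \<inter> chart_dom c))"
    if "\<And>W. W \<in> K \<Longrightarrow> open (coord c ` (W \<inter> chart_dom c))" for K c
  proof -
    have "coord c ` (\<Union>K \<inter> chart_dom c) = (\<Union>W\<in>K. coord c ` (W \<inter> chart_dom c))" by auto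
    thus ?thesis using that by auto
  qed
  show ?thesis unfolding istopology_def
    using * ** by (intro conjI allI impI ballI) (blast, blast, blast, metis)
qed

definition smooth_manifold :: "('a, 'e::euclidean_space) chart set \<Rightarrow> bool" where
  "smooth_manifold A \<longleftrightarrow> smooth_atlas A \<and>
     Hausdorff_space (atlas_topology A) \<and> second_countable (atlas_topology A)"

section \<open>Tangent vectors and the tangent bundle\<close>

text \<open>
  A tangent vector at \<open>p\<close> is represented by the family of its components in all charts around
  \<open>p\<close>, subject to the usual transformation law (and set to \<open>0\<close> on all other arguments, so
  that equality of tangent vectors is equality of functions).
\<close>

type_synonym ('a, 'e) tvec = "('a, 'e) chart \<Rightarrow> 'e"

definition tangent_space :: "('a, 'e::euclidean_space) chart set \<Rightarrow> 'a \<Rightarrow> ('a, 'e) tvec set" where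
  "tangent_space A p = {v.
     (\<forall>c. \<not> (c \<in> A \<and> p \<in> chart_dom c) \<longrightarrow> v c = 0) \<and>
     (\<forall>c\<in>A. \<forall>c'\<in>A. p \<in> chart_dom c \<and> p \<in> chart_dom c' \<longrightarrow>
        v c' = frechet_derivative (coord c' \<circ> chart_inv c) (at (coord c p)) (v c))}"

text \<open>The tangent vector at \<open>p\<close> whose components in the chart \<open>c\<close> are \<open>u\<close>.\<close>

definition chart_vec ::
  "('a, 'e::euclidean_space) chart set \<Rightarrow> ('a, 'e) chart \<Rightarrow> 'a \<Rightarrow> 'e \<Rightarrow> ('a, 'e) tvec" where
  "chart_vec A c p u = (\<lambda>c'. if c' \<in> A \<and> p \<in> chart_dom c'
     then frechet_derivative (coord c' \<circ> chart_inv c) (at (coord c p)) u else 0)"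

text \<open>The induced chart \<open>(x, y)\<close> of the tangent bundle, modelled on \<open>'e \<times> 'e\<close>.\<close>

definition tb_chart ::
  "('a, 'e::euclidean_space) chart set \<Rightarrow> ('a, 'e) chart \<Rightarrow> ('a \<times> ('a, 'e) tvec, 'e \<times> 'e) chart" where
  "tb_chart A c =
     ({(p, y). p \<in> chart_dom c \<and> y \<in> tangent_space A p}, \<lambda>(p, y). (coord c p, y c))"

definition tb_atlas ::
  "('a, 'e::euclidean_space) chart set \<Rightarrow> ('a \<times> ('a, 'e) tvec, 'e \<times> 'e) chart set" where
  "tb_atlas A = tb_chart A ` A"

lemma inj_tb_chart: "inj (tb_chart (A :: ('a, 'e::euclidean_space) chart set))"
proof (rule injI)
  fix c c' :: "('a, 'e) chart"
  assume "tb_chart A c = tb_chart A c'"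
  hence eq: "(\<lambda>(p, y :: ('a, 'e) tvec). (coord c p, y c)) = (\<lambda>(p, y). (coord c' p, y c'))"
    by (simp add: tb_chart_def)
  have *: "y c = y c'" for y :: "('a, 'e) tvec"
    using fun_cong[OF eq, of "(undefined, y)"] by simp
  obtain b :: 'e where "b \<in> Basis" using nonempty_Basis by blast
  hence "b \<noteq> 0" by auto
  with *[of "\<lambda>d. if d = c then b else 0"] show "c = c'" by (auto split: if_splits)
qed

section \<open>Vector fields, 1-forms and Riemannian metrics\<close>

type_synonym ('a, 'e) vfield = "'a \<Rightarrow> ('a, 'e) tvec"
type_synonym ('a, 'e) form1 = "'a \<Rightarrow> ('a, 'e) tvec \<Rightarrow> real"
type_synonym ('a, 'e) tensor2 = "'a \<Rightarrow> ('a, 'e) tvec \<Rightarrow> ('a, 'e) tvec \<Rightarrow> real"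

definition vector_field :: "('a, 'e::euclidean_space) chart set \<Rightarrow> ('a, 'e) vfield \<Rightarrow> bool" where
  "vector_field A X \<longleftrightarrow> (\<forall>p\<in>points A. X p \<in> tangent_space A p) \<and>
     (\<forall>c\<in>A. smooth_on (chart_ran c) (\<lambda>x. X (chart_inv c x) c))"

definition form1_comp ::
  "('a, 'e::euclidean_space) chart set \<Rightarrow> ('a, 'e) form1 \<Rightarrow> ('a, 'e) chart \<Rightarrow> 'e \<Rightarrow> 'e \<Rightarrow> real" where
  "form1_comp A \<alpha> c x u = \<alpha> (chart_inv c x) (chart_vec A c (chart_inv c x) u)"

definition one_form :: "('a, 'e::euclidean_space) chart set \<Rightarrow> ('a, 'e) form1 \<Rightarrow> bool" where
  "one_form A \<alpha> \<longleftrightarrow> (\<forall>c\<in>A. (\<forall>x\<in>chart_ran c. linear (form1_comp A \<alpha> c x)) \<and>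
     (\<forall>u. smooth_on (chart_ran c) (\<lambda>x. form1_comp A \<alpha> c x u)))"

definition tensor2_comp ::
  "('a, 'e::euclidean_space) chart set \<Rightarrow> ('a, 'e) tensor2 \<Rightarrow> ('a, 'e) chart \<Rightarrow>
     'e \<Rightarrow> 'e \<Rightarrow> 'e \<Rightarrow> real" where
  "tensor2_comp A k c x u v =
     k (chart_inv c x) (chart_vec A c (chart_inv c x) u) (chart_vec A c (chart_inv c x) v)"

definition symmetric_tensor2 ::
  "('a, 'e::euclidean_space) chart set \<Rightarrow> ('a, 'e) tensor2 \<Rightarrow> bool" where
  "symmetric_tensor2 A k \<longleftrightarrow> (\<forall>c\<in>A.
     (\<forall>x\<in>chart_ran c. bilinear (tensor2_comp A k c x) \<and>
        (\<forall>u v. tensor2_comp A k c x u v = tensor2_comp A k c x v u)) \<and>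
     (\<forall>u v. smooth_on (chart_ran c) (\<lambda>x. tensor2_comp A k c x u v)))"

definition riemannian_metric ::
  "('a, 'e::euclidean_space) chart set \<Rightarrow> ('a, 'e) tensor2 \<Rightarrow> bool" where
  "riemannian_metric A k \<longleftrightarrow> symmetric_tensor2 A k \<and>
     (\<forall>c\<in>A. \<forall>x\<in>chart_ran c. \<forall>u. u \<noteq> 0 \<longrightarrow> tensor2_comp A k c x u u > 0)"

definition riemannian_manifold ::
  "('a, 'e::euclidean_space) chart set \<Rightarrow> ('a, 'e) tensor2 \<Rightarrow> bool" where
  "riemannian_manifold A k \<longleftrightarrow> smooth_manifold A \<and> riemannian_metric A k"

section \<open>Levi-Civita connection and curvature\<close>

text \<open>
  \<open>christoffel A k c x u v\<close> is \<open>\<nabla>\<^sub>U V\<close> at \<open>x\<close>, in the chart \<open>c\<close>, for the coordinate vector fields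
  \<open>U, V\<close> with constant components \<open>u, v\<close>: \<open>u\<^sup>i v\<^sup>j \<Gamma>\<^sub>i\<^sub>j\<^sup>k \<partial>\<^sub>k\<close>. The two equations say that the
  connection is torsion-free and metric.
\<close>

definition christoffel ::
  "('a, 'e::euclidean_space) chart set \<Rightarrow> ('a, 'e) tensor2 \<Rightarrow> ('a, 'e) chart \<Rightarrow>
     'e \<Rightarrow> 'e \<Rightarrow> 'e \<Rightarrow> 'e" where
  "christoffel A k c x = (THE \<Gamma>. bilinear \<Gamma> \<and> (\<forall>u v. \<Gamma> u v = \<Gamma> v u) \<and>
     (\<forall>w u v. frechet_derivative (\<lambda>x'. tensor2_comp A k c x' u v) (at x) w =
        tensor2_comp A k c x (\<Gamma> w u) v + tensor2_comp A k c x u (\<Gamma> w v)))"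

definition nabla ::
  "('a, 'e::euclidean_space) chart set \<Rightarrow> ('a, 'e) tensor2 \<Rightarrow>
     ('a, 'e) vfield \<Rightarrow> ('a, 'e) vfield \<Rightarrow> ('a, 'e) vfield" where
  "nabla A k X Y = (\<lambda>p c. if c \<in> A \<and> p \<in> chart_dom c
     then frechet_derivative (\<lambda>x. Y (chart_inv c x) c) (at (coord c p)) (X p c)
            + christoffel A k c (coord c p) (X p c) (Y p c)
     else 0)"

definition lie_bracket ::
  "('a, 'e::euclidean_space) chart set \<Rightarrow>
     ('a, 'e) vfield \<Rightarrow> ('a, 'e) vfield \<Rightarrow> ('a, 'e) vfield" where
  "lie_bracket A X Y = (\<lambda>p c. if c \<in> A \<and> p \<in> chart_dom c
     then frechet_derivative (\<lambda>x. Y (chart_inv c x) c) (at (coord c p)) (X p c)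
            - frechet_derivative (\<lambda>x. X (chart_inv c x) c) (at (coord c p)) (Y p c)
     else 0)"

definition curvature ::
  "('a, 'e::euclidean_space) chart set \<Rightarrow> ('a, 'e) tensor2 \<Rightarrow>
     ('a, 'e) vfield \<Rightarrow> ('a, 'e) vfield \<Rightarrow> ('a, 'e) vfield \<Rightarrow> ('a, 'e) vfield" where
  "curvature A k X Y Z = (\<lambda>p c.
     nabla A k X (nabla A k Y Z) p c - nabla A k Y (nabla A k X Z) p c
       - nabla A k (lie_bracket A X Y) Z p c)"

definition nabla_curvature ::
  "('a, 'e::euclidean_space) chart set \<Rightarrow> ('a, 'e) tensor2 \<Rightarrow> ('a, 'e) vfield \<Rightarrow>
     ('a, 'e) vfield \<Rightarrow> ('a, 'e) vfield \<Rightarrow> ('a, 'e) vfield \<Rightarrow> ('a, 'e) vfield" where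
  "nabla_curvature A k W X Y Z = (\<lambda>p c.
     nabla A k W (curvature A k X Y Z) p c
       - curvature A k (nabla A k W X) Y Z p c
       - curvature A k X (nabla A k W Y) Z p c
       - curvature A k X Y (nabla A k W Z) p c)"

definition flat :: "('a, 'e::euclidean_space) chart set \<Rightarrow> ('a, 'e) tensor2 \<Rightarrow> bool" where
  "flat A k \<longleftrightarrow> (\<forall>X Y Z. vector_field A X \<longrightarrow> vector_field A Y \<longrightarrow> vector_field A Z \<longrightarrow>
     (\<forall>p\<in>points A. curvature A k X Y Z p = (\<lambda>c. 0)))"

section \<open>Symmetry conditions\<close>

definition sharp ::
  "('a, 'e::euclidean_space) chart set \<Rightarrow> ('a, 'e) tensor2 \<Rightarrow> ('a, 'e) form1 \<Rightarrow> ('a, 'e) vfield" where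
  "sharp A k \<alpha> p =
     (THE v. v \<in> tangent_space A p \<and> (\<forall>w\<in>tangent_space A p. k p v w = \<alpha> p w))"

definition symmetry_identity ::
  "('a, 'e::euclidean_space) chart set \<Rightarrow> ('a, 'e) tensor2 \<Rightarrow>
     ('a, 'e) form1 \<Rightarrow> ('a, 'e) form1 \<Rightarrow> bool" where
  "symmetry_identity A k \<alpha>1 \<alpha>2 \<longleftrightarrow>
     (\<forall>W X Y Z. vector_field A W \<longrightarrow> vector_field A X \<longrightarrow> vector_field A Y \<longrightarrow> vector_field A Z \<longrightarrow>
       (\<forall>p\<in>points A. nabla_curvature A k W X Y Z p = (\<lambda>c.
          \<alpha>1 p (W p) *\<^sub>R curvature A k X Y Z p c
          + \<alpha>2 p (X p) *\<^sub>R curvature A k W Y Z p c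
          + \<alpha>2 p (Y p) *\<^sub>R curvature A k X W Z p c
          + \<alpha>2 p (Z p) *\<^sub>R curvature A k X Y W p c
          + k p (curvature A k X Y Z p) (W p) *\<^sub>R sharp A k \<alpha>2 p c)))"

definition recurrent :: "('a, 'e::euclidean_space) chart set \<Rightarrow> ('a, 'e) tensor2 \<Rightarrow> bool" where
  "recurrent A k \<longleftrightarrow> (\<exists>\<alpha>1. one_form A \<alpha>1 \<and> symmetry_identity A k \<alpha>1 (\<lambda>p v. 0))"

definition pseudo_symmetric ::
  "('a, 'e::euclidean_space) chart set \<Rightarrow> ('a, 'e) tensor2 \<Rightarrow> bool" where
  "pseudo_symmetric A k \<longleftrightarrow> (\<exists>\<alpha>1 \<alpha>2. one_form A \<alpha>1 \<and> one_form A \<alpha>2 \<and>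
     (\<forall>p\<in>points A. \<forall>v\<in>tangent_space A p. \<alpha>1 p v = 2 * \<alpha>2 p v) \<and>
     symmetry_identity A k \<alpha>1 \<alpha>2)"

definition locally_symmetric ::
  "('a, 'e::euclidean_space) chart set \<Rightarrow> ('a, 'e) tensor2 \<Rightarrow> bool" where
  "locally_symmetric A k \<longleftrightarrow>
     (\<forall>W X Y Z. vector_field A W \<longrightarrow> vector_field A X \<longrightarrow> vector_field A Y \<longrightarrow> vector_field A Z \<longrightarrow>
       (\<forall>p\<in>points A. nabla_curvature A k W X Y Z p = (\<lambda>c. 0)))"

section \<open>Lifts to the tangent bundle\<close>

text \<open>
  In the induced chart, at \<open>(x, y)\<close>: \<open>X\<^sup>h = (X, - \<Gamma>(y, X))\<close> and \<open>X\<^sup>v = (0, X)\<close>. By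
  \<open>inj_tb_chart\<close>, \<open>inv_into A (tb_chart A) C\<close> is the chart inducing \<open>C\<close>.
\<close>

definition hlift ::
  "('a, 'e::euclidean_space) chart set \<Rightarrow> ('a, 'e) tensor2 \<Rightarrow> ('a, 'e) vfield \<Rightarrow>
     ('a \<times> ('a, 'e) tvec, 'e \<times> 'e) vfield" where
  "hlift A g X = (\<lambda>(p, y) C. if C \<in> tb_atlas A \<and> (p, y) \<in> chart_dom C
     then let c = inv_into A (tb_chart A) C
          in (X p c, - christoffel A g c (coord c p) (y c) (X p c))
     else 0)"

definition vlift ::
  "('a, 'e::euclidean_space) chart set \<Rightarrow> ('a, 'e) vfield \<Rightarrow>
     ('a \<times> ('a, 'e) tvec, 'e \<times> 'e) vfield" where
  "vlift A X = (\<lambda>(p, y) C. if C \<in> tb_atlas A \<and> (p, y) \<in> chart_dom C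
     then let c = inv_into A (tb_chart A) C in (0, X p c)
     else 0)"

definition sasaki_lift ::
  "('a, 'e::euclidean_space) chart set \<Rightarrow> ('a, 'e) tensor2 \<Rightarrow>
     ('a \<times> ('a, 'e) tvec, 'e \<times> 'e) tensor2 \<Rightarrow> bool" where
  "sasaki_lift A g gs \<longleftrightarrow> symmetric_tensor2 (tb_atlas A) gs \<and>
     (\<forall>X Y. vector_field A X \<longrightarrow> vector_field A Y \<longrightarrow>
       (\<forall>(p, y) \<in> points (tb_atlas A).
          gs (p, y) (hlift A g X (p, y)) (hlift A g Y (p, y)) = g p (X p) (Y p) \<and>
          gs (p, y) (vlift A X (p, y)) (vlift A Y (p, y)) = g p (X p) (Y p) \<and>
          gs (p, y) (hlift A g X (p, y)) (vlift A Y (p, y)) = 0))"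

definition horizontal_lift ::
  "('a, 'e::euclidean_space) chart set \<Rightarrow> ('a, 'e) tensor2 \<Rightarrow>
     ('a \<times> ('a, 'e) tvec, 'e \<times> 'e) tensor2 \<Rightarrow> bool" where
  "horizontal_lift A g gh \<longleftrightarrow> symmetric_tensor2 (tb_atlas A) gh \<and>
     (\<forall>X Y. vector_field A X \<longrightarrow> vector_field A Y \<longrightarrow>
       (\<forall>(p, y) \<in> points (tb_atlas A).
          gh (p, y) (hlift A g X (p, y)) (hlift A g Y (p, y)) = 0 \<and>
          gh (p, y) (vlift A X (p, y)) (vlift A Y (p, y)) = 0 \<and>
          gh (p, y) (hlift A g X (p, y)) (vlift A Y (p, y)) = g p (X p) (Y p)))"

definition vertical_lift ::
  "('a, 'e::euclidean_space) chart set \<Rightarrow> ('a, 'e) tensor2 \<Rightarrow>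
     ('a \<times> ('a, 'e) tvec, 'e \<times> 'e) tensor2 \<Rightarrow> bool" where
  "vertical_lift A g gv \<longleftrightarrow> symmetric_tensor2 (tb_atlas A) gv \<and>
     (\<forall>X Y. vector_field A X \<longrightarrow> vector_field A Y \<longrightarrow>
       (\<forall>(p, y) \<in> points (tb_atlas A).
          gv (p, y) (hlift A g X (p, y)) (hlift A g Y (p, y)) = g p (X p) (Y p) \<and>
          gv (p, y) (hlift A g X (p, y)) (vlift A Y (p, y)) = 0 \<and>
          gv (p, y) (vlift A X (p, y)) (vlift A Y (p, y)) = 0))"

end

(*
  The frame X^h - (b/a) X^v, X^v is orthogonal for G, and in it the Levi-Civita connection of G is
  that of g plus terms that are linear in the curvature R of g. If R = 0 they vanish, and TM is flat.

  Conversely, for a vector tangent to the fibre at (x, y) in the second and third slot, the curvature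
  of G is the explicit polynomial
      R~(U, V^v) Z^v = - k R(V, Z)U - k^2 R(y, V)R(y, Z)U,   k = a^2 / (2 (a (a + c) - b^2)),
  with values in the first summand of the frame. Let W be the Liouville field, W = y^v. Then
  nabla_W W = W and nabla_W kills X^h and Y^v, so that nabla_W R~ is the derivative of this
  polynomial along the fibre: by Euler's relation it doubles the part quadratic in y. The identity
  for (W; X^h, Y^v, Y^v) becomes (2 - alpha_1(W)) R(y, Y)^2 X = 0, since the alpha_2-terms cancel,
  and for (W; X^h, W, Y^v) it becomes (alpha_1(W) + alpha_2(W)) R(y, Y)X = 0. As R(y, Y) is skew, its
  square vanishes only if it does. So if R is not 0, then alpha_1(W) = 2 and alpha_2(W) = -2 at some
  point, which contradicts alpha_2 = 0 as well as alpha_1 = 2 alpha_2.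
*)

theory Submission
  imports Defs
begin


section \<open>Smooth maps\<close>

text \<open>The slots are chosen so that no derivative of R along the base is ever met: on vertical
  second and third arguments the curvature of G is a polynomial in the fibre coordinate, and W
  differentiates along the fibre only. The value of k: G is q g on the first and a g on the second
  summand, with q = (a (a + c) - b^2) / a. The torsion R(X, Y)y puts -1/2 R(X, Y)y into the second
  component of the connection, and compatibility with G then asks for q k = a / 2 in the first. The
  term with the dual vector of alpha_2 has the coefficient G(R~(X, Y)Z, W). It vanishes in both
  uses, because R~(X, Y)Z lies in the first summand and W in the second, and these are orthogonal.
  Two obstacles shape the rest. Christoffel symbols are given by a description operator, so each
  closed form or transformation law is obtained from uniqueness: a tensor symmetric in one pair of
  slots and skew in an overlapping pair is zero. And all conditions quantify over global fields, so
  a pointwise conclusion needs an extension of every tangent vector to the whole manifold.\<close>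

abbreviation dd :: "('a::real_normed_vector \<Rightarrow> 'b::real_normed_vector) \<Rightarrow> 'a \<Rightarrow> 'a \<Rightarrow> 'b" where
  "dd f x \<equiv> frechet_derivative f (at x)"

lemma dd_eq: "(f has_derivative f') (at x) \<Longrightarrow> dd f x = f'"
  using frechet_derivative_at by metis

lemma has_derivative_dd: "f differentiable (at x) \<Longrightarrow> (f has_derivative dd f x) (at x)"
  by (simp add: frechet_derivative_works)

lemma has_derivative_cong_open:
  assumes "open S" "x \<in> S" "\<And>y. y \<in> S \<Longrightarrow> f y = g y"
  shows "(f has_derivative f') (at x) \<longleftrightarrow> (g has_derivative f') (at x)"
  using has_derivative_transform_within_open[of f f' x UNIV S g]
    has_derivative_transform_within_open[of g f' x UNIV S f] assms by auto

lemma dd_cong: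
  assumes "open S" "x \<in> S" "\<And>y. y \<in> S \<Longrightarrow> f y = g y"
  shows "dd f x = dd g x"
  unfolding frechet_derivative_def using has_derivative_cong_open[OF assms] by simp

lemma differentiable_cong_open:
  assumes "open S" "x \<in> S" "\<And>y. y \<in> S \<Longrightarrow> f y = g y"
  shows "f differentiable (at x) \<longleftrightarrow> g differentiable (at x)"
  unfolding differentiable_def using has_derivative_cong_open[OF assms] by simp

lemma Ck_on_cong:
  assumes "open S" "\<And>y. y \<in> S \<Longrightarrow> f y = g y"
  shows "Ck_on k S f \<longleftrightarrow> Ck_on k S g"
  using assms(2)
proof (induction k arbitrary: f g)
  case 0
  then show ?case by (simp cong: continuous_on_cong)
next
  case (Suc k)
  have "dd f x = dd g x" if "x \<in> S" for x using dd_cong[OF assms(1) that] Suc.prems by blast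
  hence "Ck_on k S (\<lambda>x. dd f x v) = Ck_on k S (\<lambda>x. dd g x v)" for v
    by (intro Suc.IH) auto
  moreover have "f differentiable (at x) \<longleftrightarrow> g differentiable (at x)" if "x \<in> S" for x
    using differentiable_cong_open[OF assms(1) that] Suc.prems by blast
  ultimately show ?case by simp
qed

lemma Ck_on_SucD: "Ck_on (Suc k) S f \<Longrightarrow> Ck_on k S f"
proof (induction k arbitrary: f)
  case 0
  then show ?case
    by (auto intro!: continuous_at_imp_continuous_on differentiable_imp_continuous_within)
qed auto

lemma Ck_on_const: "Ck_on k S (\<lambda>x. c)"
  by (induction k arbitrary: c) auto

lemma Ck_on_add: "open S \<Longrightarrow> Ck_on k S f \<Longrightarrow> Ck_on k S g \<Longrightarrow> Ck_on k S (\<lambda>x. f x + g x)"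
proof (induction k arbitrary: f g)
  case 0
  then show ?case by (auto intro: continuous_on_add)
next
  case (Suc k)
  have "dd (\<lambda>x. f x + g x) x = (\<lambda>v. dd f x v + dd g x v)" if "x \<in> S" for x
    using Suc.prems that by (intro dd_eq has_derivative_add has_derivative_dd) auto
  hence "Ck_on k S (\<lambda>x. dd (\<lambda>x. f x + g x) x v) = Ck_on k S (\<lambda>x. dd f x v + dd g x v)" for v
    by (intro Ck_on_cong) (auto simp: Suc.prems)
  thus ?case using Suc by auto
qed

text \<open>One induction covers scaling, products and inner products. The product rule keeps an
  undifferentiated factor in each term, so the factors are also needed at one order less, which
  \<open>Ck_on_SucD\<close> supplies.\<close>

lemma Ck_on_bilinear:
  assumes "bounded_bilinear mul" "open S"
  shows "Ck_on k S f \<Longrightarrow> Ck_on k S g \<Longrightarrow> Ck_on k S (\<lambda>x. mul (f x) (g x))"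
proof (induction k arbitrary: f g)
  case 0
  then show ?case using bounded_bilinear.continuous_on[OF assms(1)] by auto
next
  case (Suc k)
  have der: "((\<lambda>x. mul (f x) (g x)) has_derivative
      (\<lambda>v. mul (f x) (dd g x v) + mul (dd f x v) (g x))) (at x)" if "x \<in> S" for x
    using Suc.prems that
    by (intro bounded_bilinear.FDERIV[OF assms(1)] has_derivative_dd) auto
  have "Ck_on k S (\<lambda>x. dd (\<lambda>x. mul (f x) (g x)) x v) =
      Ck_on k S (\<lambda>x. mul (f x) (dd g x v) + mul (dd f x v) (g x))" for v
    by (intro Ck_on_cong assms) (simp add: dd_eq[OF der])
  moreover have "Ck_on k S (\<lambda>x. mul (f x) (dd g x v) + mul (dd f x v) (g x))" for v
    using Suc.prems Suc.prems[THEN Ck_on_SucD] by (intro Ck_on_add Suc.IH assms) auto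
  ultimately show ?case using der by (auto simp: differentiable_def)
qed

lemma Ck_on_linear_compose:
  assumes "bounded_linear l" "open S"
  shows "Ck_on k S f \<Longrightarrow> Ck_on k S (\<lambda>x. l (f x))"
proof (induction k arbitrary: f)
  case 0
  then show ?case using bounded_linear.continuous_on[OF assms(1)] by auto
next
  case (Suc k)
  have der: "((\<lambda>x. l (f x)) has_derivative (\<lambda>v. l (dd f x v))) (at x)" if "x \<in> S" for x
    using Suc.prems that
    by (intro bounded_linear.has_derivative[OF assms(1)] has_derivative_dd) auto
  have "Ck_on k S (\<lambda>x. dd (\<lambda>x. l (f x)) x v) = Ck_on k S (\<lambda>x. l (dd f x v))" for v
    by (intro Ck_on_cong assms) (simp add: dd_eq[OF der])
  thus ?case using der Suc by (auto simp: differentiable_def)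
qed

lemma Ck_on_bounded_linear: "bounded_linear l \<Longrightarrow> Ck_on k S l"
proof (cases k)
  case (Suc j)
  assume l: "bounded_linear l"
  have "dd l x = l" for x using l by (simp add: bounded_linear_imp_has_derivative dd_eq)
  with Suc l show ?thesis
    by (auto intro!: bounded_linear_imp_differentiable Ck_on_const)
qed (auto intro: linear_continuous_on)

lemma Ck_on_sum:
  assumes "open S" "\<And>i. i \<in> I \<Longrightarrow> Ck_on k S (f i)"
  shows "Ck_on k S (\<lambda>x. \<Sum>i\<in>I. f i x)"
  using assms(2) by (induction I rule: infinite_finite_induct)
    (auto intro!: Ck_on_const Ck_on_add assms(1))

lemma linear_expand:
  fixes l :: "'a::euclidean_space \<Rightarrow> 'b::real_vector"
  assumes "linear l"
  shows "l u = (\<Sum>b\<in>Basis. (u \<bullet> b) *\<^sub>R l b)"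
  using linear_sum[OF assms, of "\<lambda>b. (u \<bullet> b) *\<^sub>R b" Basis]
  by (simp add: euclidean_representation linear_scale[OF assms])

text \<open>\<open>Ck_on\<close> differentiates in fixed directions, whereas the chain rule produces
  the direction \<open>dd g x v\<close>, which moves with \<open>x\<close>. Expanding it in the
  basis returns to fixed directions with variable coefficients.\<close>

lemma Ck_on_compose:
  fixes f :: "'b::euclidean_space \<Rightarrow> 'c::real_normed_vector" and g :: "'a::euclidean_space \<Rightarrow> 'b"
  assumes "open S" "open T" "\<And>x. x \<in> S \<Longrightarrow> g x \<in> T"
  shows "Ck_on k T f \<Longrightarrow> Ck_on k S g \<Longrightarrow> Ck_on k S (\<lambda>x. f (g x))"
proof (induction k arbitrary: f)
  case 0
  then show ?case using continuous_on_compose2[of T f S g] assms by auto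
next
  case (Suc k)
  have der: "((\<lambda>x. f (g x)) has_derivative (\<lambda>v. dd f (g x) (dd g x v))) (at x)" if "x \<in> S" for x
    using Suc.prems that assms
    by (intro has_derivative_compose[of g _ x UNIV f, simplified] has_derivative_dd) auto
  have "dd (\<lambda>x. f (g x)) x v = (\<Sum>b\<in>Basis. (dd g x v \<bullet> b) *\<^sub>R dd f (g x) b)" if "x \<in> S" for x v
    using linear_expand[OF has_derivative_linear[OF has_derivative_dd], of f "g x" "dd g x v"] that
      Suc.prems assms by (simp add: dd_eq[OF der[OF that]])
  hence "Ck_on k S (\<lambda>x. dd (\<lambda>x. f (g x)) x v) =
      Ck_on k S (\<lambda>x. \<Sum>b\<in>Basis. (dd g x v \<bullet> b) *\<^sub>R dd f (g x) b)" for v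
    by (intro Ck_on_cong) (auto simp: assms)
  moreover have "Ck_on k S (\<lambda>x. \<Sum>b\<in>Basis. (dd g x v \<bullet> b) *\<^sub>R dd f (g x) b)" for v
    using Suc.prems Ck_on_SucD[OF Suc.prems(2)]
    by (intro Ck_on_sum Ck_on_bilinear[OF bounded_bilinear_scaleR] assms Suc.IH
        Ck_on_linear_compose[OF bounded_linear_inner_left]) auto
  ultimately show ?case using der by (auto simp: differentiable_def)
qed

lemma Ck_on_subset: "Ck_on k S f \<Longrightarrow> T \<subseteq> S \<Longrightarrow> Ck_on k T f"
  by (induction k arbitrary: f) (auto intro: continuous_on_subset)

lemma Ck_on_Un:
  "open S \<Longrightarrow> open T \<Longrightarrow> Ck_on k S f \<Longrightarrow> Ck_on k T f \<Longrightarrow> Ck_on k (S \<union> T) f"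
  by (induction k arbitrary: f) (auto intro: continuous_on_open_Un)

lemma smooth_on_cong:
  "open S \<Longrightarrow> (\<And>y. y \<in> S \<Longrightarrow> f y = g y) \<Longrightarrow> smooth_on S f \<longleftrightarrow> smooth_on S g"
  unfolding smooth_on_def using Ck_on_cong by metis

lemma smooth_on_subset: "smooth_on S f \<Longrightarrow> T \<subseteq> S \<Longrightarrow> smooth_on T f"
  unfolding smooth_on_def using Ck_on_subset by metis

lemma smooth_on_Un:
  "open S \<Longrightarrow> open T \<Longrightarrow> smooth_on S f \<Longrightarrow> smooth_on T f \<Longrightarrow> smooth_on (S \<union> T) f"
  unfolding smooth_on_def using Ck_on_Un by metis

lemma smooth_on_differentiable: "smooth_on S f \<Longrightarrow> x \<in> S \<Longrightarrow> f differentiable (at x)"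
  unfolding smooth_on_def by (drule spec[of _ "Suc 0"]) auto

lemma smooth_on_has_derivative: "smooth_on S f \<Longrightarrow> x \<in> S \<Longrightarrow> (f has_derivative dd f x) (at x)"
  by (simp add: smooth_on_differentiable has_derivative_dd)

lemma smooth_on_linear_dd: "smooth_on S f \<Longrightarrow> x \<in> S \<Longrightarrow> linear (dd f x)"
  by (simp add: smooth_on_differentiable linear_frechet_derivative)

lemma smooth_on_dd: "smooth_on S f \<Longrightarrow> smooth_on S (\<lambda>x. dd f x v)"
  unfolding smooth_on_def
proof
  fix k assume "\<forall>k. Ck_on k S f"
  hence "Ck_on (Suc k) S f" ..
  thus "Ck_on k S (\<lambda>x. dd f x v)" by simp
qed

lemma smooth_on_continuous: "smooth_on S f \<Longrightarrow> continuous_on S f"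
  unfolding smooth_on_def by (drule spec[of _ 0]) auto

lemma smooth_on_const: "smooth_on S (\<lambda>x. c)"
  by (simp add: smooth_on_def Ck_on_const)

lemma smooth_on_add: "open S \<Longrightarrow> smooth_on S f \<Longrightarrow> smooth_on S g \<Longrightarrow> smooth_on S (\<lambda>x. f x + g x)"
  by (simp add: smooth_on_def Ck_on_add)

lemma smooth_on_bilinear:
  "bounded_bilinear mul \<Longrightarrow> open S \<Longrightarrow> smooth_on S f \<Longrightarrow> smooth_on S g \<Longrightarrow>
    smooth_on S (\<lambda>x. mul (f x) (g x))"
  by (simp add: smooth_on_def Ck_on_bilinear)

lemma smooth_on_linear_compose:
  "bounded_linear l \<Longrightarrow> open S \<Longrightarrow> smooth_on S f \<Longrightarrow> smooth_on S (\<lambda>x. l (f x))"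
  by (simp add: smooth_on_def Ck_on_linear_compose)

lemma smooth_on_bounded_linear: "bounded_linear l \<Longrightarrow> smooth_on S l"
  by (simp add: smooth_on_def Ck_on_bounded_linear)

lemma smooth_on_sum:
  "open S \<Longrightarrow> (\<And>i. i \<in> I \<Longrightarrow> smooth_on S (f i)) \<Longrightarrow> smooth_on S (\<lambda>x. \<Sum>i\<in>I. f i x)"
  by (simp add: smooth_on_def Ck_on_sum)

lemma smooth_on_compose:
  fixes f :: "'b::euclidean_space \<Rightarrow> 'c::real_normed_vector" and g :: "'a::euclidean_space \<Rightarrow> 'b"
  assumes "open S" "open T" "\<And>x. x \<in> S \<Longrightarrow> g x \<in> T" "smooth_on T f" "smooth_on S g"
  shows "smooth_on S (\<lambda>x. f (g x))"
  unfolding smooth_on_def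
  using assms(4,5) Ck_on_compose[of S T g, OF assms(1-3)] unfolding smooth_on_def by blast

lemma smooth_on_id: "smooth_on S (\<lambda>x. x)"
  by (rule smooth_on_bounded_linear) (rule bounded_linear_ident)

lemma smooth_on_scaleR: "open S \<Longrightarrow> smooth_on S f \<Longrightarrow> smooth_on S g \<Longrightarrow> smooth_on S (\<lambda>x. f x *\<^sub>R g x)"
  by (rule smooth_on_bilinear[OF bounded_bilinear_scaleR])

lemma smooth_on_mult:
  fixes f g :: "_ \<Rightarrow> real"
  shows "open S \<Longrightarrow> smooth_on S f \<Longrightarrow> smooth_on S g \<Longrightarrow> smooth_on S (\<lambda>x. f x * g x)"
  by (rule smooth_on_bilinear[OF bounded_bilinear_mult])

lemma smooth_on_inner:
  "open S \<Longrightarrow> smooth_on S f \<Longrightarrow> smooth_on S g \<Longrightarrow> smooth_on S (\<lambda>x. f x \<bullet> g x)"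
  by (rule smooth_on_bilinear[OF bounded_bilinear_inner])

lemma smooth_on_scaleR_const: "open S \<Longrightarrow> smooth_on S f \<Longrightarrow> smooth_on S (\<lambda>x. r *\<^sub>R f x)"
  by (intro smooth_on_scaleR smooth_on_const)

lemma smooth_on_minus: "open S \<Longrightarrow> smooth_on S f \<Longrightarrow> smooth_on S (\<lambda>x. - f x)"
  by (rule smooth_on_linear_compose[OF bounded_linear_minus[OF bounded_linear_ident]])

lemma smooth_on_diff:
  "open S \<Longrightarrow> smooth_on S f \<Longrightarrow> smooth_on S g \<Longrightarrow> smooth_on S (\<lambda>x. f x - g x)"
  using smooth_on_add[of S f "\<lambda>x. - g x"] smooth_on_minus[of S g] by simp

lemma smooth_on_fst: "open S \<Longrightarrow> smooth_on S f \<Longrightarrow> smooth_on S (\<lambda>x. fst (f x))"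
  by (rule smooth_on_linear_compose[OF bounded_linear_fst])

lemma smooth_on_snd: "open S \<Longrightarrow> smooth_on S f \<Longrightarrow> smooth_on S (\<lambda>x. snd (f x))"
  by (rule smooth_on_linear_compose[OF bounded_linear_snd])

lemma smooth_on_Pair:
  assumes "open S" "smooth_on S f" "smooth_on S g"
  shows "smooth_on S (\<lambda>x. (f x, g x))"
proof -
  have "smooth_on S (\<lambda>x. (f x, 0) + (0, g x))"
    by (intro smooth_on_add assms smooth_on_linear_compose[of "\<lambda>u. (u, 0)"]
        smooth_on_linear_compose[of "\<lambda>u. (0, u)"] bounded_linear_intros)
  thus ?thesis by simp
qed

lemma smooth_on_base:
  fixes f :: "'a::euclidean_space \<Rightarrow> 'c::real_normed_vector"
  assumes "open S" "smooth_on S f"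
  shows "smooth_on (S \<times> (UNIV::'b::euclidean_space set)) (\<lambda>z. f (fst z))"
  by (rule smooth_on_compose[OF _ assms(1) _ assms(2)])
    (auto intro: open_Times assms smooth_on_bounded_linear bounded_linear_fst)

section \<open>Families of linear maps\<close>

text \<open>Linear maps are handled through their values on fixed vectors, without operator norms.
  In finite dimension this loses nothing, since a basis expansion reduces a moving argument to
  finitely many fixed ones.\<close>

lemma Ck_on_family:
  fixes L :: "'a::euclidean_space \<Rightarrow> 'b::euclidean_space \<Rightarrow> 'c::real_normed_vector"
  assumes "open S" "\<And>x. x \<in> S \<Longrightarrow> linear (L x)" "\<And>u. Ck_on k S (\<lambda>x. L x u)" "Ck_on k S s"
  shows "Ck_on k S (\<lambda>x. L x (s x))"
proof -
  have "Ck_on k S (\<lambda>x. \<Sum>b\<in>Basis. (s x \<bullet> b) *\<^sub>R L x b)"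
    by (intro Ck_on_sum Ck_on_bilinear[OF bounded_bilinear_scaleR] assms
        Ck_on_linear_compose[OF bounded_linear_inner_left])
  also have "?this \<longleftrightarrow> ?thesis"
    by (intro Ck_on_cong assms linear_expand[symmetric])
  finally show ?thesis .
qed

lemma smooth_on_family:
  fixes L :: "'a::euclidean_space \<Rightarrow> 'b::euclidean_space \<Rightarrow> 'c::real_normed_vector"
  assumes "open S" "\<And>x. x \<in> S \<Longrightarrow> linear (L x)" "\<And>u. smooth_on S (\<lambda>x. L x u)" "smooth_on S s"
  shows "smooth_on S (\<lambda>x. L x (s x))"
  using Ck_on_family[of S L _ s, OF assms(1,2)] assms(3,4) unfolding smooth_on_def by blast

text \<open>The family is linear only for base points in \<open>S\<close>, so additivity and
  homogeneity pass to the derivative by locality (\<open>dd_cong\<close>).\<close>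

lemma linear_dd_family:
  fixes L :: "'a::real_normed_vector \<Rightarrow> 'b::real_normed_vector \<Rightarrow> 'c::real_normed_vector"
  assumes "open S" "x \<in> S" "\<And>y. y \<in> S \<Longrightarrow> linear (L y)" "\<And>u. (\<lambda>y. L y u) differentiable (at x)"
  shows "linear (\<lambda>u. dd (\<lambda>y. L y u) x h)"
proof (rule linearI)
  fix u v :: 'b and r :: real
  have "dd (\<lambda>y. L y (u + v)) x = dd (\<lambda>y. L y u + L y v) x"
    by (rule dd_cong[OF assms(1,2)]) (simp add: linear_add assms(3))
  also have "\<dots> = (\<lambda>h. dd (\<lambda>y. L y u) x h + dd (\<lambda>y. L y v) x h)"
    by (intro dd_eq has_derivative_add has_derivative_dd assms)
  finally show "dd (\<lambda>y. L y (u + v)) x h = dd (\<lambda>y. L y u) x h + dd (\<lambda>y. L y v) x h" by simp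
  have "dd (\<lambda>y. L y (r *\<^sub>R u)) x = dd (\<lambda>y. r *\<^sub>R L y u) x"
    by (rule dd_cong[OF assms(1,2)]) (simp add: linear_scale assms(3))
  also have "\<dots> = (\<lambda>h. r *\<^sub>R dd (\<lambda>y. L y u) x h)"
    by (intro dd_eq has_derivative_scaleR_right has_derivative_dd assms)
  finally show "dd (\<lambda>y. L y (r *\<^sub>R u)) x h = r *\<^sub>R dd (\<lambda>y. L y u) x h" by simp
qed

lemma family_has_derivative:
  fixes L :: "'a::real_normed_vector \<Rightarrow> 'b::euclidean_space \<Rightarrow> 'c::real_normed_vector"
  assumes "open S" "x \<in> S" "\<And>y. y \<in> S \<Longrightarrow> linear (L y)" "\<And>u. (\<lambda>y. L y u) differentiable (at x)"
    and s: "(s has_derivative s') (at x)"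
  shows "((\<lambda>y. L y (s y)) has_derivative (\<lambda>h. dd (\<lambda>y. L y (s x)) x h + L x (s' h))) (at x)"
proof -
  have "((\<lambda>y. \<Sum>b\<in>Basis. (s y \<bullet> b) *\<^sub>R L y b) has_derivative
      (\<lambda>h. \<Sum>b\<in>Basis. (s x \<bullet> b) *\<^sub>R dd (\<lambda>y. L y b) x h + (s' h \<bullet> b) *\<^sub>R L x b)) (at x)"
    by (intro has_derivative_sum has_derivative_scaleR has_derivative_inner_left s
        has_derivative_dd assms)
  moreover have "(\<Sum>b\<in>Basis. (s x \<bullet> b) *\<^sub>R dd (\<lambda>y. L y b) x h + (s' h \<bullet> b) *\<^sub>R L x b) =
      dd (\<lambda>y. L y (s x)) x h + L x (s' h)" for h
    using linear_expand[OF linear_dd_family[OF assms(1-4), where h = h], where u = "s x"]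
      linear_expand[OF assms(3)[OF assms(2)], where u = "s' h"] by (simp add: sum.distrib)
  ultimately have "((\<lambda>y. \<Sum>b\<in>Basis. (s y \<bullet> b) *\<^sub>R L y b) has_derivative
      (\<lambda>h. dd (\<lambda>y. L y (s x)) x h + L x (s' h))) (at x)" by simp
  thus ?thesis
    by (rule has_derivative_transform_within_open[OF _ assms(1,2)])
      (rule linear_expand[OF assms(3), symmetric])
qed

lemma smooth_on_dd_family:
  assumes "open S" "smooth_on S f" "smooth_on S s"
  shows "smooth_on S (\<lambda>x. dd f x (s x))"
  by (rule smooth_on_family[where L = "dd f", OF assms(1) smooth_on_linear_dd[OF assms(2)]
        smooth_on_dd[OF assms(2)] assms(3)])

lemma smooth_on_family2:
  fixes B :: "'a::euclidean_space \<Rightarrow> 'b::euclidean_space \<Rightarrow> 'd::euclidean_space \<Rightarrow> 'c::real_normed_vector"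
  assumes "open S" "\<And>x. x \<in> S \<Longrightarrow> bilinear (B x)" "\<And>u v. smooth_on S (\<lambda>x. B x u v)"
    "smooth_on S s" "smooth_on S t"
  shows "smooth_on S (\<lambda>x. B x (s x) (t x))"
  by (rule smooth_on_family[where L = "\<lambda>x. B x (s x)", OF assms(1) _ smooth_on_family[where L = "\<lambda>x u. B x u _",
          OF assms(1) _ assms(3,4)] assms(5)])
    (use assms(2) in \<open>auto simp: bilinear_def\<close>)

lemma family2_has_derivative:
  fixes B :: "'a::euclidean_space \<Rightarrow> 'b::euclidean_space \<Rightarrow> 'd::euclidean_space \<Rightarrow> 'c::real_normed_vector"
  assumes "open S" "x \<in> S" "\<And>y. y \<in> S \<Longrightarrow> bilinear (B y)" "\<And>u v. (\<lambda>y. B y u v) differentiable (at x)"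
    and s: "(s has_derivative s') (at x)" and t: "(t has_derivative t') (at x)"
  shows "((\<lambda>y. B y (s y) (t y)) has_derivative
     (\<lambda>h. dd (\<lambda>y. B y (s x) (t x)) x h + B x (s' h) (t x) + B x (s x) (t' h))) (at x)"
proof -
  have 1: "((\<lambda>y. B y (s y) u) has_derivative
     (\<lambda>h. dd (\<lambda>y. B y (s x) u) x h + B x (s' h) u)) (at x)" for u
    by (rule family_has_derivative[where L = "\<lambda>y w. B y w u", OF assms(1,2) _ assms(4) s]) (use assms(3) in \<open>auto simp: bilinear_def\<close>)
  have "((\<lambda>y. B y (s y) (t y)) has_derivative
     (\<lambda>h. dd (\<lambda>y. B y (s y) (t x)) x h + B x (s x) (t' h))) (at x)"
    by (rule family_has_derivative[where L = "\<lambda>y. B y (s y)", OF assms(1,2) _ differentiableI[OF 1] t])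
      (use assms(3) in \<open>auto simp: bilinear_def\<close>)
  thus ?thesis using 1[of "t x"] by (simp add: dd_eq)
qed

section \<open>Symmetry of second derivatives\<close>

text \<open>The mean value theorem is applied twice: along \<open>u\<close> to the difference
  \<open>F\<close> of two parallel translates of \<open>f\<close>, then along \<open>v\<close> to
  the directional derivative \<open>dd f _ u\<close>.\<close>

lemma second_difference_mean_value:
  fixes f :: "'a::euclidean_space \<Rightarrow> real"
  assumes S: "open S" "smooth_on S f" and h: "h > 0"
    and box: "\<And>s t. 0 \<le> s \<Longrightarrow> s \<le> h \<Longrightarrow> 0 \<le> t \<Longrightarrow> t \<le> h \<Longrightarrow> x + s *\<^sub>R u + t *\<^sub>R v \<in> S"
  shows "\<exists>s t. 0 \<le> s \<and> s \<le> h \<and> 0 \<le> t \<and> t \<le> h \<and>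
    f (x + h *\<^sub>R u + h *\<^sub>R v) - f (x + h *\<^sub>R u) - f (x + h *\<^sub>R v) + f x =
      h * h * dd (\<lambda>y. dd f y u) (x + s *\<^sub>R u + t *\<^sub>R v) v"
proof -
  define F where "F s = f (x + s *\<^sub>R u + h *\<^sub>R v) - f (x + s *\<^sub>R u)" for s
  have line: "((\<lambda>s. k (z + s *\<^sub>R w)) has_field_derivative dd k (z + s *\<^sub>R w) w) (at s)"
    if "smooth_on S k" "z + s *\<^sub>R w \<in> S" for k :: "'a \<Rightarrow> real" and z w s
  proof -
    have "((\<lambda>s. k (z + s *\<^sub>R w)) has_derivative (\<lambda>r. dd k (z + s *\<^sub>R w) (r *\<^sub>R w))) (at s)"
      by (rule has_derivative_compose[of "\<lambda>s. z + s *\<^sub>R w" _ s UNIV k, simplified])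
        (auto intro!: derivative_eq_intros smooth_on_has_derivative[OF that])
    thus ?thesis
      using linear_scale[OF smooth_on_linear_dd[OF that]]
      by (simp add: has_field_derivative_def mult_commute_abs)
  qed
  have "\<exists>s. 0 < s \<and> s < h \<and>
      F h - F 0 = (h - 0) * (dd f (x + h *\<^sub>R v + s *\<^sub>R u) u - dd f (x + s *\<^sub>R u) u)"
  proof (rule MVT2[OF h])
    fix s assume s: "0 \<le> s" "s \<le> h"
    have *: "x + s *\<^sub>R u \<in> S" "(x + h *\<^sub>R v) + s *\<^sub>R u \<in> S"
      using box[of s 0] box[of s h] s h by (auto simp: algebra_simps)
    show "DERIV F s :> dd f (x + h *\<^sub>R v + s *\<^sub>R u) u - dd f (x + s *\<^sub>R u) u"
      using DERIV_diff[OF line[OF S(2) *(2)] line[OF S(2) *(1)]]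
      unfolding F_def by (simp add: algebra_simps)
  qed
  then obtain s where s: "0 < s" "s < h"
    "F h - F 0 = h * (dd f (x + s *\<^sub>R u + h *\<^sub>R v) u - dd f (x + s *\<^sub>R u) u)"
    by (auto simp: algebra_simps)
  have "\<exists>t. 0 < t \<and> t < h \<and> dd f (x + s *\<^sub>R u + h *\<^sub>R v) u - dd f (x + s *\<^sub>R u + 0 *\<^sub>R v) u =
      (h - 0) * dd (\<lambda>y. dd f y u) (x + s *\<^sub>R u + t *\<^sub>R v) v"
    by (rule MVT2[OF h], rule line[OF smooth_on_dd[OF S(2)]]) (use box s in auto)
  then obtain t where t: "0 < t" "t < h"
    "dd f (x + s *\<^sub>R u + h *\<^sub>R v) u - dd f (x + s *\<^sub>R u) u =
      h * dd (\<lambda>y. dd f y u) (x + s *\<^sub>R u + t *\<^sub>R v) v" by auto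
  show ?thesis
    using s t by (intro exI[of _ s] exI[of _ t]) (auto simp: F_def)
qed

text \<open>The second difference over a small parallelogram does not see the order of
  \<open>u\<close> and \<open>v\<close>, so the two mixed derivatives agree at two points close to
  \<open>x\<close>. Continuity carries this to \<open>x\<close>.\<close>

lemma symmetric_second_derivative_real:
  fixes f :: "'a::euclidean_space \<Rightarrow> real"
  assumes S: "open S" "x \<in> S" "smooth_on S f"
  shows "dd (\<lambda>y. dd f y u) x v = dd (\<lambda>y. dd f y v) x u" (is "?p x = ?q x")
proof (rule ccontr)
  \<comment> \<open>Half of the supposed gap: if both mixed derivatives vary by less than this near
    \<open>x\<close>, they cannot take a common value there.\<close>
  define e where "e = \<bar>?p x - ?q x\<bar> / 2"
  assume "\<not> ?thesis"
  hence e: "e > 0" by (simp add: e_def)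
  have c: "continuous_on S ?p" "continuous_on S ?q"
    by (intro smooth_on_continuous smooth_on_dd S)+
  obtain d where d: "d > 0" "ball x d \<subseteq> S"
    "\<And>y. dist y x < d \<Longrightarrow> \<bar>?p y - ?p x\<bar> < e" "\<And>y. dist y x < d \<Longrightarrow> \<bar>?q y - ?q x\<bar> < e"
  proof -
    obtain d0 where "d0 > 0" "ball x d0 \<subseteq> S" using S openE by blast
    moreover obtain d1 where "d1 > 0" "\<And>y. y \<in> S \<Longrightarrow> dist y x < d1 \<Longrightarrow> dist (?p y) (?p x) < e"
      using c(1) S(2) e unfolding continuous_on_iff by metis
    moreover obtain d2 where "d2 > 0" "\<And>y. y \<in> S \<Longrightarrow> dist y x < d2 \<Longrightarrow> dist (?q y) (?q x) < e"
      using c(2) S(2) e unfolding continuous_on_iff by metis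
    ultimately show ?thesis
      by (intro that[of "min d0 (min d1 d2)"]) (auto simp: dist_real_def dist_commute subset_iff)
  qed
  \<comment> \<open>Small enough that the parallelogram with sides \<open>h u\<close> and
    \<open>h v\<close> stays within distance \<open>d\<close> of \<open>x\<close>; the summand 1
    covers \<open>u = v = 0\<close>.\<close>
  define h where "h = d / (2 * (norm u + norm v + 1))"
  have h: "h > 0" using d by (simp add: h_def add_nonneg_pos)
  have near: "dist (x + s *\<^sub>R u + t *\<^sub>R v) x < d"
    if "0 \<le> s" "s \<le> h" "0 \<le> t" "t \<le> h" for s t
  proof -
    have "dist (x + s *\<^sub>R u + t *\<^sub>R v) x = norm (s *\<^sub>R u + t *\<^sub>R v)" by (simp add: dist_norm)
    also have "\<dots> \<le> s * norm u + t * norm v" by (rule norm_triangle_le) (use that in simp)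
    also have "\<dots> \<le> h * norm u + h * norm v" using that by (intro add_mono mult_right_mono) auto
    also have "\<dots> < 2 * (h * (norm u + norm v + 1))"
      using h by (simp add: algebra_simps add_nonneg_pos)
    also have "h * (norm u + norm v + 1) = d / 2"
      using norm_ge_zero[of u] norm_ge_zero[of v] by (simp add: h_def divide_simps del: norm_ge_zero)
    finally show ?thesis by simp
  qed
  have box: "x + s *\<^sub>R u + t *\<^sub>R v \<in> S" if "0 \<le> s" "s \<le> h" "0 \<le> t" "t \<le> h" for s t
    using near[OF that] d(2) by (auto simp: dist_commute)
  obtain s t where st: "0 \<le> s" "s \<le> h" "0 \<le> t" "t \<le> h"
    "f (x + h *\<^sub>R u + h *\<^sub>R v) - f (x + h *\<^sub>R u) - f (x + h *\<^sub>R v) + f x =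
      h * h * ?p (x + s *\<^sub>R u + t *\<^sub>R v)"
    using second_difference_mean_value[OF S(1,3) h box] by blast
  have "\<exists>s t. 0 \<le> s \<and> s \<le> h \<and> 0 \<le> t \<and> t \<le> h \<and>
    f (x + h *\<^sub>R v + h *\<^sub>R u) - f (x + h *\<^sub>R v) - f (x + h *\<^sub>R u) + f x =
      h * h * ?q (x + s *\<^sub>R v + t *\<^sub>R u)"
  proof (rule second_difference_mean_value[OF S(1,3) h])
    show "x + s *\<^sub>R v + t *\<^sub>R u \<in> S" if "0 \<le> s" "s \<le> h" "0 \<le> t" "t \<le> h" for s t
      using box[of t s] that by (simp add: algebra_simps)
  qed
  then obtain s' t' where st': "0 \<le> s'" "s' \<le> h" "0 \<le> t'" "t' \<le> h"
    "f (x + h *\<^sub>R v + h *\<^sub>R u) - f (x + h *\<^sub>R v) - f (x + h *\<^sub>R u) + f x =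
      h * h * ?q (x + s' *\<^sub>R v + t' *\<^sub>R u)" by blast
  have "h * h * ?p (x + s *\<^sub>R u + t *\<^sub>R v) = h * h * ?q (x + s' *\<^sub>R v + t' *\<^sub>R u)"
    using st(5) st'(5) by (simp add: algebra_simps)
  hence "?p (x + s *\<^sub>R u + t *\<^sub>R v) = ?q (x + t' *\<^sub>R u + s' *\<^sub>R v)"
    using h by (simp add: algebra_simps)
  moreover have "\<bar>?p (x + s *\<^sub>R u + t *\<^sub>R v) - ?p x\<bar> < e" using d(3) near st by blast
  moreover have "\<bar>?q (x + t' *\<^sub>R u + s' *\<^sub>R v) - ?q x\<bar> < e" using d(4) near st' by blast
  moreover have "2 * e = \<bar>?p x - ?q x\<bar>" by (simp add: e_def)
  ultimately show False by (smt (verit))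
qed

lemma dd_linear_compose:
  "bounded_linear l \<Longrightarrow> f differentiable (at x) \<Longrightarrow> dd (\<lambda>y. l (f y)) x v = l (dd f x v)"
  using bounded_linear.has_derivative[of l f "dd f x" "at x"] by (simp add: has_derivative_dd dd_eq)

lemma symmetric_second_derivative:
  fixes f :: "'a::euclidean_space \<Rightarrow> 'b::euclidean_space"
  assumes S: "open S" "x \<in> S" "smooth_on S f"
  shows "dd (\<lambda>y. dd f y u) x v = dd (\<lambda>y. dd f y v) x u"
proof (rule euclidean_eqI)
  fix b :: 'b
  have *: "dd (\<lambda>y. dd f y u) x v \<bullet> b = dd (\<lambda>y. dd (\<lambda>y. f y \<bullet> b) y u) x v" for u v
  proof -
    have "dd (\<lambda>y. dd f y u) x v \<bullet> b = dd (\<lambda>y. dd f y u \<bullet> b) x v"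
      by (rule dd_linear_compose[symmetric, OF bounded_linear_inner_left])
        (rule smooth_on_differentiable[OF smooth_on_dd[OF S(3)] S(2)])
    also have "\<dots> = dd (\<lambda>y. dd (\<lambda>y. f y \<bullet> b) y u) x v"
      by (intro fun_cong[OF dd_cong[OF S(1,2)]] dd_linear_compose[symmetric, OF bounded_linear_inner_left])
        (rule smooth_on_differentiable[OF S(3)])
    finally show ?thesis .
  qed
  show "dd (\<lambda>y. dd f y u) x v \<bullet> b = dd (\<lambda>y. dd f y v) x u \<bullet> b"
    unfolding * by (rule symmetric_second_derivative_real[OF S(1,2)])
      (intro smooth_on_inner S smooth_on_const)
qed


section \<open>Solutions of smooth families of linear equations\<close>

text \<open>Injectivity at one point is a quantitative bound, and a perturbation of size at most
  half of it leaves the other half. This uniform bound replaces the inverse maps in the regularity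
  proofs below.\<close>

lemma inj_family_lower_bound:
  fixes L :: "'a::euclidean_space \<Rightarrow> 'b::euclidean_space \<Rightarrow> 'b"
  assumes S: "open S" "x \<in> S" and lin: "\<And>y. y \<in> S \<Longrightarrow> linear (L y)" and inj: "inj (L x)"
    and cont: "\<And>u. continuous_on S (\<lambda>y. L y u)"
  obtains m d where "m > 0" "d > 0" "ball x d \<subseteq> S" "\<And>y w. y \<in> ball x d \<Longrightarrow> m * norm w \<le> norm (L y w)"
proof -
  obtain m where m: "m > 0" "\<And>w. m * norm w \<le> norm (L x w)"
    using linear_inj_bounded_below_pos[OF lin[OF S(2)] inj] by metis
  \<comment> \<open>A substitute for the operator norm of \<open>L y - L x\<close>, continuous
    because only values on basis vectors enter.\<close>
  define e where "e y = (\<Sum>b\<in>Basis. norm (L y b - L x b))" for y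
  have "continuous_on S e"
    unfolding e_def by (intro continuous_intros cont)
  moreover have "e x = 0" by (simp add: e_def)
  ultimately obtain d1 where d1: "d1 > 0" "\<And>y. y \<in> S \<Longrightarrow> dist y x < d1 \<Longrightarrow> \<bar>e y\<bar> < m / 2"
    using S(2) m unfolding continuous_on_iff dist_real_def
    by (metis diff_zero half_gt_zero)
  obtain d2 where d2: "d2 > 0" "ball x d2 \<subseteq> S" using S openE by blast
  have "m / 2 * norm w \<le> norm (L y w)" if y: "y \<in> ball x (min d1 d2)" for y w
  proof -
    have yS: "y \<in> S" using y d2 by auto
    have "L y w - L x w = (\<Sum>b\<in>Basis. (w \<bullet> b) *\<^sub>R (L y b - L x b))"
      using linear_expand[OF lin[OF yS], of w] linear_expand[OF lin[OF S(2)], of w]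
      by (simp add: sum_subtractf scaleR_diff_right)
    also have "norm \<dots> \<le> (\<Sum>b\<in>Basis. norm w * norm (L y b - L x b))"
      by (rule sum_norm_le) (auto intro!: mult_right_mono simp: Basis_le_norm)
    also have "\<dots> = norm w * e y" by (simp add: e_def sum_distrib_left)
    also have "\<dots> \<le> norm w * (m / 2)"
      using d1(2)[OF yS] y by (intro mult_left_mono) (auto simp: dist_commute)
    finally have "norm (L y w - L x w) \<le> norm w * (m / 2)" .
    moreover have "norm (L x w) \<le> norm (L y w) + norm (L y w - L x w)"
      by (metis norm_minus_commute norm_triangle_sub)
    ultimately have "norm (L x w) \<le> norm (L y w) + norm w * (m / 2)" by linarith
    with m(2)[of w] show ?thesis by (simp add: algebra_simps)
  qed
  moreover have "ball x (min d1 d2) \<subseteq> S" using d2 by auto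
  ultimately show ?thesis using that[of "m / 2" "min d1 d2"] m(1) d1(1) d2(1) by simp
qed

text \<open>By the lower bound, \<open>norm (s y - s x)\<close> is controlled by
  \<open>L y (s y) - L y (s x)\<close>, whose two terms have the same limit at
  \<open>x\<close>.\<close>

lemma family_solution_continuous:
  fixes L :: "'a::euclidean_space \<Rightarrow> 'b::euclidean_space \<Rightarrow> 'b"
  assumes S: "open S" and lin: "\<And>y. y \<in> S \<Longrightarrow> linear (L y)" and inj: "\<And>y. y \<in> S \<Longrightarrow> inj (L y)"
    and cont: "\<And>u. continuous_on S (\<lambda>y. L y u)" and r: "continuous_on S (\<lambda>y. L y (s y))"
  shows "continuous_on S s"
proof -
  have "isCont s x" if x: "x \<in> S" for x
  proof -
    obtain m d where md: "m > 0" "d > 0" "ball x d \<subseteq> S"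
      "\<And>y w. y \<in> ball x d \<Longrightarrow> m * norm w \<le> norm (L y w)"
      using inj_family_lower_bound[of S x L, OF S x lin inj[OF x] cont] by blast
    define H where "H y = norm (L y (s y) - L y (s x)) / m" for y
    have "isCont H x"
      using r cont[of "s x"] S x md(1) unfolding H_def
      by (intro continuous_intros) (auto simp: continuous_on_eq_continuous_at)
    hence "(H \<longlongrightarrow> 0) (at x)" by (simp add: isCont_def H_def)
    moreover have "\<forall>\<^sub>F y in at x. norm (s y - s x) \<le> H y"
      unfolding eventually_at
    proof (intro exI[of _ d] conjI md ballI impI)
      fix y assume "y \<noteq> x \<and> dist y x < d"
      hence y: "y \<in> ball x d" by (simp add: dist_commute)
      with md have "m * norm (s y - s x) \<le> norm (L y (s y - s x))" by blast
      also have "L y (s y - s x) = L y (s y) - L y (s x)"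
        using y md lin by (intro linear_diff) auto
      finally show "norm (s y - s x) \<le> H y" using md by (simp add: H_def field_simps)
    qed
    ultimately have "((\<lambda>y. s y - s x) \<longlongrightarrow> 0) (at x)"
      by (rule Lim_null_comparison[rotated])
    thus ?thesis by (simp add: isCont_def LIM_zero_cancel)
  qed
  thus ?thesis by (simp add: continuous_at_imp_continuous_on)
qed

text \<open>Formal differentiation of the equation predicts the derivative of \<open>s\<close>. The
  affine map with that derivative solves the equation up to first order, and the lower bound turns a
  small residual into a small error of \<open>s\<close>.\<close>

lemma family_solution_differentiable:
  fixes L :: "'a::euclidean_space \<Rightarrow> 'b::euclidean_space \<Rightarrow> 'b"
  assumes S: "open S" "x \<in> S" and lin: "\<And>y. y \<in> S \<Longrightarrow> linear (L y)" and inj: "inj (L x)"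
    and diff: "\<And>u y. y \<in> S \<Longrightarrow> (\<lambda>y. L y u) differentiable (at y)"
    and r: "(\<lambda>y. L y (s y)) differentiable (at x)"
  shows "s differentiable (at x)"
proof -
  have cont: "continuous_on S (\<lambda>y. L y u)" for u
    using diff by (auto intro!: continuous_at_imp_continuous_on differentiable_imp_continuous_within)
  obtain m d where md: "m > 0" "d > 0" "ball x d \<subseteq> S"
    "\<And>y w. y \<in> ball x d \<Longrightarrow> m * norm w \<le> norm (L y w)"
    using inj_family_lower_bound[of S x L, OF S lin inj cont] by blast
  obtain i where i: "linear i" "\<And>w. L x (i w) = w"
    using linear_surjective_right_inverse[OF lin[OF S(2)]]
      linear_injective_imp_surjective[OF lin[OF S(2)] inj] by (metis comp_apply id_apply)
  define r' where "r' = dd (\<lambda>y. L y (s y)) x"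
  \<comment> \<open>The predicted derivative: the solution of
    \<open>L x (l h) = r' h - L' (s x)\<close>, with \<open>L'\<close> the derivative of the family
    in direction \<open>h\<close>.\<close>
  define l where "l h = i (r' h - dd (\<lambda>y. L y (s x)) x h)" for h
  have r'lin: "linear r'" unfolding r'_def by (rule linear_frechet_derivative[OF r])
  have "linear (\<lambda>h. r' h - dd (\<lambda>y. L y (s x)) x h)"
    using S by (intro linear_compose_sub r'lin linear_frechet_derivative diff)
  from linear_compose[OF this i(1)] have "linear l" by (simp add: l_def[abs_def] o_def)
  hence bl: "bounded_linear l" by (simp add: linear_conv_bounded_linear)
  define q where "q y = s x + l (y - x)" for y
  have q: "(q has_derivative l) (at x)"
    unfolding q_def by (auto intro!: derivative_eq_intros bounded_linear.has_derivative[OF bl])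
  \<comment> \<open>The residual of the affine approximation \<open>q\<close>; the choice of
    \<open>l\<close> makes its derivative at \<open>x\<close> zero.\<close>
  define e where "e y = L y (s y) - L y (q y)" for y
  have "(e has_derivative (\<lambda>h. r' h - (dd (\<lambda>y. L y (q x)) x h + L x (l h)))) (at x)"
    unfolding e_def r'_def using S
    by (intro has_derivative_diff has_derivative_dd[OF r] family_has_derivative[OF S lin diff q])
  moreover have "q x = s x" using linear_0[OF \<open>linear l\<close>] by (simp add: q_def)
  ultimately have "(e has_derivative (\<lambda>h. 0)) (at x)" by (simp add: l_def i)
  hence e: "((\<lambda>y. norm (e y - e x - 0) / norm (y - x)) \<longlongrightarrow> 0) (at x)"
    by (simp add: has_derivative_iff_norm)
  have e0: "e x = 0" using \<open>q x = s x\<close> by (simp add: e_def)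
  have "(s has_derivative l) (at x)"
  proof (rule has_derivativeI_sandwich[OF md(2) bl])
    show "((\<lambda>y. norm (e y - e x - 0) / norm (y - x) / m) \<longlongrightarrow> 0) (at x)"
      using tendsto_divide[OF e tendsto_const[of m]] md by simp
    fix y assume y: "y \<noteq> x" "dist y x < d"
    hence yb: "y \<in> ball x d" by (simp add: dist_commute)
    have "m * norm (s y - q y) \<le> norm (L y (s y - q y))" by (rule md(4)[OF yb])
    also have "L y (s y - q y) = e y"
      unfolding e_def using yb md lin by (intro linear_diff) auto
    finally have "norm (s y - q y) \<le> norm (e y) / m" using md by (simp add: field_simps)
    hence "norm (s y - q y) / norm (y - x) \<le> norm (e y) / m / norm (y - x)"
      by (rule divide_right_mono) simp
    thus "norm (s y - s x - l (y - x)) / norm (y - x) \<le> norm (e y - e x - 0) / norm (y - x) / m"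
      by (simp add: q_def e0 diff_diff_eq mult.commute)
  qed
  thus ?thesis by (rule differentiableI)
qed

text \<open>Differentiating \<open>L (s) = r\<close> gives \<open>L (s') = r' - L' (s)\<close>, so regularity bootstraps.\<close>

lemma Ck_on_family_solution:
  fixes L :: "'a::euclidean_space \<Rightarrow> 'b::euclidean_space \<Rightarrow> 'b"
  assumes S: "open S" and lin: "\<And>y. y \<in> S \<Longrightarrow> linear (L y)" and inj: "\<And>y. y \<in> S \<Longrightarrow> inj (L y)"
    and sm: "\<And>u. smooth_on S (\<lambda>y. L y u)"
  shows "Ck_on k S (\<lambda>y. L y (s y)) \<Longrightarrow> Ck_on k S s"
proof (induction k arbitrary: s)
  case 0
  then show ?case
    using family_solution_continuous[of S L s, OF S lin inj smooth_on_continuous[OF sm]] by simp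
next
  case (Suc k)
  have s: "Ck_on k S s" by (rule Suc.IH[OF Ck_on_SucD[OF Suc.prems]])
  have dr: "(\<lambda>y. L y (s y)) differentiable (at x)" if "x \<in> S" for x
    using Suc.prems that by simp
  have ds: "s differentiable (at x)" if "x \<in> S" for x
    by (rule family_solution_differentiable[of S x L s, OF S that lin inj[OF that] _ dr[OF that]])
      (auto intro: smooth_on_differentiable[OF sm])
  have eq: "dd (\<lambda>y. L y (s y)) x v - dd (\<lambda>y. L y (s x)) x v = L x (dd s x v)" if x: "x \<in> S" for x v
    using dd_eq[OF family_has_derivative[of S x L s, OF S x lin smooth_on_differentiable[OF sm x]
        has_derivative_dd[OF ds[OF x]]]] by simp
  have "Ck_on k S (\<lambda>x. dd s x v)" for v
  proof (rule Suc.IH)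
    have "Ck_on k S (\<lambda>x. dd (\<lambda>y. L y (s x)) x v)"
    proof (rule Ck_on_family[where L = "\<lambda>x u. dd (\<lambda>y. L y u) x v", OF S _ _ s])
      show "linear (\<lambda>u. dd (\<lambda>y. L y u) x v)" if "x \<in> S" for x
        by (rule linear_dd_family[OF S that lin smooth_on_differentiable[OF sm that]])
      show "Ck_on k S (\<lambda>x. dd (\<lambda>y. L y u) x v)" for u
        using smooth_on_dd[OF sm] by (simp add: smooth_on_def)
    qed
    from Ck_on_linear_compose[OF bounded_linear_minus[OF bounded_linear_ident] S this]
    have "Ck_on k S (\<lambda>x. dd (\<lambda>y. L y (s y)) x v + - dd (\<lambda>y. L y (s x)) x v)"
      using Suc.prems by (intro Ck_on_add S) auto
    also have "?this \<longleftrightarrow> Ck_on k S (\<lambda>x. L x (dd s x v))"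
      by (rule Ck_on_cong[OF S]) (use eq in auto)
    finally show "Ck_on k S (\<lambda>x. L x (dd s x v))" .
  qed
  with ds show ?case by simp
qed

lemma smooth_on_family_solution:
  fixes L :: "'a::euclidean_space \<Rightarrow> 'b::euclidean_space \<Rightarrow> 'b"
  assumes "open S" "\<And>y. y \<in> S \<Longrightarrow> linear (L y)" "\<And>y. y \<in> S \<Longrightarrow> inj (L y)"
    "\<And>u. smooth_on S (\<lambda>y. L y u)" "smooth_on S (\<lambda>y. L y (s y))"
  shows "smooth_on S s"
  using Ck_on_family_solution[of S L _ s, OF assms(1-4)] assms(5) unfolding smooth_on_def by blast

section \<open>Connections and their curvature in coordinates\<close>

text \<open>The direction and the differentiated value may live in different spaces. Thus the same
  notion serves Christoffel symbols and a connection written in a moving frame, where directions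
  keep their coordinate components.\<close>

definition nab where
  "nab \<omega> V s = (\<lambda>z. dd s z (V z) + \<omega> z (V z) (s z))"

definition bracket where
  "bracket V W = (\<lambda>z. dd W z (V z) - dd V z (W z))"

definition field_curv where
  "field_curv \<omega> V W s = (\<lambda>z. nab \<omega> V (nab \<omega> W s) z - nab \<omega> W (nab \<omega> V s) z - nab \<omega> (bracket V W) s z)"

definition curv where
  "curv \<omega> z u v w = dd (\<lambda>y. \<omega> y v w) z u - dd (\<lambda>y. \<omega> y u w) z v + \<omega> z u (\<omega> z v w) - \<omega> z v (\<omega> z u w)"

lemma nab_has_derivative:
  fixes \<omega> :: "'f::euclidean_space \<Rightarrow> 'f \<Rightarrow> 'h::euclidean_space \<Rightarrow> 'h"
  assumes S: "open S" "z \<in> S" and bil: "\<And>z. z \<in> S \<Longrightarrow> bilinear (\<omega> z)"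
    and sm: "\<And>u v. smooth_on S (\<lambda>z. \<omega> z u v)" and V: "smooth_on S V" and s: "smooth_on S s"
  shows "(nab \<omega> V s has_derivative (\<lambda>h. dd (\<lambda>y. dd s y (V z)) z h + dd s z (dd V z h) +
    (dd (\<lambda>y. \<omega> y (V z) (s z)) z h + \<omega> z (dd V z h) (s z) + \<omega> z (V z) (dd s z h)))) (at z)"
  unfolding nab_def
  by (intro has_derivative_add family_has_derivative[where L = "dd s" and s = V, OF S]
      family2_has_derivative[where B = \<omega>, OF S bil] smooth_on_has_derivative[OF V S(2)]
      smooth_on_has_derivative[OF s S(2)] smooth_on_differentiable[OF sm S(2)]
      smooth_on_linear_dd[OF s] smooth_on_differentiable[OF smooth_on_dd[OF s] S(2)])

text \<open>Tensoriality: the second derivatives of \<open>s\<close> cancel by their symmetry, and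
  the terms with derivatives of \<open>V\<close> and \<open>W\<close> are those of the bracket. What
  remains depends on the values at \<open>z\<close> alone.\<close>

lemma field_curv_eq:
  fixes \<omega> :: "'f::euclidean_space \<Rightarrow> 'f \<Rightarrow> 'h::euclidean_space \<Rightarrow> 'h"
  assumes S: "open S" "z \<in> S" and bil: "\<And>z. z \<in> S \<Longrightarrow> bilinear (\<omega> z)"
    and sm: "\<And>u v. smooth_on S (\<lambda>z. \<omega> z u v)" and V: "smooth_on S V" and W: "smooth_on S W"
    and s: "smooth_on S s"
  shows "field_curv \<omega> V W s z = curv \<omega> z (V z) (W z) (s z)"
proof -
  have nd: "(nab \<omega> V s has_derivative (\<lambda>h. dd (\<lambda>y. dd s y (V z)) z h + dd s z (dd V z h) +
    (dd (\<lambda>y. \<omega> y (V z) (s z)) z h + \<omega> z (dd V z h) (s z) + \<omega> z (V z) (dd s z h)))) (at z)"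
    if "smooth_on S V" "smooth_on S s" for V s
    by (rule nab_has_derivative[OF S bil sm that])
  have "dd (\<lambda>y. dd s y (W z)) z (V z) = dd (\<lambda>y. dd s y (V z)) z (W z)"
    by (rule symmetric_second_derivative[OF S s])
  moreover have "field_curv \<omega> V W s z =
      dd (nab \<omega> W s) z (V z) + \<omega> z (V z) (nab \<omega> W s z)
      - (dd (nab \<omega> V s) z (W z) + \<omega> z (W z) (nab \<omega> V s z)) - nab \<omega> (bracket V W) s z"
    by (simp add: field_curv_def nab_def)
  ultimately show ?thesis
    using smooth_on_linear_dd[OF s S(2)] bil[OF S(2)]
    unfolding dd_eq[OF nd[OF W s]] dd_eq[OF nd[OF V s]]
    by (simp add: nab_def bracket_def curv_def linear_diff bilinear_ladd bilinear_lsub bilinear_rsub bilinear_radd)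
qed

lemma smooth_on_nab:
  fixes \<omega> :: "'f::euclidean_space \<Rightarrow> 'f \<Rightarrow> 'h::euclidean_space \<Rightarrow> 'h"
  assumes "open S" "\<And>z. z \<in> S \<Longrightarrow> bilinear (\<omega> z)" "\<And>u v. smooth_on S (\<lambda>z. \<omega> z u v)"
    "smooth_on S V" "smooth_on S s"
  shows "smooth_on S (nab \<omega> V s)"
  unfolding nab_def
  by (intro assms smooth_on_add smooth_on_dd_family smooth_on_family2[where B = \<omega>])

lemma curv_antisym: "curv \<omega> z u v w = - curv \<omega> z v u w"
  by (simp add: curv_def)

lemma smooth_on_curv:
  fixes \<omega> :: "'f::euclidean_space \<Rightarrow> 'f \<Rightarrow> 'h::euclidean_space \<Rightarrow> 'h"
  assumes "open S" "\<And>z. z \<in> S \<Longrightarrow> bilinear (\<omega> z)" "\<And>u v. smooth_on S (\<lambda>z. \<omega> z u v)"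
  shows "smooth_on S (\<lambda>z. curv \<omega> z u v w)"
  unfolding curv_def
  by (intro assms smooth_on_add smooth_on_diff smooth_on_dd smooth_on_const smooth_on_family2[where B = \<omega>])

lemma curv_linear:
  fixes \<omega> :: "'f::euclidean_space \<Rightarrow> 'f \<Rightarrow> 'h::euclidean_space \<Rightarrow> 'h"
  assumes S: "open S" "z \<in> S" and bil: "\<And>z. z \<in> S \<Longrightarrow> bilinear (\<omega> z)"
    and sm: "\<And>u v. smooth_on S (\<lambda>z. \<omega> z u v)"
  shows "linear (\<lambda>u. curv \<omega> z u v w)" "linear (\<lambda>v. curv \<omega> z u v w)" "linear (\<lambda>w. curv \<omega> z u v w)"
proof -
  have b: "linear (\<lambda>w. \<omega> y v w)" "linear (\<lambda>v. \<omega> y v w)" if "y \<in> S" for y v w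
    using bil[OF that] by (auto simp: bilinear_def)
  have d1: "linear (\<lambda>v. dd (\<lambda>y. \<omega> y v w) z h)" for w h
    by (rule linear_dd_family[where L = "\<lambda>y v. \<omega> y v w", OF S b(2) smooth_on_differentiable[OF sm S(2)]])
  have d2: "linear (\<lambda>w. dd (\<lambda>y. \<omega> y v w) z h)" for v h
    by (rule linear_dd_family[where L = "\<lambda>y w. \<omega> y v w", OF S b(1) smooth_on_differentiable[OF sm S(2)]])
  have d3: "linear (dd (\<lambda>y. \<omega> y v w) z)" for v w
    by (rule smooth_on_linear_dd[OF sm S(2)])
  have c1: "linear (\<lambda>w. \<omega> z u (\<omega> z v w))" for u v
    using linear_compose[OF b(1)[OF S(2), of v] b(1)[OF S(2), of u]] by (simp add: o_def)
  have c2: "linear (\<lambda>v. \<omega> z u (\<omega> z v w))" for u w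
    using linear_compose[OF b(2)[OF S(2), of w] b(1)[OF S(2), of u]] by (simp add: o_def)
  show 2: "linear (\<lambda>v. curv \<omega> z u v w)" for u
    unfolding curv_def
    by (rule linear_compose_sub[OF linear_compose_add[OF linear_compose_sub[OF d1 d3] c2] b(2)[OF S(2)]])
  show "linear (\<lambda>w. curv \<omega> z u v w)"
    unfolding curv_def
    by (rule linear_compose_sub[OF linear_compose_add[OF linear_compose_sub[OF d2 d2] c1] c1])
  have "linear (\<lambda>u. - curv \<omega> z v u w)" by (rule linear_compose_neg[OF 2])
  also have "(\<lambda>u. - curv \<omega> z v u w) = (\<lambda>u. curv \<omega> z u v w)"
    by (rule ext) (simp add: curv_def)
  finally show "linear (\<lambda>u. curv \<omega> z u v w)" .
qed

section \<open>Riemannian metrics on open sets\<close>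

text \<open>The description behind \<open>christoffel\<close>, freed from atlases, so that it can be
  applied to an explicit metric on an open set of the coordinate space of the tangent
  bundle.\<close>

definition levi_civita :: "('e::euclidean_space \<Rightarrow> 'e \<Rightarrow> 'e \<Rightarrow> real) \<Rightarrow> 'e \<Rightarrow> 'e \<Rightarrow> 'e \<Rightarrow> 'e" where
  "levi_civita gm x = (THE \<Gamma>. bilinear \<Gamma> \<and> (\<forall>u v. \<Gamma> u v = \<Gamma> v u) \<and>
     (\<forall>w u v. dd (\<lambda>x'. gm x' u v) x w = gm x (\<Gamma> w u) v + gm x u (\<Gamma> w v)))"

lemma christoffel_levi_civita: "christoffel A k c x = levi_civita (tensor2_comp A k c) x"
  by (simp add: christoffel_def levi_civita_def)

locale local_metric =
  fixes S :: "'e::euclidean_space set" and gm :: "'e \<Rightarrow> 'e \<Rightarrow> 'e \<Rightarrow> real"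
  assumes open_S: "open S"
    and bil: "x \<in> S \<Longrightarrow> bilinear (gm x)"
    and sym: "x \<in> S \<Longrightarrow> gm x u v = gm x v u"
    and pos: "x \<in> S \<Longrightarrow> u \<noteq> 0 \<Longrightarrow> gm x u u > 0"
    and smooth: "smooth_on S (\<lambda>x. gm x u v)"
begin

abbreviation \<Gamma> :: "'e \<Rightarrow> 'e \<Rightarrow> 'e \<Rightarrow> 'e" where "\<Gamma> \<equiv> levi_civita gm"

abbreviation R :: "'e \<Rightarrow> 'e \<Rightarrow> 'e \<Rightarrow> 'e \<Rightarrow> 'e" where "R \<equiv> curv \<Gamma>"

lemma lin: "x \<in> S \<Longrightarrow> linear (gm x u)" "x \<in> S \<Longrightarrow> linear (\<lambda>u. gm x u v)"
  using bil by (auto simp: bilinear_def)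

lemma nondegenerate:
  assumes "x \<in> S" "\<And>w. gm x s w = 0"
  shows "s = 0"
  using pos[OF assms(1), of s] assms(2)[of s] by auto

lemma eq_if_gm_eq:
  assumes "x \<in> S" "\<And>w. gm x s w = gm x t w"
  shows "s = t"
  using nondegenerate[OF assms(1), of "s - t"] assms by (simp add: bilinear_lsub bil)

text \<open>The musical isomorphism as an endomorphism of the model space. It turns the defining
  equations of the Christoffel symbols into a linear system with smooth coefficients.\<close>

definition flat_map :: "'e \<Rightarrow> 'e \<Rightarrow> 'e" where
  "flat_map x u = (\<Sum>b\<in>Basis. gm x u b *\<^sub>R b)"

lemma flat_map_inner: "b \<in> Basis \<Longrightarrow> flat_map x u \<bullet> b = gm x u b"
  by (simp add: flat_map_def inner_sum_left inner_Basis if_distrib sum.delta cong: if_cong)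

lemma linear_flat_map: "x \<in> S \<Longrightarrow> linear (flat_map x)"
  by (rule linearI)
    (simp_all add: flat_map_def bilinear_ladd[OF bil] bilinear_lmul[OF bil] scaleR_add_left
      sum.distrib scaleR_sum_right)

lemma linear_eq_on_Basis:
  assumes "linear (f :: 'e \<Rightarrow> real)" "linear h" "\<And>b. b \<in> Basis \<Longrightarrow> f b = h b"
  shows "f w = h w"
  using linear_expand[OF assms(1), of w] linear_expand[OF assms(2), of w] assms(3) by simp

lemma inj_flat_map: assumes "x \<in> S" shows "inj (flat_map x)"
proof -
  have "u = 0" if "flat_map x u = 0" for u
  proof (rule nondegenerate[OF assms])
    show "gm x u w = 0" for w
    proof (rule linear_eq_on_Basis[OF lin(1)[OF assms] linear_zero])
      show "gm x u b = 0" if "b \<in> Basis" for b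
        using flat_map_inner[OF that, of x u] \<open>flat_map x u = 0\<close> by simp
    qed
  qed
  thus ?thesis using linear_injective_0[OF linear_flat_map[OF assms]] by blast
qed

lemma riesz:
  assumes "x \<in> S" "linear K"
  shows "\<exists>s. \<forall>w. gm x s w = K w"
proof -
  have "surj (flat_map x)"
    by (rule linear_injective_imp_surjective[OF linear_flat_map[OF assms(1)] inj_flat_map[OF assms(1)]]) simp
  then obtain s where s: "flat_map x s = (\<Sum>b\<in>Basis. K b *\<^sub>R b)" by (metis surj_def)
  have "gm x s b = K b" if "b \<in> Basis" for b
    using flat_map_inner[OF that, of x s] that unfolding s
    by (simp add: inner_sum_left inner_Basis if_distrib sum.delta cong: if_cong)
  thus ?thesis using linear_eq_on_Basis[OF lin(1)[OF assms(1)] assms(2)] by blast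
qed

text \<open>Symmetric in the first two slots and skew in the last two: going alternately through the
  two kinds of swaps returns to the start with the opposite sign. This is the only uniqueness
  argument used; it gives the connection, its transformation law and its form in the orthogonal
  frame.\<close>

lemma skew_symmetric_zero:
  assumes x: "x \<in> S" and "\<And>u v. T u v = T v u" "\<And>w u v. gm x (T w u) v + gm x u (T w v) = 0"
  shows "T u v = 0"
proof (rule nondegenerate[OF x])
  fix w
  have skew: "gm x (T p q) r = - gm x (T p r) q" for p q r
    using assms(3)[of p q r] sym[OF x] by (metis add_eq_0_iff add.commute)
  show "gm x (T u v) w = 0"
    using skew[of u v w] skew[of w u v] skew[of v w u] assms(2) by (metis equal_neg_zero minus_minus)
qed

lemma linear_dd_gm:
  "x \<in> S \<Longrightarrow> linear (\<lambda>u. dd (\<lambda>x. gm x u v) x h)" "x \<in> S \<Longrightarrow> linear (\<lambda>v. dd (\<lambda>x. gm x u v) x h)"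
  "x \<in> S \<Longrightarrow> linear (dd (\<lambda>x. gm x u v) x)"
  using linear_dd_family[where L = "\<lambda>x u. gm x u v", OF open_S _ lin(2) smooth_on_differentiable[OF smooth]]
    linear_dd_family[where L = "\<lambda>x v. gm x u v", OF open_S _ lin(1) smooth_on_differentiable[OF smooth]]
    smooth_on_linear_dd[OF smooth] by auto

text \<open>Koszul's formula for constant fields, whose brackets vanish.\<close>

definition koszul :: "'e \<Rightarrow> 'e \<Rightarrow> 'e \<Rightarrow> 'e \<Rightarrow> real" where
  "koszul x u v w = (dd (\<lambda>x. gm x v w) x u + dd (\<lambda>x. gm x u w) x v - dd (\<lambda>x. gm x u v) x w) / 2"

lemma koszul_scaleR:
  "koszul x u v w = (1 / 2) *\<^sub>R (dd (\<lambda>x. gm x v w) x u + dd (\<lambda>x. gm x u w) x v - dd (\<lambda>x. gm x u v) x w)"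
  by (simp add: koszul_def)

lemma linear_koszul:
  assumes "x \<in> S"
  shows "linear (\<lambda>u. koszul x u v w)" "linear (\<lambda>v. koszul x u v w)" "linear (\<lambda>w. koszul x u v w)"
  unfolding koszul_scaleR
  by (intro linear_compose_scale_right linear_compose_add linear_compose_sub linear_dd_gm[OF assms])+

lemma dd_gm_sym: "x \<in> S \<Longrightarrow> dd (\<lambda>x. gm x u v) x = dd (\<lambda>x. gm x v u) x"
  by (rule dd_cong[OF open_S]) (auto intro: sym)

text \<open>Licenses the description operator. Existence represents the Koszul form by a vector in
  each case; for uniqueness, the difference of two candidates meets the hypotheses of
  \<open>skew_symmetric_zero\<close>.\<close>

lemma levi_civita_ex1:
  assumes x: "x \<in> S"
  shows "\<exists>!\<Gamma>. bilinear \<Gamma> \<and> (\<forall>u v. \<Gamma> u v = \<Gamma> v u) \<and>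
     (\<forall>w u v. dd (\<lambda>x'. gm x' u v) x w = gm x (\<Gamma> w u) v + gm x u (\<Gamma> w v))"
proof (rule ex_ex1I)
  have "\<forall>u v. \<exists>s. \<forall>w. gm x s w = koszul x u v w"
    using riesz[OF x linear_koszul(3)[OF x]] by blast
  then obtain C where C: "\<And>u v w. gm x (C u v) w = koszul x u v w" by metis
  have "bilinear C"
    unfolding bilinear_def
  proof (intro conjI allI linearI)
    note eqI = eq_if_gm_eq[OF x] and ks = linear_koszul[OF x, THEN linear_add]
      linear_koszul[OF x, THEN linear_scale]
    note bl = bilinear_ladd[OF bil[OF x]] bilinear_lmul[OF bil[OF x]]
    show "C u (v + w) = C u v + C u w" "C (v + w) u = C v u + C w u"
      "C u (r *\<^sub>R v) = r *\<^sub>R C u v" "C (r *\<^sub>R v) u = r *\<^sub>R C v u" for u v w r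
      by (rule eqI, simp only: C bl ks real_scaleR_def)+
  qed
  moreover have "C u v = C v u" for u v
    by (rule eq_if_gm_eq[OF x]) (simp add: C koszul_def dd_gm_sym[OF x, of u v])
  moreover have "dd (\<lambda>x'. gm x' u v) x w = gm x (C w u) v + gm x u (C w v)" for u v w
    unfolding sym[OF x, of u] C koszul_def
    using dd_gm_sym[OF x, of w u] dd_gm_sym[OF x, of v u] dd_gm_sym[OF x, of v w] by (simp add: field_simps)
  ultimately show "\<exists>\<Gamma>. bilinear \<Gamma> \<and> (\<forall>u v. \<Gamma> u v = \<Gamma> v u) \<and>
     (\<forall>w u v. dd (\<lambda>x'. gm x' u v) x w = gm x (\<Gamma> w u) v + gm x u (\<Gamma> w v))" by blast
next
  fix C C'
  assume C: "bilinear C \<and> (\<forall>u v. C u v = C v u) \<and>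
     (\<forall>w u v. dd (\<lambda>x'. gm x' u v) x w = gm x (C w u) v + gm x u (C w v))"
   and C': "bilinear C' \<and> (\<forall>u v. C' u v = C' v u) \<and>
     (\<forall>w u v. dd (\<lambda>x'. gm x' u v) x w = gm x (C' w u) v + gm x u (C' w v))"
  have "C u v - C' u v = 0" for u v
  proof (rule skew_symmetric_zero[OF x, of "\<lambda>u v. C u v - C' u v"])
    show "gm x (C w u - C' w u) v + gm x u (C w v - C' w v) = 0" for w u v
      using conjunct2[OF conjunct2[OF C], rule_format, of u v w]
        conjunct2[OF conjunct2[OF C'], rule_format, of u v w]
      by (simp add: bilinear_lsub[OF bil[OF x]] bilinear_rsub[OF bil[OF x]])
  qed (use C C' in metis)
  thus "C = C'" by (intro ext) simp
qed

lemma levi_civita: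
  assumes "x \<in> S"
  shows bilinear_\<Gamma>: "bilinear (\<Gamma> x)" and \<Gamma>_sym: "\<Gamma> x u v = \<Gamma> x v u"
    and \<Gamma>_metric: "dd (\<lambda>x'. gm x' u v) x w = gm x (\<Gamma> x w u) v + gm x u (\<Gamma> x w v)"
  using theI'[OF levi_civita_ex1[OF assms]] unfolding levi_civita_def[symmetric] by blast+

lemma gm_\<Gamma>:
  assumes x: "x \<in> S"
  shows "gm x (\<Gamma> x u v) w = koszul x u v w"
  unfolding koszul_def \<Gamma>_metric[OF x]
  using \<Gamma>_sym[OF x, of v u] \<Gamma>_sym[OF x, of w u] \<Gamma>_sym[OF x, of w v]
    sym[OF x, of v "\<Gamma> x u w"] sym[OF x, of u "\<Gamma> x v w"] sym[OF x, of u "\<Gamma> x w v"] by simp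

text \<open>A value of a description operator has no visible dependence on \<open>x\<close>.
  Smoothness comes from the linear system that \<open>flat_map\<close> makes of the Koszul
  formula.\<close>

lemma smooth_\<Gamma>: "smooth_on S (\<lambda>x. \<Gamma> x u v)"
proof (rule smooth_on_family_solution[where L = flat_map, OF open_S linear_flat_map inj_flat_map])
  show "smooth_on S (\<lambda>x. flat_map x u)" for u
    unfolding flat_map_def by (intro smooth_on_sum smooth_on_scaleR open_S smooth smooth_on_const)
  have "smooth_on S (\<lambda>x. koszul x u v w)" for w
    unfolding koszul_def divide_inverse
    by (intro smooth_on_mult smooth_on_add smooth_on_diff smooth_on_dd smooth smooth_on_const open_S)
  hence "smooth_on S (\<lambda>x. \<Sum>b\<in>Basis. koszul x u v b *\<^sub>R b)"
    by (intro smooth_on_sum smooth_on_scaleR open_S smooth_on_const)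
  also have "?this \<longleftrightarrow> smooth_on S (\<lambda>x. flat_map x (\<Gamma> x u v))"
    by (rule smooth_on_cong[OF open_S]) (simp add: flat_map_def gm_\<Gamma>)
  finally show "smooth_on S (\<lambda>x. flat_map x (\<Gamma> x u v))" .
qed

section \<open>Symmetries of the curvature of a metric\<close>

lemmas linear_R = curv_linear[where \<omega> = \<Gamma>, OF open_S _ bilinear_\<Gamma> smooth_\<Gamma>]

lemma smooth_R: "smooth_on S (\<lambda>x. R x u v w)"
  by (rule smooth_on_curv[OF open_S bilinear_\<Gamma> smooth_\<Gamma>])

lemma R_bianchi:
  assumes x: "x \<in> S"
  shows "R x u v w + R x v w u + R x w u v = 0"
proof -
  have "dd (\<lambda>x. \<Gamma> x u v) x = dd (\<lambda>x. \<Gamma> x v u) x" for u v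
    by (rule dd_cong[OF open_S x]) (rule \<Gamma>_sym)
  thus ?thesis
    unfolding curv_def using \<Gamma>_sym[OF x] by (simp add: algebra_simps)
qed

lemma dd_gm_field:
  assumes x: "x \<in> S" and "s differentiable (at x)" "t differentiable (at x)"
  shows "dd (\<lambda>y. gm y (s y) (t y)) x h =
    gm x (\<Gamma> x h (s x) + dd s x h) (t x) + gm x (s x) (\<Gamma> x h (t x) + dd t x h)"
  using dd_eq[OF family2_has_derivative[where B = gm, OF open_S x bil smooth_on_differentiable[OF smooth x]
    has_derivative_dd[OF assms(2)] has_derivative_dd[OF assms(3)]]]
  by (simp add: \<Gamma>_metric[OF x] bilinear_ladd[OF bil[OF x]] bilinear_radd[OF bil[OF x]])

text \<open>Second derivatives of the function \<open>gm y w w'\<close> commute. Written out by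
  metric compatibility, their difference is the sum of the two curvature terms.\<close>

lemma R_skew:
  assumes x: "x \<in> S"
  shows "gm x (R x u v w) w' = - gm x w (R x u v w')"
proof -
  have d\<Gamma>: "(\<lambda>x. \<Gamma> x u v) differentiable (at x)" for u v
    by (rule smooth_on_differentiable[OF smooth_\<Gamma> x])
  have second: "dd (\<lambda>y. dd (\<lambda>y. gm y w w') y v) x u =
      gm x (\<Gamma> x u (\<Gamma> x v w) + dd (\<lambda>y. \<Gamma> y v w) x u) w' + gm x (\<Gamma> x v w) (\<Gamma> x u w')
      + (gm x (\<Gamma> x u w) (\<Gamma> x v w') + gm x w (\<Gamma> x u (\<Gamma> x v w') + dd (\<lambda>y. \<Gamma> y v w') x u))" for u v
  proof -
    have "dd (\<lambda>y. dd (\<lambda>y. gm y w w') y v) x = dd (\<lambda>y. gm y (\<Gamma> y v w) w' + gm y w (\<Gamma> y v w')) x"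
      by (rule dd_cong[OF open_S x]) (rule \<Gamma>_metric)
    also have "\<dots> = (\<lambda>u. dd (\<lambda>y. gm y (\<Gamma> y v w) w') x u + dd (\<lambda>y. gm y w (\<Gamma> y v w')) x u)"
      by (intro dd_eq has_derivative_add smooth_on_has_derivative[OF _ x]
          smooth_on_family2[where B = gm, OF open_S bil smooth] smooth_\<Gamma> smooth_on_const)
    finally show ?thesis
      using dd_gm_field[OF x d\<Gamma>[of v w], of "\<lambda>_. w'"] dd_gm_field[OF x _ d\<Gamma>[of v w'], of "\<lambda>_. w"]
      by simp
  qed
  have "dd (\<lambda>y. dd (\<lambda>y. gm y w w') y v) x u = dd (\<lambda>y. dd (\<lambda>y. gm y w w') y u) x v"
    by (rule symmetric_second_derivative[OF open_S x smooth])
  thus ?thesis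
    unfolding second curv_def
    by (simp add: bilinear_ladd[OF bil[OF x]] bilinear_radd[OF bil[OF x]] bilinear_lsub[OF bil[OF x]]
        bilinear_rsub[OF bil[OF x]])
qed

lemma R_pair:
  assumes x: "x \<in> S"
  shows "gm x (R x u v w) z = gm x (R x w z u) v"
proof -
  define r where "r u v w z = gm x (R x u v w) z" for u v w z
  have 1: "r u v w z = - r v u w z" for u v w z
    unfolding r_def curv_antisym[of _ _ u v] by (simp add: bilinear_lneg[OF bil[OF x]])
  have 2: "r u v w z = - r u v z w" for u v w z
    unfolding r_def using R_skew[OF x, of u v w z] sym[OF x] by metis
  have 3: "r u v w z + r v w u z + r w u v z = 0" for u v w z
    unfolding r_def using arg_cong[OF R_bianchi[OF x, of u v w], of "\<lambda>t. gm x t z"]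
    by (simp add: bilinear_ladd[OF bil[OF x]] bilinear_lzero[OF bil[OF x]])
  \<comment> \<open>The classical combination of four Bianchi identities, one for each choice of the
    fixed last slot; the remaining facts only normalise signs.\<close>
  have "r u v w z = r w z u v"
    using 3[of u v w z] 3[of v w z u] 3[of w z u v] 3[of z u v w]
      2[of v w z u] 2[of w z v u] 1[of z v w u] 1[of z u w v] 2[of u z w v] 1[of u w z v] 2[of w u z v]
      1[of z u v w] 2[of u v z w] 2[of v z u w]
    by linarith
  thus ?thesis by (simp add: r_def)
qed

end


section \<open>Charts, tangent vectors and vector fields\<close>

abbreviation transition :: "('a, 'e) chart \<Rightarrow> ('a, 'e) chart \<Rightarrow> 'e \<Rightarrow> 'e" where
  "transition c c' \<equiv> coord c' \<circ> chart_inv c"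

abbreviation overlap :: "('a, 'e) chart \<Rightarrow> ('a, 'e) chart \<Rightarrow> 'e set" where
  "overlap c c' \<equiv> coord c ` (chart_dom c \<inter> chart_dom c')"

definition rep :: "('a, 'e) chart \<Rightarrow> ('a, 'e) vfield \<Rightarrow> 'e \<Rightarrow> 'e" where
  "rep c X = (\<lambda>x. X (chart_inv c x) c)"

lemma overlap_subset: "overlap c c' \<subseteq> chart_ran c"
  by (auto simp: chart_ran_def)

locale atlas =
  fixes A :: "('a, 'e::euclidean_space) chart set"
  assumes smooth_atlas: "smooth_atlas A"
begin

lemma inj_coord: "c \<in> A \<Longrightarrow> inj_on (coord c) (chart_dom c)"
  and open_chart_ran: "c \<in> A \<Longrightarrow> open (chart_ran c)"
  and open_overlap: "c \<in> A \<Longrightarrow> c' \<in> A \<Longrightarrow> open (overlap c c')"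
  and smooth_trans: "c \<in> A \<Longrightarrow> c' \<in> A \<Longrightarrow> smooth_on (overlap c c') (transition c c')"
  using smooth_atlas by (auto simp: smooth_atlas_def)

lemma chart_inv_coord: "c \<in> A \<Longrightarrow> p \<in> chart_dom c \<Longrightarrow> chart_inv c (coord c p) = p"
  by (simp add: chart_inv_def inj_coord)

lemma coord_chart_inv: "x \<in> chart_ran c \<Longrightarrow> coord c (chart_inv c x) = x"
  by (simp add: chart_inv_def chart_ran_def f_inv_into_f)

lemma chart_inv_dom: "x \<in> chart_ran c \<Longrightarrow> chart_inv c x \<in> chart_dom c"
  by (simp add: chart_inv_def chart_ran_def inv_into_into)

lemma coord_in_ran: "p \<in> chart_dom c \<Longrightarrow> coord c p \<in> chart_ran c"
  by (simp add: chart_ran_def)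

lemma overlap_iff: "c \<in> A \<Longrightarrow> x \<in> overlap c c' \<longleftrightarrow> x \<in> chart_ran c \<and> chart_inv c x \<in> chart_dom c'"
  by (auto simp: chart_ran_def chart_inv_coord intro: image_eqI[of _ _ "chart_inv c x"]
      simp: coord_chart_inv chart_inv_dom)

lemma trans_overlap:
  assumes "c \<in> A" "c' \<in> A" "x \<in> overlap c c'"
  shows "transition c c' x \<in> overlap c' c" "transition c' c (transition c c' x) = x"
    "chart_inv c' (transition c c' x) = chart_inv c x"
  using assms by (auto simp: chart_inv_coord)

lemma trans_compose:
  assumes "c \<in> A" "c' \<in> A" "x \<in> overlap c c'"
  shows "transition c c'' x = transition c' c'' (transition c c' x)"
  using assms by (auto simp: chart_inv_coord)

text \<open>The cocycle rule that makes \<open>chart_vec\<close> a tangent vector. The direct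
  transition and the composite agree only on an overlap, which is open and hence enough for
  derivatives.\<close>

lemma dd_transition_compose:
  assumes A: "c \<in> A" "c' \<in> A" "c'' \<in> A" and x: "x \<in> overlap c c'" "x \<in> overlap c c''"
  shows "dd (transition c c'') x v = dd (transition c' c'') (transition c c' x) (dd (transition c c') x v)"
proof -
  have y: "transition c c' x \<in> overlap c' c''"
    using x overlap_iff[OF A(1), of x c'] overlap_iff[OF A(1), of x c''] by simp
  have "((\<lambda>y. transition c' c'' (transition c c' y)) has_derivative
      (\<lambda>v. dd (transition c' c'') (transition c c' x) (dd (transition c c') x v))) (at x)"
    by (rule has_derivative_compose[OF smooth_on_has_derivative[OF smooth_trans[OF A(1,2)] x(1)],
        where g = "transition c' c''"], rule smooth_on_has_derivative[OF smooth_trans[OF A(2,3)] y])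
  hence "dd (\<lambda>y. transition c' c'' (transition c c' y)) x v =
      dd (transition c' c'') (transition c c' x) (dd (transition c c') x v)" by (simp only: dd_eq)
  moreover have "dd (transition c c'') x = dd (\<lambda>y. transition c' c'' (transition c c' y)) x"
    by (rule dd_cong[OF open_overlap[OF A(1,2)] x(1)]) (rule trans_compose[OF A(1,2)])
  ultimately show ?thesis by simp
qed

lemma dd_transition_self: "c \<in> A \<Longrightarrow> x \<in> chart_ran c \<Longrightarrow> dd (transition c c) x v = v"
  using dd_cong[OF open_chart_ran, of c x "transition c c" "\<lambda>x. x"] by (simp add: coord_chart_inv)

lemma dd_transition_inverse:
  assumes "c \<in> A" "c' \<in> A" "x \<in> overlap c c'"
  shows "dd (transition c' c) (transition c c' x) (dd (transition c c') x v) = v"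
  using dd_transition_compose[OF assms(1,2,1,3), of v] dd_transition_self[OF assms(1)] assms(3)
  by (auto simp: chart_ran_def)

lemma linear_dd_trans: "c \<in> A \<Longrightarrow> c' \<in> A \<Longrightarrow> x \<in> overlap c c' \<Longrightarrow> linear (dd (transition c c') x)"
  by (rule smooth_on_linear_dd[OF smooth_trans])

lemma tangent_spaceD:
  assumes "v \<in> tangent_space A p" "c \<in> A" "c' \<in> A" "p \<in> chart_dom c" "p \<in> chart_dom c'"
  shows "v c' = dd (transition c c') (coord c p) (v c)"
  using assms unfolding tangent_space_def mem_Collect_eq by blast

lemma tangent_space_outside: "v \<in> tangent_space A p \<Longrightarrow> \<not> (c \<in> A \<and> p \<in> chart_dom c) \<Longrightarrow> v c = 0"
  unfolding tangent_space_def mem_Collect_eq by blast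

lemma tangent_spaceI:
  assumes "\<And>c. \<not> (c \<in> A \<and> p \<in> chart_dom c) \<Longrightarrow> v c = 0"
    "\<And>c c'. c \<in> A \<Longrightarrow> c' \<in> A \<Longrightarrow> p \<in> chart_dom c \<Longrightarrow> p \<in> chart_dom c' \<Longrightarrow>
      v c' = dd (transition c c') (coord c p) (v c)"
  shows "v \<in> tangent_space A p"
  unfolding tangent_space_def mem_Collect_eq using assms by blast

lemma overlapI: "p \<in> chart_dom c \<Longrightarrow> p \<in> chart_dom c' \<Longrightarrow> coord c p \<in> overlap c c'"
  by blast

lemma chart_vec_self: "c \<in> A \<Longrightarrow> p \<in> chart_dom c \<Longrightarrow> chart_vec A c p u c = u"
  by (simp add: chart_vec_def dd_transition_self coord_in_ran)

lemma chart_vec_tangent: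
  assumes "c \<in> A" "p \<in> chart_dom c"
  shows "chart_vec A c p u \<in> tangent_space A p"
proof (rule tangent_spaceI)
  fix c' c'' assume *: "c' \<in> A" "c'' \<in> A" "p \<in> chart_dom c'" "p \<in> chart_dom c''"
  have "transition c c' (coord c p) = coord c' p" by (simp add: chart_inv_coord assms)
  with dd_transition_compose[OF assms(1) *(1,2) overlapI overlapI, of p u] assms *
  show "chart_vec A c p u c'' = dd (transition c' c'') (coord c' p) (chart_vec A c p u c')"
    by (simp add: chart_vec_def)
qed (auto simp: chart_vec_def)

lemma tangent_eq_chart_vec:
  assumes "v \<in> tangent_space A p" "c \<in> A" "p \<in> chart_dom c"
  shows "v = chart_vec A c p (v c)"
proof
  show "v c' = chart_vec A c p (v c) c'" for c'
    using tangent_spaceD[OF assms(1,2) _ assms(3), of c'] tangent_space_outside[OF assms(1), of c']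
    by (cases "c' \<in> A \<and> p \<in> chart_dom c'") (auto simp: chart_vec_def)
qed

lemma tangent_eqI:
  assumes "v \<in> tangent_space A p" "w \<in> tangent_space A p" "c \<in> A" "p \<in> chart_dom c" "v c = w c"
  shows "v = w"
  using tangent_eq_chart_vec[OF assms(1,3,4)] tangent_eq_chart_vec[OF assms(2,3,4)] assms(5) by simp

lemma tangent_diff:
  assumes "v \<in> tangent_space A p" "w \<in> tangent_space A p"
  shows "(\<lambda>c. v c - w c) \<in> tangent_space A p"
proof (rule tangent_spaceI)
  fix c c' assume *: "c \<in> A" "c' \<in> A" "p \<in> chart_dom c" "p \<in> chart_dom c'"
  show "v c' - w c' = dd (transition c c') (coord c p) (v c - w c)"
    unfolding linear_diff[OF linear_dd_trans[OF *(1,2) overlapI[OF *(3,4)]]]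
      tangent_spaceD[OF assms(1) *] tangent_spaceD[OF assms(2) *] ..
qed (use tangent_space_outside[OF assms(1)] tangent_space_outside[OF assms(2)] in simp)

lemma tangent_zero: "(\<lambda>c. 0) \<in> tangent_space A p"
  by (rule tangent_spaceI) (simp_all only: linear_0[OF linear_dd_trans[OF _ _ overlapI]])

lemma chart_vec_transform:
  assumes "c \<in> A" "c' \<in> A" "x \<in> overlap c c'"
  shows "chart_vec A c (chart_inv c x) u = chart_vec A c' (chart_inv c x) (dd (transition c c') x u)"
proof -
  have p: "chart_inv c x \<in> chart_dom c" "chart_inv c x \<in> chart_dom c'" "coord c (chart_inv c x) = x"
    using assms by (auto simp: chart_inv_coord)
  have "chart_vec A c (chart_inv c x) u c' = dd (transition c c') x u"
    using p assms by (simp add: chart_vec_def)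
  with tangent_eq_chart_vec[OF chart_vec_tangent[OF assms(1) p(1)] assms(2) p(2), of u]
  show ?thesis by simp
qed

lemma vector_field_iff:
  "vector_field A X \<longleftrightarrow> (\<forall>p\<in>points A. X p \<in> tangent_space A p) \<and> (\<forall>c\<in>A. smooth_on (chart_ran c) (rep c X))"
  by (simp add: vector_field_def rep_def)

lemma smooth_rep: "vector_field A X \<Longrightarrow> c \<in> A \<Longrightarrow> smooth_on (chart_ran c) (rep c X)"
  by (simp add: vector_field_iff)

lemma vector_field_tangent: "vector_field A X \<Longrightarrow> p \<in> points A \<Longrightarrow> X p \<in> tangent_space A p"
  by (simp add: vector_field_iff)

lemma chart_dom_points: "c \<in> A \<Longrightarrow> p \<in> chart_dom c \<Longrightarrow> p \<in> points A"
  by (auto simp: points_def)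

lemma rep_coord: "c \<in> A \<Longrightarrow> p \<in> chart_dom c \<Longrightarrow> rep c X (coord c p) = X p c"
  by (simp add: rep_def chart_inv_coord)

lemma rep_transform:
  assumes "vector_field A X" "c \<in> A" "c' \<in> A" "x \<in> overlap c c'"
  shows "rep c' X (transition c c' x) = dd (transition c c') x (rep c X x)"
proof -
  obtain p where p: "p \<in> chart_dom c" "p \<in> chart_dom c'" "x = coord c p" using assms(4) by auto
  have "X p c' = dd (transition c c') (coord c p) (X p c)"
    using tangent_spaceD[OF vector_field_tangent[OF assms(1)] assms(2,3) p(1,2)] p assms(2)
    by (auto simp: points_def)
  thus ?thesis using p assms by (simp add: rep_def chart_inv_coord)
qed

lemma vector_field_diff:
  assumes "vector_field A X" "vector_field A Y"
  shows "vector_field A (\<lambda>p c. X p c - Y p c)"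
proof -
  have "rep c (\<lambda>p c. X p c - Y p c) = (\<lambda>x. rep c X x - rep c Y x)" for c by (simp add: rep_def)
  thus ?thesis using assms by (auto simp: vector_field_iff intro!: tangent_diff smooth_on_diff open_chart_ran)
qed

end

section \<open>The connection and the curvature of a Riemannian metric\<close>

lemma nab_cong:
  assumes "open S" "x \<in> S" "\<And>y. y \<in> S \<Longrightarrow> s y = s' y" "V x = V' x"
  shows "nab \<omega> V s x = nab \<omega> V' s' x"
  using dd_cong[OF assms(1-3)] assms(2-4) by (simp add: nab_def)

locale riemannian = atlas A for A :: "('a, 'e::euclidean_space) chart set" +
  fixes k :: "('a, 'e) tensor2"
  assumes riemannian_metric: "riemannian_metric A k"
begin

abbreviation gc where "gc \<equiv> tensor2_comp A k"

abbreviation \<Gamma>c where "\<Gamma>c \<equiv> christoffel A k"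

lemma \<Gamma>c_levi_civita: "\<Gamma>c c = levi_civita (gc c)"
  by (rule ext) (rule christoffel_levi_civita)

lemma local_metric_chart:
  assumes "c \<in> A"
  shows "local_metric (chart_ran c) (gc c)"
  using assms riemannian_metric
  by unfold_locales (auto simp: riemannian_metric_def symmetric_tensor2_def open_chart_ran)

lemma gc_transform:
  assumes "c \<in> A" "c' \<in> A" "x \<in> overlap c c'"
  shows "gc c x u v = gc c' (transition c c' x) (dd (transition c c') x u) (dd (transition c c') x v)"
  unfolding tensor2_comp_def chart_vec_transform[OF assms] trans_overlap(3)[OF assms] ..

lemma christoffel_facts:
  assumes "c \<in> A"
  shows bilinear_\<Gamma>c: "x \<in> chart_ran c \<Longrightarrow> bilinear (\<Gamma>c c x)"
    and \<Gamma>c_sym: "x \<in> chart_ran c \<Longrightarrow> \<Gamma>c c x u v = \<Gamma>c c x v u"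
    and smooth_\<Gamma>c: "smooth_on (chart_ran c) (\<lambda>x. \<Gamma>c c x u v)"
  unfolding \<Gamma>c_levi_civita
  by (fact local_metric.bilinear_\<Gamma>[OF local_metric_chart[OF assms]]
      local_metric.\<Gamma>_sym[OF local_metric_chart[OF assms]]
      local_metric.smooth_\<Gamma>[OF local_metric_chart[OF assms]])+

text \<open>Both sides are torsion-free and compatible with the metric, so their difference falls
  under \<open>skew_symmetric_zero\<close>. The Hessian of the transition is the inhomogeneous
  term.\<close>

lemma christoffel_transform:
  assumes A: "c \<in> A" "c' \<in> A" and x: "x \<in> overlap c c'"
  shows "dd (transition c c') x (\<Gamma>c c x u v) =
    \<Gamma>c c' (transition c c' x) (dd (transition c c') x u) (dd (transition c c') x v)
    + dd (\<lambda>y. dd (transition c c') y u) x v"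
proof -
  interpret m: local_metric "chart_ran c" "gc c" by (rule local_metric_chart[OF A(1)])
  interpret m': local_metric "chart_ran c'" "gc c'" by (rule local_metric_chart[OF A(2)])
  define \<phi> where "\<phi> = transition c c'"
  define i where "i = dd (transition c' c) (\<phi> x)"
  define H where "H u v = dd (\<lambda>y. dd \<phi> y u) x v" for u v
  have sm: "smooth_on (overlap c c') \<phi>" unfolding \<phi>_def by (rule smooth_trans[OF A])
  have op: "open (overlap c c')" by (rule open_overlap[OF A])
  have xr: "x \<in> chart_ran c" "\<phi> x \<in> chart_ran c'" using x A by (auto simp: chart_ran_def \<phi>_def chart_inv_coord)
  have i: "i (dd \<phi> x w) = w" for w unfolding i_def \<phi>_def by (rule dd_transition_inverse[OF A x])
  have i': "dd \<phi> x (i w) = w" for w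
    using dd_transition_inverse[OF A(2,1) trans_overlap(1)[OF A x], of w] trans_overlap(2)[OF A x]
    by (simp add: i_def \<phi>_def)
  have H_sym: "H u v = H v u" for u v unfolding H_def by (rule symmetric_second_derivative[OF op x sm])
  \<comment> \<open>The discrepancy, moved to vectors of the target chart by the inverse
    \<open>i\<close> so that it is a tensor for the metric there. Its symmetry uses that of the
    Hessian \<open>H\<close>; its skewness comes from differentiating the transformation law of the
    metric.\<close>
  define T where "T u v = dd \<phi> x (m.\<Gamma> x (i u) (i v)) - m'.\<Gamma> (\<phi> x) u v - H (i u) (i v)" for u v
  have "T (dd \<phi> x u) (dd \<phi> x v) = 0"
  proof (rule m'.skew_symmetric_zero[where T = T, OF xr(2)])
    show "T u v = T v u" for u v
      using m.\<Gamma>_sym[OF xr(1)] m'.\<Gamma>_sym[OF xr(2)] H_sym by (simp add: T_def)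
    show "gc c' (\<phi> x) (T w u) v + gc c' (\<phi> x) u (T w v) = 0" for w u v
    proof -
      let ?g = "gc c' (\<phi> x)"
      have pull: "gc c x p q = ?g (dd \<phi> x p) (dd \<phi> x q)" for p q
        unfolding \<phi>_def by (rule gc_transform[OF A x])
      have "dd (\<lambda>y. gc c y (i u) (i v)) x (i w) =
          ?g (dd \<phi> x (m.\<Gamma> x (i w) (i u))) v + ?g u (dd \<phi> x (m.\<Gamma> x (i w) (i v)))"
        unfolding m.\<Gamma>_metric[OF xr(1)] pull i' ..
      moreover have "dd (\<lambda>y. gc c y (i u) (i v)) x =
          dd (\<lambda>y. gc c' (\<phi> y) (dd \<phi> y (i u)) (dd \<phi> y (i v))) x"
        unfolding \<phi>_def by (rule dd_cong[OF op x]) (rule gc_transform[OF A])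
      moreover have "((\<lambda>y. gc c' (\<phi> y) (dd \<phi> y (i u)) (dd \<phi> y (i v))) has_derivative
         (\<lambda>h. dd (\<lambda>y. gc c' (\<phi> y) (dd \<phi> x (i u)) (dd \<phi> x (i v))) x h +
           ?g (dd (\<lambda>y. dd \<phi> y (i u)) x h) (dd \<phi> x (i v)) +
           ?g (dd \<phi> x (i u)) (dd (\<lambda>y. dd \<phi> y (i v)) x h))) (at x)"
      proof (rule family2_has_derivative[where B = "\<lambda>y. gc c' (\<phi> y)", OF op x])
        show "bilinear (gc c' (\<phi> y))" if "y \<in> overlap c c'" for y
          using that A by (intro m'.bil) (auto simp: chart_ran_def \<phi>_def chart_inv_coord)
        show "(\<lambda>y. gc c' (\<phi> y) u v) differentiable at x" for u v
          using differentiable_chain_at[OF smooth_on_differentiable[OF sm x]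
            smooth_on_differentiable[OF m'.smooth xr(2)]] by (simp add: o_def)
      qed (intro smooth_on_has_derivative[OF smooth_on_dd[OF sm] x])+
      moreover have "dd (\<lambda>y. gc c' (\<phi> y) u v) x (i w) =
         ?g (m'.\<Gamma> (\<phi> x) w u) v + ?g u (m'.\<Gamma> (\<phi> x) w v)"
      proof -
        have "((\<lambda>y. gc c' (\<phi> y) u v) has_derivative
            (\<lambda>h. dd (\<lambda>y. gc c' y u v) (\<phi> x) (dd \<phi> x h))) (at x)"
          by (rule has_derivative_compose[OF smooth_on_has_derivative[OF sm x],
              where g = "\<lambda>y. gc c' y u v"], rule smooth_on_has_derivative[OF m'.smooth xr(2)])
        hence "dd (\<lambda>y. gc c' (\<phi> y) u v) x (i w) = dd (\<lambda>y. gc c' y u v) (\<phi> x) (dd \<phi> x (i w))"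
          by (simp only: dd_eq)
        thus ?thesis unfolding i' m'.\<Gamma>_metric[OF xr(2)] .
      qed
      ultimately have "?g (dd \<phi> x (m.\<Gamma> x (i w) (i u))) v + ?g u (dd \<phi> x (m.\<Gamma> x (i w) (i v))) =
        ?g (m'.\<Gamma> (\<phi> x) w u) v + ?g u (m'.\<Gamma> (\<phi> x) w v) + ?g (H (i u) (i w)) v + ?g u (H (i v) (i w))"
        by (simp add: dd_eq i' H_def)
      thus ?thesis
        unfolding T_def H_sym[of "i w"]
        by (simp add: bilinear_lsub[OF m'.bil[OF xr(2)]] bilinear_rsub[OF m'.bil[OF xr(2)]])
    qed
  qed
  hence "dd \<phi> x (m.\<Gamma> x u v) = m'.\<Gamma> (\<phi> x) (dd \<phi> x u) (dd \<phi> x v) + H u v"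
    by (simp add: T_def i algebra_simps)
  thus ?thesis by (simp only: \<Gamma>c_levi_civita H_def \<phi>_def)
qed

lemma nabla_eq:
  assumes "c \<in> A" "p \<in> chart_dom c"
  shows "nabla A k X Y p c = nab (\<Gamma>c c) (rep c X) (rep c Y) (coord c p)"
  using assms by (simp add: nabla_def nab_def rep_coord rep_def[symmetric])

lemma rep_nabla:
  assumes "c \<in> A" "x \<in> chart_ran c"
  shows "rep c (nabla A k X Y) x = nab (\<Gamma>c c) (rep c X) (rep c Y) x"
  using nabla_eq[OF assms(1) chart_inv_dom[OF assms(2)]] coord_chart_inv[OF assms(2)]
  by (simp add: rep_def)

text \<open>Differentiating the transformation law of \<open>Y\<close> produces the Hessian of the
  transition, which cancels the inhomogeneous term of \<open>christoffel_transform\<close>.\<close>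

lemma nabla_transform:
  assumes X: "vector_field A X" and Y: "vector_field A Y" and A: "c \<in> A" "c' \<in> A" and x: "x \<in> overlap c c'"
  shows "nab (\<Gamma>c c') (rep c' X) (rep c' Y) (transition c c' x) =
     dd (transition c c') x (nab (\<Gamma>c c) (rep c X) (rep c Y) x)"
proof -
  define \<phi> where "\<phi> = transition c c'"
  have xr: "x \<in> chart_ran c" "\<phi> x \<in> chart_ran c'" using x A by (auto simp: chart_ran_def \<phi>_def chart_inv_coord)
  have op: "open (overlap c c')" by (rule open_overlap[OF A])
  have sm: "smooth_on (overlap c c') \<phi>" unfolding \<phi>_def by (rule smooth_trans[OF A])
  note sX = smooth_rep[OF X] note sY = smooth_rep[OF Y]
  have "((\<lambda>y. rep c' Y (\<phi> y)) has_derivative (\<lambda>h. dd (rep c' Y) (\<phi> x) (dd \<phi> x h))) (at x)"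
    by (rule has_derivative_compose[OF smooth_on_has_derivative[OF sm x], where g = "rep c' Y"],
        rule smooth_on_has_derivative[OF sY[OF A(2)] xr(2)])
  hence "dd (rep c' Y) (\<phi> x) (dd \<phi> x h) = dd (\<lambda>y. rep c' Y (\<phi> y)) x h" for h by (simp only: dd_eq)
  also have "dd (\<lambda>y. rep c' Y (\<phi> y)) x = dd (\<lambda>y. dd \<phi> y (rep c Y y)) x"
    unfolding \<phi>_def by (rule dd_cong[OF op x]) (rule rep_transform[OF Y A])
  also have "\<dots> = (\<lambda>h. dd (\<lambda>y. dd \<phi> y (rep c Y x)) x h + dd \<phi> x (dd (rep c Y) x h))"
    by (intro dd_eq family_has_derivative[where L = "dd \<phi>" and s = "rep c Y", OF op x]
        smooth_on_linear_dd[OF sm] smooth_on_differentiable[OF smooth_on_dd[OF sm] x]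
        smooth_on_has_derivative[OF sY[OF A(1)] xr(1)])
  finally have "dd (rep c' Y) (\<phi> x) (dd \<phi> x (rep c X x)) =
      dd (\<lambda>y. dd \<phi> y (rep c Y x)) x (rep c X x) + dd \<phi> x (dd (rep c Y) x (rep c X x))" .
  moreover have "dd \<phi> x (\<Gamma>c c x (rep c X x) (rep c Y x)) =
      \<Gamma>c c' (\<phi> x) (dd \<phi> x (rep c X x)) (dd \<phi> x (rep c Y x))
      + dd (\<lambda>y. dd \<phi> y (rep c Y x)) x (rep c X x)"
    using christoffel_transform[OF A x] symmetric_second_derivative[OF op x sm] by (simp add: \<phi>_def)
  ultimately show ?thesis
    using rep_transform[OF X A x] rep_transform[OF Y A x] linear_dd_trans[OF A x]
    by (simp add: nab_def \<phi>_def linear_add)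
qed

lemma vector_field_nabla:
  assumes X: "vector_field A X" and Y: "vector_field A Y"
  shows "vector_field A (nabla A k X Y)"
  unfolding vector_field_iff
proof (intro conjI ballI)
  fix p assume "p \<in> points A"
  show "nabla A k X Y p \<in> tangent_space A p"
  proof (rule tangent_spaceI)
    fix c c' assume *: "c \<in> A" "c' \<in> A" "p \<in> chart_dom c" "p \<in> chart_dom c'"
    have "transition c c' (coord c p) = coord c' p" by (simp add: chart_inv_coord *)
    with nabla_transform[OF X Y *(1,2) overlapI[OF *(3,4)]]
    show "nabla A k X Y p c' = dd (transition c c') (coord c p) (nabla A k X Y p c)"
      by (simp only: nabla_eq *)
  qed (auto simp: nabla_def)
next
  fix c assume c: "c \<in> A"
  have "smooth_on (chart_ran c) (nab (\<Gamma>c c) (rep c X) (rep c Y))"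
    by (rule smooth_on_nab[OF open_chart_ran bilinear_\<Gamma>c smooth_\<Gamma>c]) (use c X Y smooth_rep in auto)
  thus "smooth_on (chart_ran c) (rep c (nabla A k X Y))"
    by (subst smooth_on_cong[OF open_chart_ran[OF c] rep_nabla[OF c]])
qed

text \<open>Torsion-freeness. It lets brackets inherit the transformation law and smoothness from
  covariant derivatives.\<close>

lemma lie_bracket_nabla: "lie_bracket A X Y = (\<lambda>p c. nabla A k X Y p c - nabla A k Y X p c)"
  by (intro ext) (auto simp: lie_bracket_def nabla_def \<Gamma>c_sym[OF _ coord_in_ran])

lemma vector_field_lie_bracket:
  "vector_field A X \<Longrightarrow> vector_field A Y \<Longrightarrow> vector_field A (lie_bracket A X Y)"
  unfolding lie_bracket_nabla by (intro vector_field_diff vector_field_nabla)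

lemma vector_field_curvature:
  "vector_field A X \<Longrightarrow> vector_field A Y \<Longrightarrow> vector_field A Z \<Longrightarrow> vector_field A (curvature A k X Y Z)"
  unfolding curvature_def by (intro vector_field_diff vector_field_nabla vector_field_lie_bracket)

lemma rep_curvature:
  assumes c: "c \<in> A" and x: "x \<in> chart_ran c"
  shows "rep c (curvature A k X Y Z) x = field_curv (\<Gamma>c c) (rep c X) (rep c Y) (rep c Z) x"
proof -
  have nn: "rep c (nabla A k X (nabla A k Y Z)) x = nab (\<Gamma>c c) (rep c X) (nab (\<Gamma>c c) (rep c Y) (rep c Z)) x" for X Y
    unfolding rep_nabla[OF c x] by (rule nab_cong[OF open_chart_ran[OF c] x rep_nabla[OF c]]) auto
  have "rep c (lie_bracket A X Y) x = bracket (rep c X) (rep c Y) x"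
    using c chart_inv_dom[OF x] coord_chart_inv[OF x]
    by (simp add: rep_def lie_bracket_def bracket_def)
  hence "rep c (nabla A k (lie_bracket A X Y) Z) x = nab (\<Gamma>c c) (bracket (rep c X) (rep c Y)) (rep c Z) x"
    unfolding rep_nabla[OF c x] by (intro nab_cong[OF open_chart_ran[OF c] x]) auto
  with nn show ?thesis by (simp add: field_curv_def curvature_def) (simp add: rep_def)
qed

lemma rep_curvature_eq:
  assumes "vector_field A X" "vector_field A Y" "vector_field A Z" "c \<in> A" "x \<in> chart_ran c"
  shows "rep c (curvature A k X Y Z) x = curv (\<Gamma>c c) x (rep c X x) (rep c Y x) (rep c Z x)"
  unfolding rep_curvature[OF assms(4,5)]
  by (rule field_curv_eq[OF open_chart_ran[OF assms(4)] assms(5) bilinear_\<Gamma>c smooth_\<Gamma>c])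
    (use assms smooth_rep in auto)

end


section \<open>Bump functions and global vector fields\<close>

text \<open>The usual flat function is the case \<open>n = 0\<close>. The powers of
  \<open>1 / t\<close> make the family closed under differentiation up to linear combinations, so
  that smoothness is an induction over all \<open>n\<close> at once.\<close>

definition exp_inverse :: "nat \<Rightarrow> real \<Rightarrow> real" where
  "exp_inverse n t = (if t > 0 then (1 / t) ^ n * exp (- (1 / t)) else 0)"

lemma exp_inverse_tendsto_0: "(exp_inverse n \<longlongrightarrow> 0) (at 0)"
proof -
  have "((\<lambda>t::real. inverse t ^ n / exp (inverse t)) \<longlongrightarrow> 0) (at_right 0)"
    by (rule filterlim_compose[OF tendsto_power_div_exp_0 filterlim_inverse_at_top_right])
  hence "(exp_inverse n \<longlongrightarrow> 0) (at_right 0)"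
    by (rule Lim_transform_eventually)
      (auto simp: eventually_at_filter exp_inverse_def exp_minus field_simps intro!: always_eventually)
  moreover have "(exp_inverse n \<longlongrightarrow> 0) (at_left 0)"
    by (rule Lim_transform_eventually[OF tendsto_const])
      (auto simp: eventually_at_filter exp_inverse_def intro!: always_eventually)
  ultimately show ?thesis by (simp add: filterlim_at_split)
qed

lemma exp_inverse_DERIV:
  "(exp_inverse n has_field_derivative exp_inverse (n + 2) t - n * exp_inverse (n + 1) t) (at t)"
proof -
  consider "t > 0" | "t = 0" | "t < 0" by linarith
  thus ?thesis
  proof cases
    case 1
    have "((\<lambda>t. (1 / t) ^ n * exp (- (1 / t))) has_field_derivative
        exp_inverse (n + 2) t - n * exp_inverse (n + 1) t) (at t)"
    proof -
      define i where "i = 1 / t"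
      have i: "((\<lambda>t. 1 / t) has_field_derivative - (i * i)) (at t)"
        using 1 by (auto intro!: derivative_eq_intros simp: i_def)
      have "((\<lambda>t. (1 / t) ^ n * exp (- (1 / t))) has_field_derivative
          (n * (- (i * i) * i ^ (n - Suc 0))) * exp (- i) + (exp (- i) * (i * i)) * i ^ n) (at t)"
        using DERIV_mult[OF DERIV_power[OF i, of n] DERIV_fun_exp[OF DERIV_minus[OF i]]]
        by (simp add: i_def[symmetric])
      moreover have "(n * (- (i * i) * i ^ (n - Suc 0))) * exp (- i) + (exp (- i) * (i * i)) * i ^ n =
          exp_inverse (n + 2) t - n * exp_inverse (n + 1) t"
        using 1 by (cases n) (auto simp: exp_inverse_def i_def[symmetric] algebra_simps)
      ultimately show ?thesis by simp
    qed
    thus ?thesis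
      by (rule has_field_derivative_transform_within_open[of _ _ _ "{0<..}"])
        (use 1 in \<open>auto simp: exp_inverse_def\<close>)
  next
    \<comment> \<open>The difference quotient at 0 is again a member of the family, with
      \<open>n\<close> raised by one, and all members tend to 0.\<close>
    case 2
    have "\<forall>\<^sub>F h in at 0. exp_inverse (Suc n) h = (exp_inverse n (0 + h) - exp_inverse n 0) / h"
      by (auto simp: eventually_at_filter exp_inverse_def intro!: always_eventually)
    from Lim_transform_eventually[OF exp_inverse_tendsto_0 this]
    show ?thesis using 2 by (simp add: DERIV_def exp_inverse_def)
  next
    case 3
    have "((\<lambda>t. 0) has_field_derivative exp_inverse (n + 2) t - n * exp_inverse (n + 1) t) (at t)"
      using 3 by (auto simp: exp_inverse_def)
    thus ?thesis
      by (rule has_field_derivative_transform_within_open[of _ _ _ "{..<0}"])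
        (use 3 in \<open>auto simp: exp_inverse_def\<close>)
  qed
qed

lemma smooth_exp_inverse: "smooth_on UNIV (exp_inverse n)"
proof -
  have "Ck_on k UNIV (exp_inverse n)" for k
  proof (induction k arbitrary: n)
    case 0
    show ?case
      using exp_inverse_DERIV by (auto intro!: continuous_at_imp_continuous_on DERIV_isCont)
  next
    case (Suc k)
    have der: "(exp_inverse n has_derivative
        (\<lambda>v. (exp_inverse (n + 2) t - n * exp_inverse (n + 1) t) * v)) (at t)" for t
      using exp_inverse_DERIV by (simp add: has_field_derivative_def)
    have "dd (exp_inverse n) t v = v * exp_inverse (n + 2) t + (- v * n) * exp_inverse (n + 1) t" for t v
      by (simp add: dd_eq[OF der] algebra_simps)
    moreover have "Ck_on k UNIV (\<lambda>t. v * exp_inverse (n + 2) t + (- v * n) * exp_inverse (n + 1) t)" for v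
      by (intro Ck_on_add Ck_on_bilinear[OF bounded_bilinear_mult] Suc.IH Ck_on_const open_UNIV)
    ultimately show ?case using differentiableI[OF der] by simp
  qed
  thus ?thesis by (simp add: smooth_on_def)
qed

lemma smooth_bump:
  fixes x0 :: "'e::euclidean_space"
  assumes "r > 0"
  obtains \<beta> :: "'e \<Rightarrow> real" where "smooth_on UNIV \<beta>" "\<beta> x0 = 1" "\<And>x. x \<notin> cball x0 r \<Longrightarrow> \<beta> x = 0"
proof
  \<comment> \<open>The argument is a polynomial in \<open>x\<close>, hence smooth even at the
    centre, and it is positive exactly in the open ball of radius \<open>r\<close>.\<close>
  let ?k = "\<lambda>x. exp_inverse 0 (r\<^sup>2 - (x - x0) \<bullet> (x - x0))"
  have "smooth_on UNIV ?k"
    by (rule smooth_on_compose[OF open_UNIV open_UNIV _ smooth_exp_inverse])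
      (auto intro!: smooth_on_diff smooth_on_inner smooth_on_const smooth_on_id)
  thus "smooth_on UNIV (\<lambda>x. ?k x * inverse (?k x0))"
    by (intro smooth_on_mult smooth_on_const open_UNIV)
  show "?k x0 * inverse (?k x0) = 1" using assms by (simp add: exp_inverse_def)
  show "?k x * inverse (?k x0) = 0" if "x \<notin> cball x0 r" for x
  proof -
    have "r\<^sup>2 < (norm (x - x0))\<^sup>2"
      using that assms by (intro power_strict_mono) (auto simp: dist_norm norm_minus_commute)
    thus ?thesis by (simp add: exp_inverse_def power2_norm_eq_inner)
  qed
qed

section \<open>The atlas topology and global extension of tangent vectors\<close>

context atlas
begin

lemma openin_atlas:
  "openin (atlas_topology A) W \<longleftrightarrow> W \<subseteq> points A \<and> (\<forall>c\<in>A. open (coord c ` (W \<inter> chart_dom c)))"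
  unfolding atlas_topology_def topology_inverse'[OF istopology_atlas[OF smooth_atlas]] ..

lemma topspace_atlas: "topspace (atlas_topology A) = points A"
proof
  show "topspace (atlas_topology A) \<subseteq> points A"
    using openin_topspace[of "atlas_topology A"] by (simp only: openin_atlas)
  have "points A \<inter> chart_dom c = chart_dom c" if "c \<in> A" for c using that by (auto simp: points_def)
  hence "openin (atlas_topology A) (points A)"
    using open_chart_ran by (simp add: openin_atlas chart_ran_def)
  thus "points A \<subseteq> topspace (atlas_topology A)" by (rule openin_subset)
qed

text \<open>Used to see that a closed coordinate ball is compact, and therefore closed, in the
  manifold.\<close>

lemma continuous_chart_inv:
  assumes "c \<in> A"
  shows "continuous_map (top_of_set (chart_ran c)) (atlas_topology A) (chart_inv c)"
  unfolding continuous_map_def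
proof (intro conjI allI impI)
  show "chart_inv c \<in> topspace (top_of_set (chart_ran c)) \<rightarrow> topspace (atlas_topology A)"
    using chart_dom_points[OF assms chart_inv_dom] by (auto simp: topspace_atlas)
  fix W assume "openin (atlas_topology A) W"
  hence "open (coord c ` (W \<inter> chart_dom c))" using assms by (simp add: openin_atlas)
  moreover have "coord c ` (W \<inter> chart_dom c) = {x \<in> topspace (top_of_set (chart_ran c)). chart_inv c x \<in> W}"
    by (auto simp: chart_inv_coord[OF assms] coord_in_ran coord_chart_inv chart_inv_dom
        intro!: image_eqI[of _ _ "chart_inv c _"])
  ultimately show "openin (top_of_set (chart_ran c)) {x \<in> topspace (top_of_set (chart_ran c)). chart_inv c x \<in> W}"
    by (metis (no_types, lifting) mem_Collect_eq open_subset subsetI topspace_euclidean_subtopology)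
qed

lemma smooth_dd_transition:
  assumes c: "c \<in> A" "c' \<in> A" and s: "smooth_on (overlap c c') s"
  shows "smooth_on (overlap c' c) (\<lambda>y. dd (transition c c') (transition c' c y) (s (transition c' c y)))"
proof (rule smooth_on_compose[where f = "\<lambda>y. dd (transition c c') y (s y)" and g = "transition c' c",
      OF open_overlap[OF c(2,1)] open_overlap[OF c]])
  show "smooth_on (overlap c c') (\<lambda>y. dd (transition c c') y (s y))"
    by (rule smooth_on_dd_family[OF open_overlap[OF c] smooth_trans[OF c] s])
  show "smooth_on (overlap c' c) (transition c' c)" by (rule smooth_trans[OF c(2,1)])
qed (rule trans_overlap(1)[OF c(2,1)])

text \<open>Cutting off the constant field of a chart; closedness of the compact support in the
  Hausdorff space makes the extension by zero smooth.\<close>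

lemma vector_field_through:
  assumes H: "Hausdorff_space (atlas_topology A)" and c: "c \<in> A" and p: "p \<in> chart_dom c"
  obtains X where "vector_field A X" "X p c = u"
proof -
  obtain r where r: "r > 0" "cball (coord c p) r \<subseteq> chart_ran c"
    using open_chart_ran[OF c] coord_in_ran[OF p] open_contains_cball by blast
  obtain \<beta> :: "'e \<Rightarrow> real" where \<beta>: "smooth_on UNIV \<beta>" "\<beta> (coord c p) = 1"
    "\<And>x. x \<notin> cball (coord c p) r \<Longrightarrow> \<beta> x = 0"
    using smooth_bump[OF r(1)] by blast
  define K where "K = chart_inv c ` cball (coord c p) r"
  define X where "X q = (if q \<in> chart_dom c then chart_vec A c q (\<beta> (coord c q) *\<^sub>R u) else (\<lambda>_. 0))" for q
  have "compactin (top_of_set (chart_ran c)) (cball (coord c p) r)"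
    using r(2) by (simp add: compactin_subtopology)
  hence "compactin (atlas_topology A) K"
    unfolding K_def by (rule image_compactin) (rule continuous_chart_inv[OF c])
  hence "closedin (atlas_topology A) K" by (rule compactin_imp_closedin[OF H])
  hence opK: "openin (atlas_topology A) (points A - K)"
    by (simp add: closedin_def topspace_atlas)
  have X_tan: "X q \<in> tangent_space A q" for q
    unfolding X_def using c by (simp add: chart_vec_tangent tangent_zero)
  have sm: "smooth_on (chart_ran c') (rep c' X)" if c': "c' \<in> A" for c'
  proof -
    let ?N = "coord c' ` ((points A - K) \<inter> chart_dom c')"
    have ov: "rep c' X y = dd (transition c c') (transition c' c y) (\<beta> (transition c' c y) *\<^sub>R u)"
      if "y \<in> overlap c' c" for y
      using that c c' by (auto simp: rep_def X_def chart_vec_def chart_inv_coord)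
    have "smooth_on (overlap c' c)
        (\<lambda>y. dd (transition c c') (transition c' c y) (\<beta> (transition c' c y) *\<^sub>R u))"
      by (intro smooth_dd_transition[OF c c', where s = "\<lambda>x. \<beta> x *\<^sub>R u"] smooth_on_scaleR
          smooth_on_const open_overlap[OF c c'] smooth_on_subset[OF \<beta>(1)]) auto
    hence "smooth_on (overlap c' c) (rep c' X)"
      using smooth_on_cong[OF open_overlap[OF c' c] ov] by simp
    moreover have opN: "open ?N" using opK c' by (simp add: openin_atlas)
    have "rep c' X y = 0" if y: "y \<in> ?N" for y
    proof -
      obtain q where q: "y = coord c' q" "q \<in> chart_dom c'" "q \<notin> K" using y by auto
      have "\<beta> (coord c q) = 0" if qc: "q \<in> chart_dom c"
      proof (rule \<beta>(3), rule)
        assume "coord c q \<in> cball (coord c p) r"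
        hence "chart_inv c (coord c q) \<in> K" unfolding K_def by blast
        thus False using q c qc by (simp add: chart_inv_coord)
      qed
      thus ?thesis
        using q c' tangent_eq_chart_vec[OF tangent_zero, of c q, symmetric] c
        by (auto simp: rep_def X_def chart_inv_coord)
    qed
    hence "smooth_on ?N (rep c' X)"
      using smooth_on_cong[OF opN, of "rep c' X" "\<lambda>_. 0"] by (simp add: smooth_on_const)
    ultimately have "smooth_on (overlap c' c \<union> ?N) (rep c' X)"
      by (intro smooth_on_Un open_overlap c c' opN)
    moreover have "chart_ran c' \<subseteq> overlap c' c \<union> ?N"
    proof
      fix y assume "y \<in> chart_ran c'"
      then obtain q where q: "q \<in> chart_dom c'" "y = coord c' q" by (auto simp: chart_ran_def)
      have "q \<in> chart_dom c" if "q \<in> K" using that r(2) chart_inv_dom[of _ c] unfolding K_def by blast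
      thus "y \<in> overlap c' c \<union> ?N" using q chart_dom_points[OF c'] by blast
    qed
    ultimately show ?thesis by (rule smooth_on_subset)
  qed
  have "vector_field A X" using X_tan sm by (simp add: vector_field_iff)
  moreover have "X p c = u" using p c \<beta>(2) by (simp add: X_def chart_vec_self)
  ultimately show ?thesis by (rule that)
qed

end

section \<open>Flatness in components\<close>

context riemannian
begin

text \<open>\<open>flat\<close> speaks of global fields; \<open>vector_field_through\<close>
  supplies fields with prescribed values at the point, and tensoriality makes their other values
  irrelevant.\<close>

lemma flatD:
  assumes "flat A k" "Hausdorff_space (atlas_topology A)" "c \<in> A" "x \<in> chart_ran c"
  shows "curv (\<Gamma>c c) x u v w = 0"
proof -
  let ?p = "chart_inv c x"
  note p = chart_inv_dom[OF assms(4)]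
  obtain X where X: "vector_field A X" "X ?p c = u" by (rule vector_field_through[OF assms(2,3) p])
  obtain Y where Y: "vector_field A Y" "Y ?p c = v" by (rule vector_field_through[OF assms(2,3) p])
  obtain Z where Z: "vector_field A Z" "Z ?p c = w" by (rule vector_field_through[OF assms(2,3) p])
  have "curvature A k X Y Z ?p = (\<lambda>c. 0)"
    using assms(1) X Y Z chart_dom_points[OF assms(3) p] by (simp add: flat_def)
  hence "rep c (curvature A k X Y Z) x = 0" by (simp add: rep_def)
  thus ?thesis
    using rep_curvature_eq[OF X(1) Y(1) Z(1) assms(3,4)] X Y Z by (simp add: rep_def)
qed

lemma flatI:
  assumes "\<And>c x u v w. c \<in> A \<Longrightarrow> x \<in> chart_ran c \<Longrightarrow> curv (\<Gamma>c c) x u v w = 0"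
  shows "flat A k"
  unfolding flat_def
proof (intro allI impI ballI ext)
  fix X Y Z p c assume X: "vector_field A X" "vector_field A Y" "vector_field A Z"
  show "curvature A k X Y Z p c = 0"
  proof (cases "c \<in> A \<and> p \<in> chart_dom c")
    case True
    hence "curvature A k X Y Z p c = rep c (curvature A k X Y Z) (coord c p)" by (simp add: rep_coord)
    thus ?thesis using True rep_curvature_eq[OF X] assms by (simp add: coord_in_ran)
  next
    \<comment> \<open>\<open>flat\<close> compares whole families of components, so the default
      value 0 in charts away from \<open>p\<close> has to be checked too.\<close>
    case False
    hence "nabla A k X Y p c = 0" for X Y by (auto simp: nabla_def)
    thus ?thesis by (simp add: curvature_def)
  qed
qed

end


section \<open>The metric on the tangent bundle in an induced chart\<close>

text \<open>A derivative along the fibre can be read off from the restriction of \<open>f\<close> to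
  that fibre, where explicit polynomials are available.\<close>

lemma dd_vertical:
  assumes "f differentiable (at z)" "((\<lambda>w. f (fst z, w)) has_derivative f') (at (snd z))"
  shows "dd f z (0, v) = f' v"
proof -
  have "((\<lambda>w. f (fst z, w)) has_derivative (\<lambda>v. dd f z (0, v))) (at (snd z))"
    by (rule has_derivative_compose[where g = f and f = "Pair (fst z)" and x = "snd z"])
      (auto intro!: derivative_eq_intros has_derivative_dd[OF assms(1)])
  from has_derivative_unique[OF this assms(2)] show ?thesis by metis
qed

lemma dd_fst:
  assumes "f differentiable (at (fst z))"
  shows "dd (\<lambda>z. f (fst z)) z h = dd f (fst z) (fst h)"
proof -
  have "((\<lambda>z. f (fst z)) has_derivative (\<lambda>h. dd f (fst z) (fst h))) (at z)"
    by (rule has_derivative_compose[where g = f and f = fst])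
      (auto intro!: derivative_eq_intros has_derivative_dd[OF assms])
  thus ?thesis by (simp only: dd_eq)
qed

lemma dd_Pair:
  "f differentiable (at z) \<Longrightarrow> g differentiable (at z) \<Longrightarrow> dd (\<lambda>z. (f z, g z)) z h = (dd f z h, dd g z h)"
  using dd_eq[OF has_derivative_Pair[OF has_derivative_dd has_derivative_dd]] by metis

lemma levi_civita_cong:
  assumes "open S" "x \<in> S" "\<And>y. y \<in> S \<Longrightarrow> gm y = gm' y"
  shows "levi_civita gm x = levi_civita gm' x"
proof -
  have "dd (\<lambda>y. gm y u v) x = dd (\<lambda>y. gm' y u v) x" for u v
    by (rule dd_cong[OF assms(1,2)]) (simp add: assms(3))
  thus ?thesis by (simp add: levi_civita_def assms(2,3))
qed

text \<open>
  With \<open>\<beta> = b / a\<close> and \<open>q = (a (a + c) - b\<^sup>2) / a\<close>, the frame \<open>X\<^sup>h - \<beta> X\<^sup>v, X\<^sup>v\<close> is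
  orthogonal for the metric \<open>a g\<^sup>s + b g\<^sup>h + c g\<^sup>v\<close>, which is \<open>q g\<close> on the first and \<open>a g\<close> on the
  second summand. \<open>hat z\<close> gives the components with respect to this frame.
\<close>

locale tb_metric = local_metric S gm for S :: "'e::euclidean_space set" and gm +
  fixes a q \<beta> :: real
  assumes a_pos: "a > 0" and q_pos: "q > 0"
begin

abbreviation TS :: "('e \<times> 'e) set" where "TS \<equiv> S \<times> UNIV"

definition hat :: "'e \<times> 'e \<Rightarrow> 'e \<times> 'e \<Rightarrow> 'e \<times> 'e" where
  "hat z V = (fst V, snd V + \<Gamma> (fst z) (snd z) (fst V) + \<beta> *\<^sub>R fst V)"

definition unhat :: "'e \<times> 'e \<Rightarrow> 'e \<times> 'e \<Rightarrow> 'e \<times> 'e" where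
  "unhat z V = (fst V, snd V - \<Gamma> (fst z) (snd z) (fst V) - \<beta> *\<^sub>R fst V)"

definition ghat :: "'e \<Rightarrow> 'e \<times> 'e \<Rightarrow> 'e \<times> 'e \<Rightarrow> real" where
  "ghat x U V = q * gm x (fst U) (fst V) + a * gm x (snd U) (snd V)"

definition gtm :: "'e \<times> 'e \<Rightarrow> 'e \<times> 'e \<Rightarrow> 'e \<times> 'e \<Rightarrow> real" where
  "gtm z U V = ghat (fst z) (hat z U) (hat z V)"

lemma hat_unhat [simp]: "hat z (unhat z V) = V"
  by (simp add: hat_def unhat_def)

lemma open_TS: "open TS"
  by (intro open_Times open_S open_UNIV)

lemma linear_hat: "z \<in> TS \<Longrightarrow> linear (hat z)"
  by (rule linearI)
    (auto simp: hat_def bilinear_radd[OF bilinear_\<Gamma>] bilinear_rmul[OF bilinear_\<Gamma>] algebra_simps)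

lemma bilinear_ghat: "x \<in> S \<Longrightarrow> bilinear (ghat x)"
  unfolding bilinear_def linear_iff ghat_def
  by (simp add: bilinear_ladd[OF bil] bilinear_radd[OF bil] bilinear_lmul[OF bil] bilinear_rmul[OF bil]
      algebra_simps)

lemma fst_in_S: "z \<in> TS \<Longrightarrow> fst z \<in> S"
  by auto

lemma smooth_on_fst_TS: "smooth_on S f \<Longrightarrow> smooth_on TS (\<lambda>z. f (fst z))"
  by (rule smooth_on_base[OF open_S])

lemma smooth_gm_TS:
  "smooth_on TS s \<Longrightarrow> smooth_on TS t \<Longrightarrow> smooth_on TS (\<lambda>z. gm (fst z) (s z) (t z))"
  by (rule smooth_on_family2[where B = "\<lambda>z. gm (fst z)", OF open_TS bil[OF fst_in_S] smooth_on_fst_TS[OF smooth]])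

lemma smooth_\<Gamma>_TS:
  "smooth_on TS s \<Longrightarrow> smooth_on TS t \<Longrightarrow> smooth_on TS (\<lambda>z. \<Gamma> (fst z) (s z) (t z))"
  by (rule smooth_on_family2[where B = "\<lambda>z. \<Gamma> (fst z)",
      OF open_TS bilinear_\<Gamma>[OF fst_in_S] smooth_on_fst_TS[OF smooth_\<Gamma>]])

lemma bilinear_R: "x \<in> S \<Longrightarrow> bilinear (\<lambda>u v. R x u v w)"
  by (simp add: bilinear_def linear_R)

lemma smooth_R_TS:
  assumes "smooth_on TS s" "smooth_on TS t" "smooth_on TS r"
  shows "smooth_on TS (\<lambda>z. R (fst z) (s z) (t z) (r z))"
proof (rule smooth_on_family[where L = "\<lambda>z. R (fst z) (s z) (t z)", OF open_TS _ _ assms(3)])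
  show "linear (R (fst z) (s z) (t z))" if "z \<in> TS" for z using linear_R(3)[of "fst z"] that by auto
  show "smooth_on TS (\<lambda>z. R (fst z) (s z) (t z) u)" for u
    by (rule smooth_on_family2[where B = "\<lambda>z u' v. R (fst z) u' v u",
        OF open_TS bilinear_R[OF fst_in_S] smooth_on_fst_TS[OF smooth_R] assms(1,2)])
qed

lemma smooth_snd: "smooth_on TS snd"
  by (intro smooth_on_bounded_linear bounded_linear_snd)

lemma smooth_hat: "smooth_on TS V \<Longrightarrow> smooth_on TS (\<lambda>z. hat z (V z))"
  unfolding hat_def
  by (intro smooth_on_Pair smooth_on_add smooth_\<Gamma>_TS smooth_on_scaleR_const smooth_on_fst smooth_on_snd
      open_TS smooth_snd)

lemma local_metric_gtm: "local_metric TS gtm"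
proof
  show "open TS" by (rule open_TS)
  fix z :: "'e \<times> 'e" and u v assume z: "z \<in> TS"
  have h: "hat z (u + v) = hat z u + hat z v" "hat z (r *\<^sub>R u) = r *\<^sub>R hat z u" for u v r
    by (rule linear_add[OF linear_hat[OF z]] linear_scale[OF linear_hat[OF z]])+
  show "bilinear (gtm z)"
  proof -
    have g: "bilinear (ghat (fst z))" by (rule bilinear_ghat[OF fst_in_S[OF z]])
    show ?thesis
      unfolding bilinear_def linear_iff gtm_def h
      by (simp only: bilinear_ladd[OF g] bilinear_radd[OF g] bilinear_lmul[OF g] bilinear_rmul[OF g] simp_thms)
  qed
  show "gtm z u v = gtm z v u"
    using sym[OF fst_in_S[OF z]] by (simp add: gtm_def ghat_def)
  assume "u \<noteq> 0"
  hence "hat z u \<noteq> 0" using z by (auto simp: hat_def prod_eq_iff bilinear_rzero[OF bilinear_\<Gamma>])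
  hence "fst (hat z u) \<noteq> 0 \<or> snd (hat z u) \<noteq> 0" by (auto simp: prod_eq_iff)
  moreover have "0 \<le> gm (fst z) w w" "w \<noteq> 0 \<Longrightarrow> 0 < gm (fst z) w w" for w
    using pos[OF fst_in_S[OF z], of w] bilinear_lzero[OF bil[OF fst_in_S[OF z]]] by (cases "w = 0"; simp)+
  ultimately show "gtm z u u > 0"
    using a_pos q_pos unfolding gtm_def ghat_def
    by (metis add_nonneg_pos add_pos_nonneg mult_nonneg_nonneg mult_pos_pos less_imp_le)
next
  show "smooth_on TS (\<lambda>z. gtm z u v)" for u v
    unfolding gtm_def ghat_def
    by (intro smooth_on_add smooth_on_mult smooth_gm_TS smooth_on_fst smooth_on_snd smooth_hat
        smooth_on_const open_TS)
qed

sublocale tm: local_metric TS gtm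
  by (rule local_metric_gtm)

text \<open>\<open>omega\<close> is the Levi-Civita connection in this frame (\<open>hat_nab\<close>). As for the Sasaki metric, its
  curvature terms are forced by the torsion \<open>R(X, Y)y\<close> of the pulled back connection.\<close>

definition kap :: real where "kap = a / (2 * q)"

definition omega :: "'e \<times> 'e \<Rightarrow> 'e \<times> 'e \<Rightarrow> 'e \<times> 'e \<Rightarrow> 'e \<times> 'e" where
  "omega z V s = (\<Gamma> (fst z) (fst V) (fst s)
      + kap *\<^sub>R (R (fst z) (snd z) (snd s) (fst V) + R (fst z) (snd z) (snd (hat z V)) (fst s)),
    \<Gamma> (fst z) (fst V) (snd s) - (1/2) *\<^sub>R R (fst z) (fst V) (fst s) (snd z))"

text \<open>The derivative of the frame change \<open>hat\<close> in direction \<open>W\<close> with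
  \<open>U\<close> held fixed. The part with \<beta> has constant coefficients and drops
  out.\<close>

definition frame_derivative :: "'e \<times> 'e \<Rightarrow> 'e \<times> 'e \<Rightarrow> 'e \<times> 'e \<Rightarrow> 'e \<times> 'e" where
  "frame_derivative z W U = (0, dd (\<lambda>x. \<Gamma> x (snd z) (fst U)) (fst z) (fst W) + \<Gamma> (fst z) (snd W) (fst U))"

lemma hat_has_derivative:
  assumes z: "z \<in> TS" and V: "(V has_derivative V') (at z)"
  shows "((\<lambda>z. hat z (V z)) has_derivative (\<lambda>h. hat z (V' h) + frame_derivative z h (V z))) (at z)"
proof -
  have x: "fst z \<in> S" using z by auto
  have V12: "((\<lambda>z. fst (V z)) has_derivative (\<lambda>h. fst (V' h))) (at z)"
    "((\<lambda>z. snd (V z)) has_derivative (\<lambda>h. snd (V' h))) (at z)"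
    using V by (auto intro!: derivative_eq_intros)
  have snd': "(snd has_derivative snd) (at z)" by (auto intro!: derivative_eq_intros)
  have "((\<lambda>z. \<Gamma> (fst z) (snd z) (fst (V z))) has_derivative
      (\<lambda>h. dd (\<lambda>z'. \<Gamma> (fst z') (snd z) (fst (V z))) z h + \<Gamma> (fst z) (snd h) (fst (V z))
        + \<Gamma> (fst z) (snd z) (fst (V' h)))) (at z)"
    by (rule family2_has_derivative[where B = "\<lambda>z. \<Gamma> (fst z)", OF open_TS z bilinear_\<Gamma>[OF fst_in_S]
          smooth_on_differentiable[OF smooth_on_fst_TS[OF smooth_\<Gamma>] z] snd' V12(1)])
  hence "((\<lambda>z. \<Gamma> (fst z) (snd z) (fst (V z))) has_derivative
      (\<lambda>h. dd (\<lambda>x. \<Gamma> x (snd z) (fst (V z))) (fst z) (fst h) + \<Gamma> (fst z) (snd h) (fst (V z))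
        + \<Gamma> (fst z) (snd z) (fst (V' h)))) (at z)"
    unfolding dd_fst[where f = "\<lambda>x. \<Gamma> x (snd z) (fst (V z))", OF smooth_on_differentiable[OF smooth_\<Gamma> x]] .
  from has_derivative_Pair[OF V12(1) has_derivative_add[OF has_derivative_add[OF V12(2) this]
        has_derivative_scaleR_right[OF V12(1)]]]
  show ?thesis unfolding hat_def frame_derivative_def by (simp add: add_ac)
qed

text \<open>Metric compatibility of the pulled back connection; it will be applied to each of the
  two orthogonal summands.\<close>

lemma gm_TS_has_derivative:
  assumes z: "z \<in> TS" and s: "(s has_derivative s') (at z)" and t: "(t has_derivative t') (at z)"
  shows "((\<lambda>z. gm (fst z) (s z) (t z)) has_derivative
    (\<lambda>h. gm (fst z) (\<Gamma> (fst z) (fst h) (s z) + s' h) (t z) + gm (fst z) (s z) (\<Gamma> (fst z) (fst h) (t z) + t' h))) (at z)"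
proof -
  have x: "fst z \<in> S" using z by auto
  have "((\<lambda>z. gm (fst z) (s z) (t z)) has_derivative (\<lambda>h. dd (\<lambda>z'. gm (fst z') (s z) (t z)) z h
      + gm (fst z) (s' h) (t z) + gm (fst z) (s z) (t' h))) (at z)"
    by (rule family2_has_derivative[where B = "\<lambda>z. gm (fst z)", OF open_TS z bil[OF fst_in_S]
          smooth_on_differentiable[OF smooth_on_fst_TS[OF smooth] z] s t])
  thus ?thesis
    unfolding dd_fst[where f = "\<lambda>x. gm x (s z) (t z)", OF smooth_on_differentiable[OF smooth x]]
      \<Gamma>_metric[OF x]
    by (simp add: bilinear_ladd[OF bil[OF x]] bilinear_radd[OF bil[OF x]] add_ac)
qed

text \<open>\<open>omega\<close> differs from the pulled back connection by a skew endomorphism. The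
  terms between the two summands cancel by pair symmetry of the curvature, and the remaining one is
  itself skew by \<open>R_skew\<close>.\<close>

lemma omega_skew:
  assumes z: "z \<in> TS"
  shows "ghat (fst z) (omega z W (hat z U)) (hat z V) + ghat (fst z) (hat z U) (omega z W (hat z V)) =
    ghat (fst z) (\<Gamma> (fst z) (fst W) (fst U), \<Gamma> (fst z) (fst W) (snd (hat z U))) (hat z V) +
    ghat (fst z) (hat z U) (\<Gamma> (fst z) (fst W) (fst V), \<Gamma> (fst z) (fst W) (snd (hat z V)))"
proof -
  define x y where "x = fst z" and "y = snd z"
  have x: "x \<in> S" using z by (auto simp: x_def)
  have f: "fst (hat z V) = fst V" for V by (simp add: hat_def)
  \<comment> \<open>The balance that fixes \<open>kap\<close>: it matches the weight
    \<open>q\<close> of the first summand against half the weight \<open>a\<close> of the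
    second.\<close>
  have q: "q * kap = a / 2" using q_pos by (simp add: kap_def)
  have pair: "gm x (R x y u w) v = gm x (R x w v y) u" for u v w by (rule R_pair[OF x])
  note bl = bilinear_ladd[OF bil[OF x]] bilinear_lsub[OF bil[OF x]] bilinear_lmul[OF bil[OF x]]
    bilinear_radd[OF bil[OF x]] bilinear_rsub[OF bil[OF x]] bilinear_rmul[OF bil[OF x]]
  have 1: "ghat x (omega z W (hat z U)) (hat z V) =
    ghat x (\<Gamma> x (fst W) (fst U), \<Gamma> x (fst W) (snd (hat z U))) (hat z V)
    + (q * kap) * (gm x (R x y (snd (hat z U)) (fst W)) (fst V) + gm x (R x y (snd (hat z W)) (fst U)) (fst V))
    - (a / 2) * gm x (R x (fst W) (fst U) y) (snd (hat z V))" for U V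
    unfolding ghat_def omega_def x_def[symmetric] y_def[symmetric] f
    by (simp add: bl f algebra_simps)
  have s: "ghat x U V = ghat x V U" for U V unfolding ghat_def by (simp add: sym[OF x])
  show ?thesis
    unfolding x_def[symmetric] s[of "hat z U"] 1 q pair[of _ "fst W"]
    using R_skew[OF x, of y "snd (hat z W)" "fst U" "fst V"] sym[OF x]
    by (simp add: algebra_simps)
qed

text \<open>In the first component the curvature terms are symmetric in the two fields. In the
  second, swapping the fields in the frame derivatives leaves the torsion \<open>R(V, U)y\<close>,
  which the term with factor \<open>1/2\<close> absorbs.\<close>

lemma omega_torsion:
  assumes z: "z \<in> TS"
  shows "frame_derivative z V U + omega z V (hat z U) = frame_derivative z U V + omega z U (hat z V)"
proof -
  define x y where "x = fst z" and "y = snd z"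
  have x: "x \<in> S" using z by (auto simp: x_def)
  note bl = bilinear_radd[OF bilinear_\<Gamma>[OF x]] bilinear_rmul[OF bilinear_\<Gamma>[OF x]]
  have dd_sym: "dd (\<lambda>x. \<Gamma> x v u) x = dd (\<lambda>x. \<Gamma> x u v) x" for u v
    by (rule dd_cong[OF open_S x]) (rule \<Gamma>_sym)
  have "R x (fst V) (fst U) y = dd (\<lambda>x. \<Gamma> x y (fst U)) x (fst V) - dd (\<lambda>x. \<Gamma> x y (fst V)) x (fst U)
      + \<Gamma> x (fst V) (\<Gamma> x y (fst U)) - \<Gamma> x (fst U) (\<Gamma> x y (fst V))"
    unfolding curv_def dd_sym[of y] \<Gamma>_sym[OF x, of _ y] ..
  moreover have "R x (fst U) (fst V) y = - R x (fst V) (fst U) y" by (rule curv_antisym)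
  \<comment> \<open>Half of the torsion is absorbed on either side of the equation.\<close>
  moreover have "r = (1/2) *\<^sub>R r + (1/2) *\<^sub>R r" for r :: 'e
    by (metis scaleR_half_double scaleR_add_right)
  ultimately show ?thesis
    unfolding frame_derivative_def omega_def x_def[symmetric] y_def[symmetric]
    using \<Gamma>_sym[OF x, of "fst V" "fst U"] \<Gamma>_sym[OF x, of "fst V" "snd U"] \<Gamma>_sym[OF x, of "fst U" "snd V"]
    by (simp add: hat_def x_def[symmetric] y_def[symmetric] bl algebra_simps)
qed

text \<open>The right-hand side, brought back to coordinates by \<open>unhat\<close>, is
  torsion-free by \<open>omega_torsion\<close> and metric by \<open>omega_skew\<close>, so
  uniqueness identifies it with the Levi-Civita connection.\<close>

lemma hat_levi_civita:
  assumes z: "z \<in> TS"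
  shows "hat z (tm.\<Gamma> z V U) = frame_derivative z V U + omega z V (hat z U)"
proof -
  have x: "fst z \<in> S" using z by auto
  define F where "F V U = unhat z (frame_derivative z V U + omega z V (hat z U))" for V U
  have "tm.\<Gamma> z V U - F V U = 0"
  proof (rule tm.skew_symmetric_zero[where T = "\<lambda>V U. tm.\<Gamma> z V U - F V U", OF z])
    show "tm.\<Gamma> z V U - F V U = tm.\<Gamma> z U V - F U V" for U V
      unfolding tm.\<Gamma>_sym[OF z, of V U] F_def omega_torsion[OF z, of V U] ..
    fix W U V
    have hd: "((\<lambda>z. hat z U) has_derivative (\<lambda>h. frame_derivative z h U)) (at z)" for U
      using hat_has_derivative[OF z has_derivative_const[of U]] linear_0[OF linear_hat[OF z]] by simp
    have "((\<lambda>z. gtm z U V) has_derivative (\<lambda>h.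
        ghat (fst z) (\<Gamma> (fst z) (fst h) (fst U), \<Gamma> (fst z) (fst h) (snd (hat z U)) + snd (frame_derivative z h U)) (hat z V)
        + ghat (fst z) (hat z U) (\<Gamma> (fst z) (fst h) (fst V), \<Gamma> (fst z) (fst h) (snd (hat z V)) + snd (frame_derivative z h V)))) (at z)"
      using has_derivative_add[OF
        has_derivative_mult_right[OF gm_TS_has_derivative[OF z has_derivative_const[of "fst U"] has_derivative_const[of "fst V"]], of q]
        has_derivative_mult_right[OF gm_TS_has_derivative[OF z has_derivative_snd[OF hd[of U]] has_derivative_snd[OF hd[of V]]], of a]]
      unfolding gtm_def ghat_def by (simp add: hat_def algebra_simps)
    from dd_eq[OF this]
    have "gtm z (tm.\<Gamma> z W U) V + gtm z U (tm.\<Gamma> z W V) =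
        ghat (fst z) (\<Gamma> (fst z) (fst W) (fst U), \<Gamma> (fst z) (fst W) (snd (hat z U)) + snd (frame_derivative z W U)) (hat z V)
        + ghat (fst z) (hat z U) (\<Gamma> (fst z) (fst W) (fst V), \<Gamma> (fst z) (fst W) (snd (hat z V)) + snd (frame_derivative z W V))"
      unfolding tm.\<Gamma>_metric[OF z, symmetric] by simp
    also have "\<dots> = ghat (fst z) (\<Gamma> (fst z) (fst W) (fst U), \<Gamma> (fst z) (fst W) (snd (hat z U))) (hat z V)
        + ghat (fst z) (hat z U) (\<Gamma> (fst z) (fst W) (fst V), \<Gamma> (fst z) (fst W) (snd (hat z V)))
        + ghat (fst z) (frame_derivative z W U) (hat z V) + ghat (fst z) (hat z U) (frame_derivative z W V)"
      by (simp add: ghat_def frame_derivative_def bilinear_ladd[OF bil[OF x]] bilinear_radd[OF bil[OF x]]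
          bilinear_lzero[OF bil[OF x]] bilinear_rzero[OF bil[OF x]] algebra_simps)
    also have "\<dots> = gtm z (F W U) V + gtm z U (F W V)"
      unfolding omega_skew[OF z, symmetric]
      by (simp add: gtm_def F_def bilinear_ladd[OF bilinear_ghat[OF x]] bilinear_radd[OF bilinear_ghat[OF x]])
    finally show "gtm z (tm.\<Gamma> z W U - F W U) V + gtm z U (tm.\<Gamma> z W V - F W V) = 0"
      by (simp add: bilinear_lsub[OF tm.bil[OF z]] bilinear_rsub[OF tm.bil[OF z]])
  qed
  thus ?thesis by (simp add: F_def)
qed

lemma hat_nab:
  assumes z: "z \<in> TS" and s: "s differentiable (at z)"
  shows "hat z (nab tm.\<Gamma> V s z) = nab omega V (\<lambda>z. hat z (s z)) z"
  using dd_eq[OF hat_has_derivative[OF z has_derivative_dd[OF s]]]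
  by (simp add: nab_def linear_add[OF linear_hat[OF z]] hat_levi_civita[OF z])

lemma bilinear_omega:
  assumes z: "z \<in> TS"
  shows "bilinear (omega z)"
proof -
  define x y where "x = fst z" and "y = snd z"
  have x: "x \<in> S" using z by (auto simp: x_def)
  note R_add = linear_R[OF x, THEN linear_add] and R_scale = linear_R[OF x, THEN linear_scale]
  note h = linear_add[OF linear_hat[OF z]] linear_scale[OF linear_hat[OF z]]
  show ?thesis
    unfolding bilinear_def linear_iff omega_def x_def[symmetric] y_def[symmetric]
    by (simp add: h bilinear_ladd[OF bilinear_\<Gamma>[OF x]] bilinear_radd[OF bilinear_\<Gamma>[OF x]]
        bilinear_lmul[OF bilinear_\<Gamma>[OF x]] bilinear_rmul[OF bilinear_\<Gamma>[OF x]] R_add R_scale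
        scaleR_add_right scaleR_diff_right mult.commute)
qed

lemma smooth_omega: "smooth_on TS (\<lambda>z. omega z u v)"
  unfolding omega_def
  by (intro smooth_on_Pair smooth_on_add smooth_on_diff smooth_on_scaleR_const smooth_\<Gamma>_TS smooth_R_TS
      smooth_on_const smooth_snd smooth_on_snd smooth_hat open_TS)

text \<open>A gauge change: \<open>hat_nab\<close> applied twice to constant fields conjugates the
  curvature. Only the differentiated argument is moved into the frame; the directions
  \<open>u\<close> and \<open>v\<close> keep their coordinate components.\<close>

lemma hat_curv:
  assumes z: "z \<in> TS"
  shows "hat z (curv tm.\<Gamma> z u v w) = curv omega z u v (hat z w)"
proof -
  let ?s = "\<lambda>z. hat z w"
  have s: "smooth_on TS ?s" by (rule smooth_hat[OF smooth_on_const])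
  have dw: "(\<lambda>_. w) differentiable at y" for y :: "'e \<times> 'e" by simp
  have nn: "hat z (nab tm.\<Gamma> V (nab tm.\<Gamma> U (\<lambda>_. w)) z) = nab omega V (nab omega U ?s) z"
    if U: "smooth_on TS U" for V U
  proof -
    have "smooth_on TS (nab tm.\<Gamma> U (\<lambda>_. w))"
      by (rule smooth_on_nab[OF open_TS tm.bilinear_\<Gamma> tm.smooth_\<Gamma> U smooth_on_const])
    hence "hat z (nab tm.\<Gamma> V (nab tm.\<Gamma> U (\<lambda>_. w)) z) = nab omega V (\<lambda>z. hat z (nab tm.\<Gamma> U (\<lambda>_. w) z)) z"
      by (intro hat_nab[OF z] smooth_on_differentiable[OF _ z])
    also have "\<dots> = nab omega V (nab omega U ?s) z"
      by (rule nab_cong[OF open_TS z hat_nab[OF _ dw] refl])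
    finally show ?thesis .
  qed
  have "hat z (field_curv tm.\<Gamma> (\<lambda>_. u) (\<lambda>_. v) (\<lambda>_. w) z) = field_curv omega (\<lambda>_. u) (\<lambda>_. v) ?s z"
    unfolding field_curv_def by (simp add: linear_diff[OF linear_hat[OF z]] nn smooth_on_const hat_nab[OF z dw])
  moreover have "field_curv tm.\<Gamma> (\<lambda>_. u) (\<lambda>_. v) (\<lambda>_. w) z = curv tm.\<Gamma> z u v w"
    by (rule field_curv_eq[OF open_TS z tm.bilinear_\<Gamma> tm.smooth_\<Gamma>]) (assumption | rule smooth_on_const)+
  moreover have "field_curv omega (\<lambda>_. u) (\<lambda>_. v) ?s z = curv omega z u v (hat z w)"
    by (rule field_curv_eq[OF open_TS z bilinear_omega smooth_omega _ _ s]) (assumption | rule smooth_on_const)+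
  ultimately show ?thesis by simp
qed

section \<open>The curvature of G on vertical arguments and over a flat base\<close>

lemma R_zero:
  assumes "x \<in> S"
  shows "R x 0 v w = 0" "R x u 0 w = 0" "R x u v 0 = 0" "R x u u w = 0"
  using linear_R[OF assms, THEN linear_0] curv_antisym[of \<Gamma> x u u w] by (auto simp: eq_neg_iff_add_eq_0 scaleR_2[symmetric])

lemma omega_vertical:
  assumes z: "z \<in> TS"
  shows "omega z u (0, s) = (kap *\<^sub>R R (fst z) (snd z) s (fst u), \<Gamma> (fst z) (fst u) s)"
    "omega z (0, v) w = (kap *\<^sub>R R (fst z) (snd z) v (fst w), 0)"
  using R_zero[OF fst_in_S[OF z]] bilinear_\<Gamma>[OF fst_in_S[OF z]]
  by (simp_all add: omega_def hat_def bilinear_lzero bilinear_rzero)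

text \<open>Vertical frame fields are parallel along the fibres, so two of the four terms of
  \<open>curv\<close> vanish. In the derivative that is left the direction is vertical, and there
  \<open>omega\<close> is linear in the fibre coordinate, so R itself is not differentiated.\<close>

lemma curv_omega_vertical:
  assumes z: "z \<in> TS"
  shows "curv omega z u (0, v) (0, s) =
    (- (kap *\<^sub>R R (fst z) v s (fst u) + (kap * kap) *\<^sub>R R (fst z) (snd z) v (R (fst z) (snd z) s (fst u))), 0)"
proof -
  have x: "fst z \<in> S" using z by auto
  have 1: "dd (\<lambda>z. omega z (0, v) (0, s)) z u = 0"
    using dd_cong[OF open_TS z, of "\<lambda>z. omega z (0, v) (0, s)" "\<lambda>_. 0"] omega_vertical(2) R_zero
    by (auto simp: zero_prod_def)
  let ?f = "\<lambda>z. (kap *\<^sub>R R (fst z) (snd z) s (fst u), \<Gamma> (fst z) (fst u) s)"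
  have sm: "smooth_on TS ?f"
    by (intro smooth_on_Pair smooth_on_scaleR_const smooth_R_TS smooth_\<Gamma>_TS smooth_on_const smooth_snd open_TS)
  have bl: "bounded_linear (\<lambda>w. R (fst z) w s (fst u))"
    using linear_R(1)[OF x] by (simp add: linear_conv_bounded_linear)
  have "dd (\<lambda>z. omega z u (0, s)) z (0, v) = dd ?f z (0, v)"
    by (rule fun_cong[OF dd_cong[OF open_TS z omega_vertical(1)]])
  also have "\<dots> = (kap *\<^sub>R R (fst z) v s (fst u), 0)"
    by (rule dd_vertical[OF smooth_on_differentiable[OF sm z]])
      (auto intro!: derivative_eq_intros bounded_linear.has_derivative[OF bl])
  finally show ?thesis
    unfolding curv_def[of omega] 1
    using omega_vertical[OF z] R_zero[OF x] linear_scale[OF linear_R(3)[OF x]]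
    by (simp add: bilinear_lzero[OF bilinear_\<Gamma>[OF x]] bilinear_rzero[OF bilinear_\<Gamma>[OF x]])
qed

text \<open>Without curvature terms \<open>omega\<close> is the pullback of the base connection on
  each summand, and so its curvature is that of the base, taken twice.\<close>

lemma curv_omega_flat:
  assumes z: "z \<in> TS" and flat: "\<And>x u v w. x \<in> S \<Longrightarrow> R x u v w = 0"
  shows "curv omega z u v w = 0"
proof -
  have x: "fst z \<in> S" using z by auto
  have om: "omega z u w = (\<Gamma> (fst z) (fst u) (fst w), \<Gamma> (fst z) (fst u) (snd w))" if "z \<in> TS" for z u w
    using flat[OF fst_in_S[OF that]] by (simp add: omega_def)
  have "dd (\<lambda>z. omega z v w) z u =
      (dd (\<lambda>x. \<Gamma> x (fst v) (fst w)) (fst z) (fst u), dd (\<lambda>x. \<Gamma> x (fst v) (snd w)) (fst z) (fst u))" for u v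
  proof -
    have "dd (\<lambda>z. omega z v w) z u = dd (\<lambda>z. (\<Gamma> (fst z) (fst v) (fst w), \<Gamma> (fst z) (fst v) (snd w))) z u"
      by (rule fun_cong[OF dd_cong[OF open_TS z om]])
    also have "\<dots> = (dd (\<lambda>z. \<Gamma> (fst z) (fst v) (fst w)) z u, dd (\<lambda>z. \<Gamma> (fst z) (fst v) (snd w)) z u)"
      by (rule dd_Pair) (intro smooth_on_differentiable[OF smooth_on_fst_TS[OF smooth_\<Gamma>] z])+
    finally show ?thesis
      by (simp add: dd_fst[where f = "\<lambda>x. \<Gamma> x _ _", OF smooth_on_differentiable[OF smooth_\<Gamma> x]])
  qed
  hence "curv omega z u v w = (R (fst z) (fst u) (fst v) (fst w), R (fst z) (fst u) (fst v) (snd w))"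
    by (simp add: curv_def om[OF z])
  thus ?thesis using flat[OF x] by (simp add: zero_prod_def)
qed

lemma kap_pos: "kap > 0"
  using a_pos q_pos by (simp add: kap_def)

lemma hat_eq_0: "z \<in> TS \<Longrightarrow> hat z V = 0 \<Longrightarrow> V = 0"
  by (auto simp: hat_def prod_eq_iff bilinear_rzero[OF bilinear_\<Gamma>])

lemma hat_inject: "z \<in> TS \<Longrightarrow> hat z U = hat z V \<longleftrightarrow> U = V"
  by (auto simp: hat_def prod_eq_iff)

end


section \<open>The atlas of the tangent bundle\<close>

lemma tb_dom: "(p, y) \<in> chart_dom (tb_chart A c) \<longleftrightarrow> p \<in> chart_dom c \<and> y \<in> tangent_space A p"
  by (simp add: tb_chart_def)

lemma tb_coord: "coord (tb_chart A c) (p, y) = (coord c p, y c)"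
  by (simp add: tb_chart_def)

lemma inv_tb_chart: "c \<in> A \<Longrightarrow> inv_into A (tb_chart A) (tb_chart A c) = c"
  by (rule inv_into_f_f[OF inj_on_subset[OF inj_tb_chart subset_UNIV]])

lemma tb_chart_in_atlas: "c \<in> A \<Longrightarrow> tb_chart A c \<in> tb_atlas A"
  by (simp add: tb_atlas_def)

context atlas
begin

lemma inj_tb_coord: "c \<in> A \<Longrightarrow> inj_on (coord (tb_chart A c)) (chart_dom (tb_chart A c))"
proof (rule inj_onI)
  fix z z' assume c: "c \<in> A" and z: "z \<in> chart_dom (tb_chart A c)" "z' \<in> chart_dom (tb_chart A c)"
    "coord (tb_chart A c) z = coord (tb_chart A c) z'"
  obtain p y p' y' where zp: "z = (p, y)" "z' = (p', y')" by (cases z, cases z')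
  have "p = p'" using z inj_onD[OF inj_coord[OF c], of p p'] by (simp add: zp tb_dom tb_coord)
  moreover from this have "y = y'"
    using z tangent_eqI[of y p y' c] c by (simp add: zp tb_dom tb_coord)
  ultimately show "z = z'" by (simp add: zp)
qed

lemma tb_ran:
  assumes c: "c \<in> A"
  shows "chart_ran (tb_chart A c) = chart_ran c \<times> UNIV"
proof
  show "chart_ran (tb_chart A c) \<subseteq> chart_ran c \<times> UNIV"
    by (auto simp: chart_ran_def tb_dom tb_coord)
  show "chart_ran c \<times> UNIV \<subseteq> chart_ran (tb_chart A c)"
  proof clarify
    fix x w assume x: "x \<in> chart_ran c"
    let ?z = "(chart_inv c x, chart_vec A c (chart_inv c x) w)"
    have "?z \<in> chart_dom (tb_chart A c)" "coord (tb_chart A c) ?z = (x, w)"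
      using c chart_inv_dom[OF x] coord_chart_inv[OF x]
      by (auto simp: tb_dom tb_coord chart_vec_tangent chart_vec_self)
    thus "(x, w) \<in> chart_ran (tb_chart A c)" unfolding chart_ran_def by (metis imageI)
  qed
qed

lemma tb_inv:
  assumes c: "c \<in> A" and x: "x \<in> chart_ran c"
  shows "chart_inv (tb_chart A c) (x, w) = (chart_inv c x, chart_vec A c (chart_inv c x) w)"
  unfolding chart_inv_def[of "tb_chart A c"]
  by (rule inv_into_f_eq[OF inj_tb_coord[OF c]])
    (use c chart_inv_dom[OF x] coord_chart_inv[OF x] in
      \<open>auto simp: tb_dom tb_coord chart_vec_tangent chart_vec_self\<close>)

lemma tb_overlap:
  assumes c: "c \<in> A" "c' \<in> A"
  shows "overlap (tb_chart A c) (tb_chart A c') = overlap c c' \<times> UNIV"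
proof
  show "overlap (tb_chart A c) (tb_chart A c') \<subseteq> overlap c c' \<times> UNIV"
    by (auto simp: tb_dom tb_coord)
  show "overlap c c' \<times> UNIV \<subseteq> overlap (tb_chart A c) (tb_chart A c')"
  proof clarify
    fix w p assume p: "p \<in> chart_dom c" "p \<in> chart_dom c'"
    have "coord (tb_chart A c) (p, chart_vec A c p w) = (coord c p, w)"
      using c p by (simp add: tb_coord chart_vec_self)
    moreover have "(p, chart_vec A c p w) \<in> chart_dom (tb_chart A c) \<inter> chart_dom (tb_chart A c')"
      using c p by (simp add: tb_dom chart_vec_tangent)
    ultimately show "(coord c p, w) \<in> overlap (tb_chart A c) (tb_chart A c')" by (metis imageI)
  qed
qed

lemma tb_transition:
  assumes c: "c \<in> A" "c' \<in> A" and x: "x \<in> overlap c c'"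
  shows "transition (tb_chart A c) (tb_chart A c') (x, w) = (transition c c' x, dd (transition c c') x w)"
proof -
  have xr: "x \<in> chart_ran c" by (rule subsetD[OF overlap_subset x])
  have p: "chart_inv c x \<in> chart_dom c'" using overlap_iff[OF c(1), of x c'] x by simp
  show ?thesis
    using c p coord_chart_inv[OF xr]
    by (simp add: tb_inv[OF c(1) xr] tb_coord chart_vec_def)
qed

lemma smooth_tb_transition:
  assumes c: "c \<in> A" "c' \<in> A"
  shows "smooth_on (overlap c c' \<times> UNIV) (transition (tb_chart A c) (tb_chart A c'))"
proof -
  let ?S = "overlap c c' \<times> (UNIV :: 'e set)"
  note op = open_overlap[OF c] and sm = smooth_trans[OF c]
  have opS: "open ?S" by (intro open_Times op open_UNIV)
  have "smooth_on ?S (\<lambda>z. dd (transition c c') (fst z) (snd z))"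
    by (rule smooth_on_family[where L = "\<lambda>z. dd (transition c c') (fst z)", OF opS _
        smooth_on_base[OF op smooth_on_dd[OF sm]] smooth_on_bounded_linear[OF bounded_linear_snd]])
      (use linear_dd_trans[OF c] in auto)
  hence "smooth_on ?S (\<lambda>z. (transition c c' (fst z), dd (transition c c') (fst z) (snd z)))"
    by (intro smooth_on_Pair opS smooth_on_base op sm)
  thus ?thesis
    by (subst smooth_on_cong[OF opS, of _ "\<lambda>z. (transition c c' (fst z), dd (transition c c') (fst z) (snd z))"])
      (use tb_transition[OF c] in auto)
qed

lemma atlas_tb: "atlas (tb_atlas A)"
proof
  show "smooth_atlas (tb_atlas A)"
    unfolding smooth_atlas_def
  proof (intro conjI ballI)
    fix C assume "C \<in> tb_atlas A"
    then obtain c where c: "c \<in> A" "C = tb_chart A c" by (auto simp: tb_atlas_def)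
    show "inj_on (coord C) (chart_dom C)" using c inj_tb_coord by simp
    show "open (chart_ran C)" using c by (simp add: tb_ran open_Times open_chart_ran)
    fix C' assume "C' \<in> tb_atlas A"
    then obtain c' where c': "c' \<in> A" "C' = tb_chart A c'" by (auto simp: tb_atlas_def)
    show "open (overlap C C')" unfolding c c' tb_overlap[OF c(1) c'(1)]
      by (intro open_Times open_overlap c c' open_UNIV)
    show "smooth_on (overlap C C') (transition C C')"
      unfolding c c' tb_overlap[OF c(1) c'(1)] by (rule smooth_tb_transition[OF c(1) c'(1)])
  qed
qed

text \<open>The lower left block is the Hessian of the base transition contracted with
  \<open>w\<close>. The same term occurs in \<open>christoffel_transform\<close>, which is why
  horizontal lifts are well defined.\<close>

lemma dd_tb_transition:
  assumes c: "c \<in> A" "c' \<in> A" and x: "x \<in> overlap c c'"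
  shows "dd (transition (tb_chart A c) (tb_chart A c')) (x, w) U =
    (dd (transition c c') x (fst U),
     dd (\<lambda>u. dd (transition c c') u w) x (fst U) + dd (transition c c') x (snd U))"
proof -
  let ?\<phi> = "transition c c'"
  let ?S = "overlap c c' \<times> (UNIV :: 'e set)"
  note op = open_overlap[OF c] and sm = smooth_trans[OF c]
  have opS: "open ?S" by (intro open_Times op open_UNIV)
  have zS: "(x, w) \<in> ?S" using x by simp
  have 1: "((\<lambda>z. ?\<phi> (fst z)) has_derivative (\<lambda>h. dd ?\<phi> x (fst h))) (at (x, w))"
    by (rule has_derivative_compose[where g = ?\<phi>, OF has_derivative_fst[OF has_derivative_ident]],
        simp only: fst_conv, rule smooth_on_has_derivative[OF sm x])
  have "((\<lambda>z. dd ?\<phi> (fst z) (snd z)) has_derivative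
      (\<lambda>h. dd (\<lambda>z. dd ?\<phi> (fst z) (snd (x, w))) (x, w) h + dd ?\<phi> (fst (x, w)) (snd h))) (at (x, w))"
    by (rule family_has_derivative[where L = "\<lambda>z. dd ?\<phi> (fst z)" and s = snd, OF opS zS])
      (use linear_dd_trans[OF c] smooth_on_differentiable[OF smooth_on_base[OF op smooth_on_dd[OF sm]] zS]
        in \<open>auto intro!: derivative_eq_intros\<close>)
  hence 2: "((\<lambda>z. dd ?\<phi> (fst z) (snd z)) has_derivative
      (\<lambda>h. dd (\<lambda>u. dd ?\<phi> u w) x (fst h) + dd ?\<phi> x (snd h))) (at (x, w))"
    using dd_fst[where f = "\<lambda>u. dd ?\<phi> u w" and z = "(x, w)", OF smooth_on_differentiable[OF smooth_on_dd[OF sm]]] x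
    by simp
  have "dd (transition (tb_chart A c) (tb_chart A c')) (x, w) =
      dd (\<lambda>z. (?\<phi> (fst z), dd ?\<phi> (fst z) (snd z))) (x, w)"
    by (rule dd_cong[OF opS zS]) (use tb_transition[OF c] in auto)
  also have "\<dots> = (\<lambda>h. (dd ?\<phi> x (fst h), dd (\<lambda>u. dd ?\<phi> u w) x (fst h) + dd ?\<phi> x (snd h)))"
    by (rule dd_eq[OF has_derivative_Pair[OF 1 2]])
  finally show ?thesis by simp
qed

lemma tb_tangentI:
  assumes y: "y \<in> tangent_space A p"
    and "\<And>C. \<not> (C \<in> tb_atlas A \<and> (p, y) \<in> chart_dom C) \<Longrightarrow> V C = 0"
    and "\<And>c c'. c \<in> A \<Longrightarrow> c' \<in> A \<Longrightarrow> p \<in> chart_dom c \<Longrightarrow> p \<in> chart_dom c' \<Longrightarrow>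
      V (tb_chart A c') = (dd (transition c c') (coord c p) (fst (V (tb_chart A c))),
        dd (\<lambda>u. dd (transition c c') u (y c)) (coord c p) (fst (V (tb_chart A c)))
        + dd (transition c c') (coord c p) (snd (V (tb_chart A c))))"
  shows "V \<in> tangent_space (tb_atlas A) (p, y)"
proof (rule atlas.tangent_spaceI[OF atlas_tb])
  fix C C' assume *: "C \<in> tb_atlas A" "C' \<in> tb_atlas A" "(p, y) \<in> chart_dom C" "(p, y) \<in> chart_dom C'"
  then obtain c c' where c: "c \<in> A" "C = tb_chart A c" "c' \<in> A" "C' = tb_chart A c'"
    by (auto simp: tb_atlas_def)
  have p: "p \<in> chart_dom c" "p \<in> chart_dom c'" using * c by (auto simp: tb_dom)
  show "V C' = dd (transition C C') (coord C (p, y)) (V C)"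
    unfolding c tb_coord dd_tb_transition[OF c(1,3) overlapI[OF p]] by (rule assms(3)[OF c(1,3) p])
qed (rule assms(2))

lemma points_tb: "(p, y) \<in> points (tb_atlas A) \<longleftrightarrow> p \<in> points A \<and> y \<in> tangent_space A p"
  by (auto simp: points_def tb_atlas_def tb_dom)

lemma vlift_comp:
  "c \<in> A \<Longrightarrow> p \<in> chart_dom c \<Longrightarrow> y \<in> tangent_space A p \<Longrightarrow> vlift A X (p, y) (tb_chart A c) = (0, X p c)"
  by (simp add: vlift_def tb_chart_in_atlas tb_dom inv_tb_chart)

lemma vlift_tangent:
  assumes y: "y \<in> tangent_space A p" and X: "X p \<in> tangent_space A p"
  shows "vlift A X (p, y) \<in> tangent_space (tb_atlas A) (p, y)"
proof (rule tb_tangentI[OF y])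
  fix c c' assume c: "c \<in> A" "c' \<in> A" "p \<in> chart_dom c" "p \<in> chart_dom c'"
  have "linear (dd (\<lambda>u. dd (transition c c') u (y c)) (coord c p))"
    by (rule smooth_on_linear_dd[OF smooth_on_dd[OF smooth_trans[OF c(1,2)]] overlapI[OF c(3,4)]])
  thus "vlift A X (p, y) (tb_chart A c') =
     (dd (transition c c') (coord c p) (fst (vlift A X (p, y) (tb_chart A c))),
        dd (\<lambda>u. dd (transition c c') u (y c)) (coord c p) (fst (vlift A X (p, y) (tb_chart A c)))
        + dd (transition c c') (coord c p) (snd (vlift A X (p, y) (tb_chart A c))))"
    unfolding vlift_comp[OF c(1,3) y] vlift_comp[OF c(2,4) y] tangent_spaceD[OF X c]
    using linear_0[OF linear_dd_trans[OF c(1,2) overlapI[OF c(3,4)]]] by (simp add: linear_0)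
qed (auto simp: vlift_def)

lemma tb_vector_field_iff:
  "vector_field (tb_atlas A) V \<longleftrightarrow>
    (\<forall>p y. p \<in> points A \<longrightarrow> y \<in> tangent_space A p \<longrightarrow> V (p, y) \<in> tangent_space (tb_atlas A) (p, y)) \<and>
    (\<forall>c\<in>A. smooth_on (chart_ran c \<times> UNIV) (rep (tb_chart A c) V))"
proof -
  have "(\<forall>z\<in>points (tb_atlas A). V z \<in> tangent_space (tb_atlas A) z) \<longleftrightarrow>
      (\<forall>p y. p \<in> points A \<longrightarrow> y \<in> tangent_space A p \<longrightarrow> V (p, y) \<in> tangent_space (tb_atlas A) (p, y))"
    by (auto simp: points_tb)
  moreover have "(\<forall>C\<in>tb_atlas A. smooth_on (chart_ran C) (rep C V)) \<longleftrightarrow>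
      (\<forall>c\<in>A. smooth_on (chart_ran c \<times> UNIV) (rep (tb_chart A c) V))"
    by (auto simp: tb_atlas_def tb_ran)
  ultimately show ?thesis by (simp only: atlas.vector_field_iff[OF atlas_tb])
qed

lemma rep_vlift:
  "c \<in> A \<Longrightarrow> x \<in> chart_ran c \<Longrightarrow> rep (tb_chart A c) (vlift A X) (x, w) = (0, rep c X x)"
  by (simp add: rep_def tb_inv vlift_comp chart_inv_dom chart_vec_tangent)

lemma vector_field_vlift:
  assumes X: "vector_field A X"
  shows "vector_field (tb_atlas A) (vlift A X)"
  unfolding tb_vector_field_iff
proof (intro conjI allI impI ballI)
  show "vlift A X (p, y) \<in> tangent_space (tb_atlas A) (p, y)"
    if "p \<in> points A" "y \<in> tangent_space A p" for p y
    by (rule vlift_tangent[where X = X, OF that(2) vector_field_tangent[OF X that(1)]])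
  fix c assume c: "c \<in> A"
  have op: "open (chart_ran c \<times> (UNIV::'e set))" by (intro open_Times open_chart_ran c open_UNIV)
  have "smooth_on (chart_ran c \<times> UNIV) (\<lambda>z. (0 :: 'e, rep c X (fst z)))"
    by (intro smooth_on_Pair op smooth_on_const smooth_on_base smooth_rep X open_chart_ran c)
  thus "smooth_on (chart_ran c \<times> UNIV) (rep (tb_chart A c) (vlift A X))"
    by (subst smooth_on_cong[OF op, of _ "\<lambda>z. (0 :: 'e, rep c X (fst z))"]) (auto simp: rep_vlift c)
qed

text \<open>\<open>vlift\<close> reads its argument only at the foot point, so a constant function
  with value the fibre vector may stand for a field and may change with \<open>z\<close>.\<close>

definition liouville :: "('a \<times> ('a, 'e) tvec, 'e \<times> 'e) vfield" where
  "liouville z = vlift A (\<lambda>_. snd z) z"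

lemma rep_liouville:
  "c \<in> A \<Longrightarrow> x \<in> chart_ran c \<Longrightarrow> rep (tb_chart A c) liouville (x, w) = (0, w)"
  by (simp add: rep_def liouville_def tb_inv vlift_comp chart_inv_dom chart_vec_tangent chart_vec_self)

lemma vector_field_liouville: "vector_field (tb_atlas A) liouville"
  unfolding tb_vector_field_iff
proof (intro conjI allI impI ballI)
  show "liouville (p, y) \<in> tangent_space (tb_atlas A) (p, y)"
    if "y \<in> tangent_space A p" for p y
    unfolding liouville_def using that by (intro vlift_tangent) auto
  fix c assume c: "c \<in> A"
  have op: "open (chart_ran c \<times> (UNIV::'e set))" by (intro open_Times open_chart_ran c open_UNIV)
  have "smooth_on (chart_ran c \<times> UNIV) (\<lambda>z. (0 :: 'e, snd z :: 'e))"
    by (intro smooth_on_Pair op smooth_on_const smooth_on_bounded_linear bounded_linear_snd)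
  thus "smooth_on (chart_ran c \<times> UNIV) (rep (tb_chart A c) liouville)"
    by (subst smooth_on_cong[OF op, of _ "\<lambda>z. (0 :: 'e, snd z :: 'e)"]) (auto simp: rep_liouville c)
qed

end

section \<open>Horizontal lifts and components of lifted tensors\<close>

context riemannian
begin

lemma hlift_comp:
  "c \<in> A \<Longrightarrow> p \<in> chart_dom c \<Longrightarrow> y \<in> tangent_space A p \<Longrightarrow>
    hlift A k X (p, y) (tb_chart A c) = (X p c, - \<Gamma>c c (coord c p) (y c) (X p c))"
  by (simp add: hlift_def tb_chart_in_atlas tb_dom inv_tb_chart)

text \<open>The inhomogeneous term in the change of Christoffel symbols is exactly compensated by
  the Hessian block of the transition of the tangent bundle.\<close>

lemma hlift_tangent:
  assumes y: "y \<in> tangent_space A p" and X: "X p \<in> tangent_space A p"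
  shows "hlift A k X (p, y) \<in> tangent_space (tb_atlas A) (p, y)"
proof (rule tb_tangentI[OF y])
  fix c c' assume c: "c \<in> A" "c' \<in> A" "p \<in> chart_dom c" "p \<in> chart_dom c'"
  note ov = overlapI[OF c(3,4)]
  have "transition c c' (coord c p) = coord c' p" by (simp add: chart_inv_coord c)
  with christoffel_transform[OF c(1,2) ov, of "y c" "X p c"]
  have "\<Gamma>c c' (coord c' p) (y c') (X p c') = dd (transition c c') (coord c p) (\<Gamma>c c (coord c p) (y c) (X p c))
      - dd (\<lambda>u. dd (transition c c') u (y c)) (coord c p) (X p c)"
    unfolding tangent_spaceD[OF X c] tangent_spaceD[OF y c] by simp
  thus "hlift A k X (p, y) (tb_chart A c') =
     (dd (transition c c') (coord c p) (fst (hlift A k X (p, y) (tb_chart A c))),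
        dd (\<lambda>u. dd (transition c c') u (y c)) (coord c p) (fst (hlift A k X (p, y) (tb_chart A c)))
        + dd (transition c c') (coord c p) (snd (hlift A k X (p, y) (tb_chart A c))))"
    unfolding hlift_comp[OF c(1,3) y] hlift_comp[OF c(2,4) y]
    using tangent_spaceD[OF X c] linear_neg[OF linear_dd_trans[OF c(1,2) ov]] by simp
qed (auto simp: hlift_def)

lemma rep_hlift:
  "c \<in> A \<Longrightarrow> x \<in> chart_ran c \<Longrightarrow>
    rep (tb_chart A c) (hlift A k X) (x, w) = (rep c X x, - \<Gamma>c c x w (rep c X x))"
  by (simp add: rep_def tb_inv hlift_comp chart_inv_dom chart_vec_tangent chart_vec_self coord_chart_inv)

lemma vector_field_hlift:
  assumes X: "vector_field A X"
  shows "vector_field (tb_atlas A) (hlift A k X)"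
  unfolding tb_vector_field_iff
proof (intro conjI allI impI ballI)
  show "hlift A k X (p, y) \<in> tangent_space (tb_atlas A) (p, y)"
    if "p \<in> points A" "y \<in> tangent_space A p" for p y
    by (rule hlift_tangent[where X = X, OF that(2) vector_field_tangent[OF X that(1)]])
  fix c assume c: "c \<in> A"
  let ?S = "chart_ran c \<times> (UNIV::'e set)"
  have op: "open ?S" by (intro open_Times open_chart_ran c open_UNIV)
  have "smooth_on ?S (\<lambda>z. \<Gamma>c c (fst z) (snd z) (rep c X (fst z)))"
    by (rule smooth_on_family2[where B = "\<lambda>z. \<Gamma>c c (fst z)", OF op _
        smooth_on_base[OF open_chart_ran[OF c] smooth_\<Gamma>c[OF c]] smooth_on_bounded_linear[OF bounded_linear_snd]
        smooth_on_base[OF open_chart_ran[OF c] smooth_rep[OF X c]]])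
      (use bilinear_\<Gamma>c[OF c] in auto)
  hence "smooth_on ?S (\<lambda>z. (rep c X (fst z), - \<Gamma>c c (fst z) (snd z) (rep c X (fst z))))"
    by (intro smooth_on_Pair smooth_on_minus op smooth_on_base smooth_rep X open_chart_ran c)
  thus "smooth_on ?S (rep (tb_chart A c) (hlift A k X))"
    by (subst smooth_on_cong[OF op, of _ "\<lambda>z. (rep c X (fst z), - \<Gamma>c c (fst z) (snd z) (rep c X (fst z)))"])
      (auto simp: rep_hlift c)
qed

lemma metric_comp:
  assumes "v \<in> tangent_space A p" "w \<in> tangent_space A p" "c \<in> A" "p \<in> chart_dom c"
  shows "k p v w = gc c (coord c p) (v c) (w c)"
  using tangent_eq_chart_vec[OF assms(1,3,4)] tangent_eq_chart_vec[OF assms(2,3,4)]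
  by (simp add: tensor2_comp_def chart_inv_coord assms(3,4))

text \<open>The lifts are characterised on lifted global fields only. Fields with arbitrary values
  at a point exist, and their lifts span, so bilinearity determines all components. The weights
  \<open>r\<close>, \<open>s\<close>, \<open>t\<close> treat the three lifts at once.\<close>

lemma lifted_tensor_comp:
  fixes T :: "('a \<times> ('a, 'e) tvec, 'e \<times> 'e) tensor2"
  assumes H: "Hausdorff_space (atlas_topology A)" and T: "symmetric_tensor2 (tb_atlas A) T"
    and lifts: "\<And>X Y p y. vector_field A X \<Longrightarrow> vector_field A Y \<Longrightarrow> (p, y) \<in> points (tb_atlas A) \<Longrightarrow>
      T (p, y) (hlift A k X (p, y)) (hlift A k Y (p, y)) = r * k p (X p) (Y p) \<and>
      T (p, y) (hlift A k X (p, y)) (vlift A Y (p, y)) = s * k p (X p) (Y p) \<and>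
      T (p, y) (vlift A X (p, y)) (vlift A Y (p, y)) = t * k p (X p) (Y p)"
    and c: "c \<in> A" and x: "x \<in> chart_ran c"
  shows "tensor2_comp (tb_atlas A) T (tb_chart A c) (x, w) U V =
    r * gc c x (fst U) (fst V) + s * (gc c x (fst U) (snd V + \<Gamma>c c x w (fst V))
      + gc c x (snd U + \<Gamma>c c x w (fst U)) (fst V))
    + t * gc c x (snd U + \<Gamma>c c x w (fst U)) (snd V + \<Gamma>c c x w (fst V))"
proof -
  interpret tb: atlas "tb_atlas A" by (rule atlas_tb)
  let ?C = "tb_chart A c" and ?p = "chart_inv c x"
  let ?y = "chart_vec A c ?p w"
  let ?T = "tensor2_comp (tb_atlas A) T ?C (x, w)"
  define h where "h u = (u, - \<Gamma>c c x w u)" for u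
  define v :: "'e \<Rightarrow> 'e \<times> 'e" where "v u = (0, u)" for u
  note p = chart_inv_dom[OF x] and cx = coord_chart_inv[OF x]
  have y: "?y \<in> tangent_space A ?p" by (rule chart_vec_tangent[OF c p])
  have zC: "?C \<in> tb_atlas A" "(?p, ?y) \<in> chart_dom ?C" using c p y by (auto simp: tb_chart_in_atlas tb_dom)
  have zP: "(?p, ?y) \<in> points (tb_atlas A)" using y chart_dom_points[OF c p] by (simp add: points_tb)
  have inv: "chart_inv ?C (x, w) = (?p, ?y)" by (rule tb_inv[OF c x])
  have comp: "?T (h u) (h u') = r * gc c x u u'" "?T (h u) (v u') = s * gc c x u u'"
    "?T (v u) (v u') = t * gc c x u u'" for u u'
  proof -
    obtain X where X: "vector_field A X" "X ?p c = u" by (rule vector_field_through[OF H c p])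
    obtain Y where Y: "vector_field A Y" "Y ?p c = u'" by (rule vector_field_through[OF H c p])
    have Xt: "X ?p \<in> tangent_space A ?p" "Y ?p \<in> tangent_space A ?p"
      using vector_field_tangent chart_dom_points[OF c p] X Y by auto
    have k: "k ?p (X ?p) (Y ?p) = gc c x u u'"
      using metric_comp[OF Xt c p] X Y cx by simp
    have hv: "chart_vec (tb_atlas A) ?C (?p, ?y) (h (X ?p c)) = hlift A k X (?p, ?y)"
      "chart_vec (tb_atlas A) ?C (?p, ?y) (v (X ?p c)) = vlift A X (?p, ?y)"
      if "X ?p \<in> tangent_space A ?p" for X
      using tb.tangent_eq_chart_vec[OF hlift_tangent[where X = X, OF y that] zC]
        tb.tangent_eq_chart_vec[OF vlift_tangent[where X = X, OF y that] zC]
      by (simp_all add: hlift_comp[OF c p y] vlift_comp[OF c p y] chart_vec_self[OF c p] h_def v_def cx)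
    show "?T (h u) (h u') = r * gc c x u u'" "?T (h u) (v u') = s * gc c x u u'"
      "?T (v u) (v u') = t * gc c x u u'"
      using lifts[OF X(1) Y(1) zP] hv[where X = X, OF Xt(1)] hv[where X = Y, OF Xt(2)]
      by (simp_all add: tensor2_comp_def inv k X Y)
  qed
  have zr: "(x, w) \<in> chart_ran ?C" using c x by (simp add: tb_ran)
  have bil: "bilinear ?T" and sym: "?T U V = ?T V U" for U V
    using T zC(1) zr unfolding symmetric_tensor2_def by blast+
  have gsym: "gc c x u u' = gc c x u' u" for u u' by (rule local_metric.sym[OF local_metric_chart[OF c] x])
  \<comment> \<open>Horizontal and vertical parts of a tangent vector in the induced
    coordinates.\<close>
  have split: "U = h (fst U) + v (snd U + \<Gamma>c c x w (fst U))" for U by (simp add: h_def v_def prod_eq_iff)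
  have "?T U V = ?T (h (fst U) + v (snd U + \<Gamma>c c x w (fst U))) (h (fst V) + v (snd V + \<Gamma>c c x w (fst V)))"
    using split[of U] split[of V] by simp
  also have "\<dots> = r * gc c x (fst U) (fst V) + s * (gc c x (fst U) (snd V + \<Gamma>c c x w (fst V))
      + gc c x (snd U + \<Gamma>c c x w (fst U)) (fst V))
    + t * gc c x (snd U + \<Gamma>c c x w (fst U)) (snd V + \<Gamma>c c x w (fst V))"
    unfolding bilinear_ladd[OF bil] bilinear_radd[OF bil] sym[of "v _" "h _"] comp
    using gsym[of "fst V"] by (simp add: algebra_simps)
  finally show ?thesis .
qed

end

text \<open>The constant \<open>c\<close> of the theorem is called \<open>d\<close> here, as \<open>c\<close> stands for charts.\<close>

locale tangent_bundle = riemannian A g for A :: "('a, 'e::euclidean_space) chart set" and g +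
  fixes gs gh gv G :: "('a \<times> ('a, 'e) tvec, 'e \<times> 'e) tensor2" and a b d :: real
  assumes Hausdorff: "Hausdorff_space (atlas_topology A)"
    and a_pos: "a > 0" and disc_pos: "a * (a + d) - b\<^sup>2 > 0"
    and sasaki: "sasaki_lift A g gs" and horizontal: "horizontal_lift A g gh"
    and vertical: "vertical_lift A g gv"
    and G_def: "G = (\<lambda>z \<xi> \<eta>. a * gs z \<xi> \<eta> + b * gh z \<xi> \<eta> + d * gv z \<xi> \<eta>)"
begin

definition "q = (a * (a + d) - b\<^sup>2) / a"

definition "\<beta> = b / a"

lemma q_pos: "q > 0"
  using a_pos disc_pos by (simp add: q_def)

lemma tb_metric_chart:
  assumes "c \<in> A"
  shows "tb_metric (chart_ran c) (gc c) a q"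
  by (rule tb_metric.intro[OF local_metric_chart[OF assms]]) (unfold_locales, rule a_pos, rule q_pos)

lemma G_comp:
  assumes c: "c \<in> A" and z: "z \<in> chart_ran c \<times> UNIV"
  shows "tensor2_comp (tb_atlas A) G (tb_chart A c) z = tb_metric.gtm (gc c) a q \<beta> z"
proof (intro ext)
  fix U V
  interpret t: tb_metric "chart_ran c" "gc c" a q \<beta> by (rule tb_metric_chart[OF c])
  obtain x w where zx: "z = (x, w)" by (cases z)
  hence x: "x \<in> chart_ran c" using z by simp
  let ?\<Gamma> = "\<Gamma>c c x w"
  have s: "tensor2_comp (tb_atlas A) gs (tb_chart A c) (x, w) U V =
    1 * gc c x (fst U) (fst V) + 0 * (gc c x (fst U) (snd V + ?\<Gamma> (fst V)) + gc c x (snd U + ?\<Gamma> (fst U)) (fst V))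
    + 1 * gc c x (snd U + ?\<Gamma> (fst U)) (snd V + ?\<Gamma> (fst V))"
    by (rule lifted_tensor_comp[OF Hausdorff _ _ c x]) (use sasaki in \<open>auto simp: sasaki_lift_def Ball_def split_paired_All\<close>)
  have h: "tensor2_comp (tb_atlas A) gh (tb_chart A c) (x, w) U V =
    0 * gc c x (fst U) (fst V) + 1 * (gc c x (fst U) (snd V + ?\<Gamma> (fst V)) + gc c x (snd U + ?\<Gamma> (fst U)) (fst V))
    + 0 * gc c x (snd U + ?\<Gamma> (fst U)) (snd V + ?\<Gamma> (fst V))"
    by (rule lifted_tensor_comp[OF Hausdorff _ _ c x]) (use horizontal in \<open>auto simp: horizontal_lift_def Ball_def split_paired_All\<close>)
  have v: "tensor2_comp (tb_atlas A) gv (tb_chart A c) (x, w) U V =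
    1 * gc c x (fst U) (fst V) + 0 * (gc c x (fst U) (snd V + ?\<Gamma> (fst V)) + gc c x (snd U + ?\<Gamma> (fst U)) (fst V))
    + 0 * gc c x (snd U + ?\<Gamma> (fst U)) (snd V + ?\<Gamma> (fst V))"
    by (rule lifted_tensor_comp[OF Hausdorff _ _ c x]) (use vertical in \<open>auto simp: vertical_lift_def Ball_def split_paired_All\<close>)
  have "tensor2_comp (tb_atlas A) G (tb_chart A c) (x, w) U V =
      a * tensor2_comp (tb_atlas A) gs (tb_chart A c) (x, w) U V +
      b * tensor2_comp (tb_atlas A) gh (tb_chart A c) (x, w) U V +
      d * tensor2_comp (tb_atlas A) gv (tb_chart A c) (x, w) U V"
    by (simp add: tensor2_comp_def G_def)
  also have "\<dots> = (q + b * \<beta>) * gc c x (fst U) (fst V)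
      + (a * \<beta>) * (gc c x (fst U) (snd V + ?\<Gamma> (fst V)) + gc c x (snd U + ?\<Gamma> (fst U)) (fst V))
      + a * gc c x (snd U + ?\<Gamma> (fst U)) (snd V + ?\<Gamma> (fst V))"
  proof -
    \<comment> \<open>Completing the square: \<beta> removes the mixed term of G and
      \<open>q\<close> is what then remains on the first summand.\<close>
    have "q + b * \<beta> = a + d" "a * \<beta> = b"
      using a_pos by (simp_all add: q_def \<beta>_def power2_eq_square diff_divide_distrib)
    thus ?thesis unfolding s h v by (simp add: algebra_simps)
  qed
  also have "\<dots> = t.gtm (x, w) U V"
    by (simp add: t.gtm_def t.ghat_def t.hat_def \<Gamma>c_levi_civita bilinear_ladd[OF t.bil[OF x]]
        bilinear_radd[OF t.bil[OF x]] bilinear_lmul[OF t.bil[OF x]] bilinear_rmul[OF t.bil[OF x]] algebra_simps)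
      (use a_pos in \<open>simp add: \<beta>_def\<close>)
  finally show "tensor2_comp (tb_atlas A) G (tb_chart A c) z U V = t.gtm z U V" by (simp add: zx)
qed

lemma riemannian_tb: "riemannian (tb_atlas A) G"
proof (rule riemannian.intro[OF atlas_tb], unfold_locales)
  have "bilinear (tensor2_comp (tb_atlas A) G C z) \<and>
      (\<forall>u v. tensor2_comp (tb_atlas A) G C z u v = tensor2_comp (tb_atlas A) G C z v u) \<and>
      (\<forall>u. u \<noteq> 0 \<longrightarrow> tensor2_comp (tb_atlas A) G C z u u > 0)"
    and "smooth_on (chart_ran C) (\<lambda>z. tensor2_comp (tb_atlas A) G C z u v)"
    if C: "C \<in> tb_atlas A" and z: "z \<in> chart_ran C" for C z u v
  proof -
    obtain c where c: "c \<in> A" "C = tb_chart A c" using C by (auto simp: tb_atlas_def)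
    interpret t: tb_metric "chart_ran c" "gc c" a q \<beta> by (rule tb_metric_chart[OF c(1)])
    have z': "z \<in> chart_ran c \<times> UNIV" using z c by (simp add: tb_ran)
    show "bilinear (tensor2_comp (tb_atlas A) G C z) \<and>
      (\<forall>u v. tensor2_comp (tb_atlas A) G C z u v = tensor2_comp (tb_atlas A) G C z v u) \<and>
      (\<forall>u. u \<noteq> 0 \<longrightarrow> tensor2_comp (tb_atlas A) G C z u u > 0)"
      unfolding c G_comp[OF c(1) z'] using t.tm.bil[OF z'] t.tm.sym[OF z'] t.tm.pos[OF z'] by blast
    have "smooth_on t.TS (\<lambda>z. tensor2_comp (tb_atlas A) G C z u v) \<longleftrightarrow> smooth_on t.TS (\<lambda>z. t.gtm z u v)"
      by (rule smooth_on_cong[OF t.open_TS]) (simp only: c G_comp[OF c(1)])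
    thus "smooth_on (chart_ran C) (\<lambda>z. tensor2_comp (tb_atlas A) G C z u v)"
      using t.tm.smooth c by (simp add: tb_ran)
  qed
  \<comment> \<open>The facts above presuppose a point in the range of the chart; a chart with empty
    domain is allowed and is treated separately.\<close>
  moreover have "smooth_on {} f" for f :: "'e \<times> 'e \<Rightarrow> real"
    using smooth_on_cong[of "{}" f "\<lambda>_. 0"] smooth_on_const by auto
  ultimately show "riemannian_metric (tb_atlas A) G"
    unfolding riemannian_metric_def symmetric_tensor2_def by (metis equals0I)
qed

lemma christoffel_tb:
  assumes c: "c \<in> A" and z: "z \<in> chart_ran c \<times> UNIV"
  shows "christoffel (tb_atlas A) G (tb_chart A c) z = levi_civita (tb_metric.gtm (gc c) a q \<beta>) z"
proof -
  interpret t: tb_metric "chart_ran c" "gc c" a q \<beta> by (rule tb_metric_chart[OF c])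
  show ?thesis
    unfolding christoffel_levi_civita by (rule levi_civita_cong[OF t.open_TS z G_comp[OF c]])
qed

end


section \<open>Symmetry conditions\<close>

lemma curv_cong:
  assumes "open S" "x \<in> S" "\<And>y. y \<in> S \<Longrightarrow> \<omega> y = \<omega>' y"
  shows "curv \<omega> x u v w = curv \<omega>' x u v w"
proof -
  have "dd (\<lambda>y. \<omega> y u v) x = dd (\<lambda>y. \<omega>' y u v) x" for u v
    by (rule dd_cong[OF assms(1,2)]) (simp add: assms(3))
  thus ?thesis by (simp add: curv_def assms(2,3))
qed

context riemannian
begin

lemma flat_nabla_curvature:
  assumes flat: "flat A k" and vf: "vector_field A W" "vector_field A X" "vector_field A Y" "vector_field A Z"
    and p: "p \<in> points A"
  shows "nabla_curvature A k W X Y Z p = (\<lambda>c. 0)"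
proof -
  have zero: "curvature A k X Y Z p = (\<lambda>c. 0)"
    if "vector_field A X" "vector_field A Y" "vector_field A Z" "p \<in> points A" for X Y Z p
    using flat that by (simp add: flat_def)
  have "nabla A k W (curvature A k X Y Z) p c = 0" for c
  proof (cases "c \<in> A \<and> p \<in> chart_dom c")
    case True
    have "rep c (curvature A k X Y Z) x = 0" if "x \<in> chart_ran c" for x
      using zero[OF vf(2-4) chart_dom_points[OF _ chart_inv_dom[OF that]]] True by (simp add: rep_def)
    hence "nab (\<Gamma>c c) (rep c W) (rep c (curvature A k X Y Z)) (coord c p) =
        nab (\<Gamma>c c) (rep c W) (\<lambda>_. 0) (coord c p)"
      using True by (intro nab_cong[OF open_chart_ran]) (auto simp: coord_in_ran)
    thus ?thesis
      using True bilinear_rzero[OF bilinear_\<Gamma>c[OF _ coord_in_ran]] by (simp add: nabla_eq nab_def)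
  next
    case False
    thus ?thesis by (auto simp: nabla_def)
  qed
  thus ?thesis
    using vf p by (simp add: nabla_curvature_def zero vector_field_nabla)
qed

lemma flat_imp_symmetric:
  assumes flat: "flat A k"
  shows "locally_symmetric A k" "recurrent A k" "pseudo_symmetric A k"
proof -
  show "locally_symmetric A k"
    unfolding locally_symmetric_def using flat_nabla_curvature[OF flat] by blast
  have "form1_comp A (\<lambda>p v. 0) c x = (\<lambda>u. 0)" for c x by (rule ext) (simp add: form1_comp_def)
  hence one: "one_form A (\<lambda>p v. 0)"
    by (simp add: one_form_def smooth_on_const linear_zero)
  \<comment> \<open>For vanishing curvature this makes the coefficient of the \<open>sharp\<close>
    term zero.\<close>
  have "k p (\<lambda>c. 0) w = 0" if p: "p \<in> points A" and w: "w \<in> tangent_space A p" for p w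
  proof -
    obtain c where c: "c \<in> A" "p \<in> chart_dom c" using p by (auto simp: points_def)
    show ?thesis
      using metric_comp[OF tangent_zero w c]
        bilinear_lzero[OF local_metric.bil[OF local_metric_chart[OF c(1)] coord_in_ran[OF c(2)]]] by simp
  qed
  hence "symmetry_identity A k (\<lambda>p v. 0) (\<lambda>p v. 0)"
    using flat by (auto simp: symmetry_identity_def flat_nabla_curvature[OF flat] flat_def vector_field_tangent)
  with one show "recurrent A k" "pseudo_symmetric A k"
    unfolding recurrent_def pseudo_symmetric_def by (blast, force)
qed

end

context tangent_bundle
begin

sublocale tb: riemannian "tb_atlas A" G
  by (rule riemannian_tb)

end

section \<open>Fibre derivatives along the Liouville field over one chart\<close>

locale tangent_bundle_chart = tangent_bundle +
  fixes c
  assumes c_in_A: "c \<in> A"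
begin

sublocale t: tb_metric "chart_ran c" "gc c" a q \<beta>
  by (rule tb_metric_chart[OF c_in_A])

abbreviation "C \<equiv> tb_chart A c"

abbreviation "Rtm \<equiv> curvature (tb_atlas A) G"

abbreviation "nabtm \<equiv> nabla (tb_atlas A) G"

abbreviation "field \<equiv> vector_field (tb_atlas A)"

lemma C_in_atlas: "C \<in> tb_atlas A"
  by (rule tb_chart_in_atlas[OF c_in_A])

lemma ran_C: "chart_ran C = t.TS"
  by (rule tb_ran[OF c_in_A])

lemma smooth_rep_C: "field V \<Longrightarrow> smooth_on t.TS (rep C V)"
  using tb.smooth_rep[OF _ C_in_atlas] by (simp add: ran_C)

definition frame_rep where
  "frame_rep F z = t.hat z (rep C F z)"

lemma christoffel_C: "z \<in> t.TS \<Longrightarrow> christoffel (tb_atlas A) G C z = t.tm.\<Gamma> z"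
  by (rule christoffel_tb[OF c_in_A])

lemma hat_curv_C:
  assumes z: "z \<in> t.TS"
  shows "t.hat z (curv (christoffel (tb_atlas A) G C) z u v w) = curv t.omega z u v (t.hat z w)"
proof -
  have "curv (christoffel (tb_atlas A) G C) z u v w = curv t.tm.\<Gamma> z u v w"
    by (rule curv_cong[OF t.open_TS z christoffel_C])
  thus ?thesis by (simp only: t.hat_curv[OF z])
qed

lemma frame_rep_curvature:
  assumes "field U" "field V" "field F" and z: "z \<in> t.TS"
  shows "frame_rep (Rtm U V F) z = curv t.omega z (rep C U z) (rep C V z) (frame_rep F z)"
  unfolding frame_rep_def using z
  by (simp only: tb.rep_curvature_eq[OF assms(1-3) C_in_atlas, unfolded ran_C] hat_curv_C)

lemma frame_rep_curvature_vertical: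
  assumes "field U" "field V" "field F" and z: "z \<in> t.TS"
    and "rep C V z = (0, v)" "frame_rep F z = (0, s)"
  shows "frame_rep (Rtm U V F) z =
    (- (t.kap *\<^sub>R t.R (fst z) v s (fst (rep C U z))
      + (t.kap * t.kap) *\<^sub>R t.R (fst z) (snd z) v (t.R (fst z) (snd z) s (fst (rep C U z)))), 0)"
  using frame_rep_curvature[OF assms(1-4)] t.curv_omega_vertical[OF z] assms(5,6) by simp

lemma frame_rep_curvature_zero:
  assumes f: "field U" "field V" "field F" and z: "z \<in> t.TS"
    and "rep C U z = 0 \<or> rep C V z = 0 \<or> rep C F z = 0"
  shows "frame_rep (Rtm U V F) z = 0"
proof -
  note lin = curv_linear[OF t.open_TS z t.bilinear_omega t.smooth_omega, THEN linear_0]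
  have "frame_rep F z = 0" if "rep C F z = 0" using that linear_0[OF t.linear_hat[OF z]] by (simp add: frame_rep_def)
  with assms(5) show ?thesis unfolding frame_rep_curvature[OF f z] by (elim disjE) (simp_all only: lin)
qed

text \<open>In direction \<open>(0, y)\<close> the connection term at \<open>(x, y)\<close> contains
  \<open>R(y, y) = 0\<close>. So in the frame the covariant derivative along the Liouville field is
  the plain derivative along the fibre.\<close>

lemma frame_rep_nabla_liouville:
  assumes F: "field F" and z: "z \<in> t.TS"
  shows "frame_rep (nabtm liouville F) z = dd (frame_rep F) z (0, snd z)"
proof -
  have l: "rep C liouville z = (0, snd z)" using rep_liouville[OF c_in_A, of "fst z" "snd z"] z by auto
  have "rep C (nabtm liouville F) z = nab t.tm.\<Gamma> (rep C liouville) (rep C F) z"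
    using tb.rep_nabla[OF C_in_atlas, of z liouville F] z christoffel_C[OF z] by (simp add: ran_C nab_def)
  hence "frame_rep (nabtm liouville F) z = nab t.omega (rep C liouville) (frame_rep F) z"
    unfolding frame_rep_def using t.hat_nab[OF z smooth_on_differentiable[OF smooth_rep_C[OF F] z]]
    by (simp add: frame_rep_def[abs_def])
  thus ?thesis
    using t.R_zero(4)[OF t.fst_in_S[OF z]] by (simp add: nab_def l t.omega_vertical(2)[OF z] zero_prod_def[symmetric])
qed

lemma rep_vlift_C: "z \<in> t.TS \<Longrightarrow> rep C (vlift A X) z = (0, rep c X (fst z))"
  using rep_vlift[OF c_in_A, of "fst z" X "snd z"] by auto

lemma rep_liouville_C: "z \<in> t.TS \<Longrightarrow> rep C liouville z = (0, snd z)"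
  using rep_liouville[OF c_in_A, of "fst z" "snd z"] by auto

lemma rep_hlift_C: "z \<in> t.TS \<Longrightarrow> rep C (hlift A g X) z =
    (rep c X (fst z), - t.\<Gamma> (fst z) (snd z) (rep c X (fst z)))"
  using rep_hlift[OF c_in_A, of "fst z" X "snd z"] by (auto simp: \<Gamma>c_levi_civita)

lemma hat_vertical: "z \<in> t.TS \<Longrightarrow> t.hat z (0, v) = (0, v)"
  using bilinear_rzero[OF t.bilinear_\<Gamma>[OF t.fst_in_S]] by (simp add: t.hat_def)

lemma frame_rep_vlift: "z \<in> t.TS \<Longrightarrow> frame_rep (vlift A X) z = (0, rep c X (fst z))"
  by (simp add: frame_rep_def rep_vlift_C hat_vertical)

lemma frame_rep_liouville: "z \<in> t.TS \<Longrightarrow> frame_rep liouville z = (0, snd z)"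
  by (simp add: frame_rep_def rep_liouville_C hat_vertical)

lemma frame_rep_hlift: "z \<in> t.TS \<Longrightarrow> frame_rep (hlift A g X) z = (rep c X (fst z), \<beta> *\<^sub>R rep c X (fst z))"
  by (simp add: frame_rep_def rep_hlift_C t.hat_def)

lemma smooth_hr: "field F \<Longrightarrow> smooth_on t.TS (frame_rep F)"
  unfolding frame_rep_def[abs_def] by (intro t.smooth_hat smooth_rep_C)

lemma dd_hr_vertical:
  assumes F: "field F" and z: "z \<in> t.TS"
    and eq: "\<And>w. frame_rep F (fst z, w) = f w" and f: "(f has_derivative f') (at (snd z))"
  shows "dd (frame_rep F) z (0, v) = f' v"
  by (rule dd_vertical[OF smooth_on_differentiable[OF smooth_hr[OF F] z]]) (simp add: eq f)

lemma rep_eq_zero: "z \<in> t.TS \<Longrightarrow> frame_rep F z = 0 \<Longrightarrow> rep C F z = 0"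
  by (simp add: frame_rep_def t.hat_eq_0)

text \<open>In the frame, the components of both lifts are constant along each fibre, the horizontal
  lift being \<open>(X, \<beta> X)\<close>; those of the Liouville field are the fibre coordinate
  itself.\<close>

lemma rep_nabla_liouville_lifts:
  assumes X: "vector_field A X" and z: "z \<in> t.TS"
  shows "rep C (nabtm liouville (hlift A g X)) z = 0" "rep C (nabtm liouville (vlift A X)) z = 0"
    "rep C (nabtm liouville liouville) z = rep C liouville z"
proof -
  have z': "(fst z, w) \<in> t.TS" for w using z by auto
  have "dd (frame_rep (hlift A g X)) z (0, snd z) = 0"
    by (rule dd_hr_vertical[OF vector_field_hlift[OF X] z, of "\<lambda>w. (rep c X (fst z), \<beta> *\<^sub>R rep c X (fst z))" "\<lambda>_. 0"])
      (simp_all add: frame_rep_hlift[OF z'])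
  thus "rep C (nabtm liouville (hlift A g X)) z = 0"
    by (intro rep_eq_zero z) (simp add: frame_rep_nabla_liouville[OF vector_field_hlift[OF X] z])
  have "dd (frame_rep (vlift A X)) z (0, snd z) = 0"
    by (rule dd_hr_vertical[OF vector_field_vlift[OF X] z, of "\<lambda>w. (0, rep c X (fst z))" "\<lambda>_. 0"])
      (simp_all add: frame_rep_vlift[OF z'])
  thus "rep C (nabtm liouville (vlift A X)) z = 0"
    by (intro rep_eq_zero z) (simp add: frame_rep_nabla_liouville[OF vector_field_vlift[OF X] z])
  have "dd (frame_rep liouville) z (0, snd z) = (0, snd z)"
    by (rule dd_hr_vertical[OF vector_field_liouville z, of "\<lambda>w. (0, w)" "\<lambda>w. (0, w)"])
      (auto simp: frame_rep_liouville[OF z'] intro!: derivative_eq_intros)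
  hence "frame_rep (nabtm liouville liouville) z = frame_rep liouville z"
    by (simp add: frame_rep_nabla_liouville[OF vector_field_liouville z] frame_rep_liouville[OF z])
  thus "rep C (nabtm liouville liouville) z = rep C liouville z"
    by (simp add: frame_rep_def t.hat_inject[OF z])
qed

lemma frame_rep_eval:
  assumes z: "z \<in> t.TS"
  shows "frame_rep F z = t.hat z (F (chart_inv C z) C)"
  by (simp add: frame_rep_def rep_def)

text \<open>\<open>nabtm liouville\<close> kills the lifts of \<open>X\<close> and \<open>Y\<close>, so only the derivative along the fibre of the
  quadratic polynomial \<open>Rtm X\<^sup>h Y\<^sup>v Y\<^sup>v\<close> survives.\<close>

lemma frame_rep_nabla_curvature_lifts:
  assumes X: "vector_field A X" and Y: "vector_field A Y" and z: "z \<in> t.TS"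
  shows "frame_rep (nabla_curvature (tb_atlas A) G liouville (hlift A g X) (vlift A Y) (vlift A Y)) z =
      2 *\<^sub>R frame_rep (Rtm (hlift A g X) (vlift A Y) (vlift A Y)) z"
    and "frame_rep (nabla_curvature (tb_atlas A) G liouville (hlift A g X) liouville (vlift A Y)) z = 0"
proof -
  let ?Xh = "hlift A g X" and ?Yv = "vlift A Y" and ?W = "liouville"
  note f = vector_field_hlift[OF X] vector_field_vlift[OF Y] vector_field_liouville
  have fn: "field (nabtm ?W ?Xh)" "field (nabtm ?W ?Yv)" "field (nabtm ?W ?W)"
    by (intro tb.vector_field_nabla f)+
  have fR: "field (Rtm ?Xh ?Yv ?Yv)" "field (Rtm ?Xh ?W ?Yv)" by (intro tb.vector_field_curvature f)+
  have z': "(fst z, w) \<in> t.TS" for w using z by auto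
  note x = t.fst_in_S[OF z]
  note [simp] = t.R_zero[OF x] rep_hlift_C[OF z'] rep_vlift_C[OF z'] rep_liouville_C[OF z']
    frame_rep_vlift[OF z'] frame_rep_liouville[OF z']
  note lin = linear_diff[OF t.linear_hat[OF z]]
  have split: "frame_rep (nabla_curvature (tb_atlas A) G U V V' V'') z =
      frame_rep (nabtm U (Rtm V V' V'')) z - frame_rep (Rtm (nabtm U V) V' V'') z - frame_rep (Rtm V (nabtm U V') V'') z
      - frame_rep (Rtm V V' (nabtm U V'')) z" for U V V' V''
    by (simp add: frame_rep_eval[OF z] nabla_curvature_def lin)
  define X0 Y0 where "X0 = rep c X (fst z)" and "Y0 = rep c Y (fst z)"
  \<comment> \<open>The linear part of the polynomial contains \<open>R(Y, Y) = 0\<close>, so it is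
    homogeneous of degree two on the fibre.\<close>
  have quad: "frame_rep (Rtm ?Xh ?Yv ?Yv) (fst z, w) = (- ((t.kap * t.kap) *\<^sub>R t.R (fst z) w Y0 (t.R (fst z) w Y0 X0)), 0)" for w
    using frame_rep_curvature_vertical[OF f(1,2,2) z', of w Y0 Y0] by (simp add: X0_def Y0_def)
  \<comment> \<open>With the Liouville field in the second slot, the quadratic part contains
    \<open>R(w, w) = 0\<close>, so this one is homogeneous of degree one.\<close>
  have lin1: "frame_rep (Rtm ?Xh ?W ?Yv) (fst z, w) = (- (t.kap *\<^sub>R t.R (fst z) w Y0 X0), 0)" for w
    using frame_rep_curvature_vertical[OF f(1,3,2) z', of w w Y0] by (simp add: X0_def Y0_def)
  have bl: "bounded_linear (\<lambda>w. t.R (fst z) w Y0 X0)"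
    using t.linear_R(1)[OF x] by (simp add: linear_conv_bounded_linear)
  have bb: "bounded_bilinear (\<lambda>w v. t.R (fst z) w Y0 v)"
    using t.linear_R(1,3)[OF x] by (simp add: bilinear_def bilinear_conv_bounded_bilinear[symmetric])
  have "((\<lambda>w. t.R (fst z) w Y0 (t.R (fst z) w Y0 X0)) has_derivative
      (\<lambda>h. t.R (fst z) (snd z) Y0 (t.R (fst z) h Y0 X0) + t.R (fst z) h Y0 (t.R (fst z) (snd z) Y0 X0))) (at (snd z))"
    by (rule bounded_bilinear.FDERIV[OF bb has_derivative_ident bounded_linear.has_derivative[OF bl has_derivative_ident]])
  from dd_hr_vertical[OF fR(1) z quad has_derivative_Pair[OF has_derivative_minus[OF
          has_derivative_scaleR_right[OF this]] has_derivative_const], of "snd z"]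
  have "dd (frame_rep (Rtm ?Xh ?Yv ?Yv)) z (0, snd z) =
      (- ((t.kap * t.kap) *\<^sub>R (t.R (fst z) (snd z) Y0 (t.R (fst z) (snd z) Y0 X0)
        + t.R (fst z) (snd z) Y0 (t.R (fst z) (snd z) Y0 X0))), 0)"
    .
  also have "\<dots> = 2 *\<^sub>R frame_rep (Rtm ?Xh ?Yv ?Yv) z"
  proof -
    have "frame_rep (Rtm ?Xh ?Yv ?Yv) z =
        (- ((t.kap * t.kap) *\<^sub>R t.R (fst z) (snd z) Y0 (t.R (fst z) (snd z) Y0 X0)), 0)"
      using quad[of "snd z"] by (simp only: prod.collapse)
    moreover have "(- (r *\<^sub>R (e + e)), 0) = 2 *\<^sub>R (- (r *\<^sub>R e), 0 :: 'b)" for r :: real and e :: 'b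
      by (simp only: scaleR_2 scaleR_add_right minus_add_distrib add_Pair add_0)
    ultimately show ?thesis by simp
  qed
  finally have "frame_rep (nabtm ?W (Rtm ?Xh ?Yv ?Yv)) z = 2 *\<^sub>R frame_rep (Rtm ?Xh ?Yv ?Yv) z"
    by (simp only: frame_rep_nabla_liouville[OF fR(1) z])
  thus "frame_rep (nabla_curvature (tb_atlas A) G ?W ?Xh ?Yv ?Yv) z = 2 *\<^sub>R frame_rep (Rtm ?Xh ?Yv ?Yv) z"
    unfolding split
    using frame_rep_curvature_zero[OF fn(1) f(2) f(2) z] frame_rep_curvature_zero[OF f(1) fn(2) f(2) z]
      frame_rep_curvature_zero[OF f(1) f(2) fn(2) z] rep_nabla_liouville_lifts[OF X z] rep_nabla_liouville_lifts[OF Y z]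
    by simp
  \<comment> \<open>A linear function is its own radial derivative. Here the second slot is not
    parallel either, and its derivative, the Liouville field again, contributes the same term with
    opposite sign.\<close>
  have "dd (frame_rep (Rtm ?Xh ?W ?Yv)) z (0, snd z) = (- (t.kap *\<^sub>R t.R (fst z) (snd z) Y0 X0), 0)"
    by (rule dd_hr_vertical[OF fR(2) z lin1 has_derivative_Pair[OF has_derivative_minus[OF
          has_derivative_scaleR_right[OF bounded_linear.has_derivative[OF bl has_derivative_ident]]]
          has_derivative_const]])
  also have "\<dots> = frame_rep (Rtm ?Xh ?W ?Yv) z" using lin1[of "snd z"] by simp
  also have "\<dots> = frame_rep (Rtm ?Xh (nabtm ?W ?W) ?Yv) z"
    unfolding frame_rep_curvature[OF f(1,3,2) z] frame_rep_curvature[OF f(1) fn(3) f(2) z] rep_nabla_liouville_lifts(3)[OF X z] ..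
  finally have "frame_rep (nabtm ?W (Rtm ?Xh ?W ?Yv)) z = frame_rep (Rtm ?Xh (nabtm ?W ?W) ?Yv) z"
    by (simp only: frame_rep_nabla_liouville[OF fR(2) z])
  thus "frame_rep (nabla_curvature (tb_atlas A) G ?W ?Xh ?W ?Yv) z = 0"
    unfolding split
    using frame_rep_curvature_zero[OF fn(1) f(3) f(2) z] frame_rep_curvature_zero[OF f(1) f(3) fn(2) z]
      rep_nabla_liouville_lifts[OF X z] rep_nabla_liouville_lifts[OF Y z]
    by simp
qed

end

section \<open>Flatness of G from that of g, and of g from the symmetry conditions\<close>

context tangent_bundle
begin

lemma flat_tb:
  assumes "flat A g"
  shows "flat (tb_atlas A) G"
proof (rule tb.flatI)
  fix C z u v w assume C: "C \<in> tb_atlas A" and z: "z \<in> chart_ran C"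
  obtain c where c: "c \<in> A" "C = tb_chart A c" using C by (auto simp: tb_atlas_def)
  interpret tangent_bundle_chart A g gs gh gv G a b d c by unfold_locales (rule c)
  have z': "z \<in> t.TS" using z by (simp add: c ran_C)
  have "t.R x u v w = 0" if "x \<in> chart_ran c" for x u v w
    using flatD[OF assms Hausdorff c(1) that] by (simp add: \<Gamma>c_levi_civita)
  from t.curv_omega_flat[OF z' this] show "curv (christoffel (tb_atlas A) G C) z u v w = 0"
    unfolding c by (rule t.hat_eq_0[OF z', OF trans[OF hat_curv_C[OF z']]])
qed

text \<open>A common form of the three conditions. \<open>ident\<close> asks for the identity only
  where the coefficient of the \<open>sharp\<close> term vanishes, so that term can be left out. The
  last assumption excludes the one pair of values compatible with curvature: when the first form
  takes the value 2, the second takes 0 for a recurrent and 1 for a pseudo-symmetric G, while for a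
  locally symmetric G the first form is zero.\<close>

lemma flat_if_symmetry_identity:
  assumes ident: "\<And>W X Y Z z. vector_field (tb_atlas A) W \<Longrightarrow> vector_field (tb_atlas A) X \<Longrightarrow>
      vector_field (tb_atlas A) Y \<Longrightarrow> vector_field (tb_atlas A) Z \<Longrightarrow> z \<in> points (tb_atlas A) \<Longrightarrow>
      G z (curvature (tb_atlas A) G X Y Z z) (W z) = 0 \<Longrightarrow>
      nabla_curvature (tb_atlas A) G W X Y Z z = (\<lambda>C.
          \<alpha>1 z (W z) *\<^sub>R curvature (tb_atlas A) G X Y Z z C
          + \<alpha>2 z (X z) *\<^sub>R curvature (tb_atlas A) G W Y Z z C
          + \<alpha>2 z (Y z) *\<^sub>R curvature (tb_atlas A) G X W Z z C
          + \<alpha>2 z (Z z) *\<^sub>R curvature (tb_atlas A) G X Y W z C)"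
    and \<alpha>: "\<And>z v. z \<in> points (tb_atlas A) \<Longrightarrow> v \<in> tangent_space (tb_atlas A) z \<Longrightarrow>
      \<alpha>1 z v = 2 \<Longrightarrow> \<alpha>2 z v \<noteq> - 2"
  shows "flat A g"
proof (rule flatI)
  fix c x u v w assume c: "c \<in> A" and x: "x \<in> chart_ran c"
  interpret tangent_bundle_chart A g gs gh gv G a b d c by unfold_locales (rule c)
  define p where "p = chart_inv c x"
  \<comment> \<open>To show \<open>R(u, v)w = 0\<close>, the vector \<open>u\<close> becomes the
    fibre coordinate of the point, \<open>v\<close> is lifted vertically and \<open>w\<close>
    horizontally.\<close>
  define z where "z = (p, chart_vec A c p u)"
  have p: "p \<in> chart_dom c" unfolding p_def by (rule chart_inv_dom[OF x])
  have zT: "(x, u) \<in> t.TS" using x by simp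
  have inv: "chart_inv C (x, u) = z" by (simp add: z_def p_def tb_inv[OF c x])
  have coordz: "coord C z = (x, u)"
    using coord_chart_inv[OF x] by (simp add: z_def tb_coord p_def chart_vec_self[OF c chart_inv_dom[OF x]])
  have zC: "z \<in> chart_dom C" using p by (simp add: z_def tb_dom chart_vec_tangent[OF c])
  have zP: "z \<in> points (tb_atlas A)" by (rule tb.chart_dom_points[OF C_in_atlas zC])
  obtain X where X: "vector_field A X" "X p c = w" by (rule vector_field_through[OF Hausdorff c p])
  obtain Y where Y: "vector_field A Y" "Y p c = v" by (rule vector_field_through[OF Hausdorff c p])
  have repXY [simp]: "rep c X x = w" "rep c Y x = v" using X Y by (simp_all add: rep_def p_def)
  let ?Xh = "hlift A g X" and ?Yv = "vlift A Y" and ?W = "liouville"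
  note f = vector_field_hlift[OF X(1)] vector_field_vlift[OF Y(1)] vector_field_liouville
  let ?\<zeta> = "(x, u)"
  note [simp] = t.R_zero[OF x] rep_hlift_C[OF zT] rep_vlift_C[OF zT] rep_liouville_C[OF zT]
    frame_rep_vlift[OF zT] frame_rep_liouville[OF zT]
  \<comment> \<open>The curvature has no second frame component and the Liouville field no first
    one, and the two summands are orthogonal.\<close>
  have G_zero: "G z (Rtm U V F z) (?W z) = 0"
    if "field U" "field V" "field F" "rep C V ?\<zeta> = (0, r)" "frame_rep F ?\<zeta> = (0, s)" for U V F r s
  proof -
    have "snd (frame_rep (Rtm U V F) ?\<zeta>) = 0" using frame_rep_curvature_vertical[OF that(1-3) zT that(4,5)] by simp
    moreover have "frame_rep (Rtm U V F) ?\<zeta> = t.hat ?\<zeta> (Rtm U V F z C)"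
      by (simp only: frame_rep_eval[OF zT] inv)
    moreover have "t.hat ?\<zeta> (?W z C) = (0, u)"
      using frame_rep_eval[OF zT, of ?W] frame_rep_liouville[OF zT] by (simp only: inv snd_conv)
    moreover have "G z (Rtm U V F z) (?W z) = tensor2_comp (tb_atlas A) G C ?\<zeta> (Rtm U V F z C) (?W z C)"
      using tb.metric_comp[OF tb.vector_field_tangent[OF tb.vector_field_curvature[OF that(1-3)] zP]
          tb.vector_field_tangent[OF f(3) zP] C_in_atlas zC] by (simp only: coordz)
    ultimately show ?thesis
      unfolding G_comp[OF c zT] t.gtm_def t.ghat_def
      by (simp add: bilinear_lzero[OF t.bil[OF x]] bilinear_rzero[OF t.bil[OF x]])
  qed
  have frame_rep_ident: "frame_rep (nabla_curvature (tb_atlas A) G ?W U V F) ?\<zeta> =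
        \<alpha>1 z (?W z) *\<^sub>R frame_rep (Rtm U V F) ?\<zeta> + \<alpha>2 z (U z) *\<^sub>R frame_rep (Rtm ?W V F) ?\<zeta>
        + \<alpha>2 z (V z) *\<^sub>R frame_rep (Rtm U ?W F) ?\<zeta> + \<alpha>2 z (F z) *\<^sub>R frame_rep (Rtm U V ?W) ?\<zeta>"
    if "field U" "field V" "field F" "rep C V ?\<zeta> = (0, r)" "frame_rep F ?\<zeta> = (0, s)" for U V F r s
    using ident[OF f(3) that(1-3) zP G_zero[OF that]] t.linear_hat[OF zT]
    by (simp add: frame_rep_eval[OF zT] inv linear_add linear_scale)
  define \<rho> where "\<rho> = t.R x u v"
  have R_vu: "t.R x v u w = - \<rho> w" unfolding \<rho>_def by (rule curv_antisym)
  have one: "frame_rep (Rtm ?Xh ?Yv ?Yv) ?\<zeta> = (- ((t.kap * t.kap) *\<^sub>R \<rho> (\<rho> w)), 0)"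
    using frame_rep_curvature_vertical[OF f(1,2,2) zT, of v v] by (simp add: \<rho>_def)
  have two: "frame_rep (Rtm ?Xh ?W ?Yv) ?\<zeta> = (- (t.kap *\<^sub>R \<rho> w), 0)"
    using frame_rep_curvature_vertical[OF f(1,3,2) zT, of u v] by (simp add: \<rho>_def)
  \<comment> \<open>The opposite of \<open>two\<close>, from the antisymmetry of R. In the identity
    for \<open>E1\<close> both appear with the same coefficient, the value of
    \<open>\<alpha>2\<close> on \<open>?Yv\<close>, and cancel.\<close>
  have three: "frame_rep (Rtm ?Xh ?Yv ?W) ?\<zeta> = (t.kap *\<^sub>R \<rho> w, 0)"
    using frame_rep_curvature_vertical[OF f(1,2,3) zT, of v u] R_vu by simp
  have zero: "frame_rep (Rtm ?W ?Yv ?Yv) ?\<zeta> = 0" "frame_rep (Rtm ?W ?W ?Yv) ?\<zeta> = 0" "frame_rep (Rtm ?Xh ?W ?W) ?\<zeta> = 0"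
    using frame_rep_curvature_vertical[OF f(3,2,2) zT, of v v] frame_rep_curvature_vertical[OF f(3,3,2) zT, of u v]
      frame_rep_curvature_vertical[OF f(1,3,3) zT, of u u] by (simp_all add: zero_prod_def)
  have E1: "(2 - \<alpha>1 z (?W z)) *\<^sub>R \<rho> (\<rho> w) = 0"
  proof -
    have "2 *\<^sub>R frame_rep (Rtm ?Xh ?Yv ?Yv) ?\<zeta> = \<alpha>1 z (?W z) *\<^sub>R frame_rep (Rtm ?Xh ?Yv ?Yv) ?\<zeta>"
      using frame_rep_ident[OF f(1,2,2), of v v] unfolding frame_rep_nabla_curvature_lifts(1)[OF X(1) Y(1) zT]
      by (simp add: zero two three zero_prod_def[symmetric])
    hence "(2 - \<alpha>1 z (?W z)) *\<^sub>R frame_rep (Rtm ?Xh ?Yv ?Yv) ?\<zeta> = 0" by (simp add: scaleR_diff_left)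
    thus ?thesis using t.kap_pos by (auto simp: one zero_prod_def)
  qed
  have E2: "(\<alpha>1 z (?W z) + \<alpha>2 z (?W z)) *\<^sub>R \<rho> w = 0"
  proof -
    have "(\<alpha>1 z (?W z) + \<alpha>2 z (?W z)) *\<^sub>R frame_rep (Rtm ?Xh ?W ?Yv) ?\<zeta> = 0"
      using frame_rep_ident[OF f(1,3,2), of u v] unfolding frame_rep_nabla_curvature_lifts(2)[OF X(1) Y(1) zT]
      by (simp add: zero scaleR_add_left)
    thus ?thesis using t.kap_pos by (auto simp: two zero_prod_def)
  qed
  have "\<rho> w = 0"
  proof (rule ccontr)
    assume ne: "\<rho> w \<noteq> 0"
    have "gc c x (\<rho> (\<rho> w)) w = - gc c x (\<rho> w) (\<rho> w)" unfolding \<rho>_def by (rule t.R_skew[OF x])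
    with t.pos[OF x ne] have "\<rho> (\<rho> w) \<noteq> 0" using bilinear_lzero[OF t.bil[OF x]] by force
    hence "\<alpha>1 z (?W z) = 2" "\<alpha>2 z (?W z) = - 2" using E1 E2 ne by auto
    with \<alpha>[OF zP tb.vector_field_tangent[OF f(3) zP]] show False by blast
  qed
  thus "curv (\<Gamma>c c) x u v w = 0" by (simp add: \<rho>_def \<Gamma>c_levi_civita)
qed

end

theorem corollary1:
  fixes A :: "('a, 'e::euclidean_space) chart set"
    and g :: "('a, 'e) tensor2"
    and gs gh gv G :: "('a \<times> ('a, 'e) tvec, 'e \<times> 'e) tensor2"
    and a b c :: real
  assumes "riemannian_manifold A g"
    and "DIM('e) \<ge> 3"
    and "a > 0"
    and "a * (a + c) - b\<^sup>2 > 0"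
    and "sasaki_lift A g gs"
    and "horizontal_lift A g gh"
    and "vertical_lift A g gv"
    and "G = (\<lambda>z \<xi> \<eta>. a * gs z \<xi> \<eta> + b * gh z \<xi> \<eta> + c * gv z \<xi> \<eta>)"
  shows "(recurrent (tb_atlas A) G \<longleftrightarrow> flat A g) \<and>
         (pseudo_symmetric (tb_atlas A) G \<longleftrightarrow> flat A g) \<and>
         (locally_symmetric (tb_atlas A) G \<longleftrightarrow> flat A g) \<and>
         (recurrent (tb_atlas A) G \<or> pseudo_symmetric (tb_atlas A) G \<or>
            locally_symmetric (tb_atlas A) G \<longrightarrow> flat (tb_atlas A) G)"
proof -
  interpret tangent_bundle A g gs gh gv G a b c
    using assms by unfold_locales (auto simp: riemannian_manifold_def smooth_manifold_def)
  have "flat A g" if rec: "recurrent (tb_atlas A) G"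
  proof -
    obtain \<alpha> where id: "symmetry_identity (tb_atlas A) G \<alpha> (\<lambda>p v. 0)"
      using rec by (auto simp: recurrent_def)
    show ?thesis
      by (rule flat_if_symmetry_identity[of \<alpha> "\<lambda>p v. 0"]) (use id in \<open>simp_all add: symmetry_identity_def\<close>)
  qed
  moreover have "flat A g" if ps: "pseudo_symmetric (tb_atlas A) G"
  proof -
    obtain \<alpha>1 \<alpha>2 where id: "symmetry_identity (tb_atlas A) G \<alpha>1 \<alpha>2"
      and two: "\<And>p v. p \<in> points (tb_atlas A) \<Longrightarrow> v \<in> tangent_space (tb_atlas A) p \<Longrightarrow> \<alpha>1 p v = 2 * \<alpha>2 p v"
      using ps by (auto simp: pseudo_symmetric_def)
    show ?thesis
      by (rule flat_if_symmetry_identity[of \<alpha>1 \<alpha>2]) (use id two in \<open>simp_all add: symmetry_identity_def\<close>)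
  qed
  moreover have "flat A g" if ls: "locally_symmetric (tb_atlas A) G"
    by (rule flat_if_symmetry_identity[of "\<lambda>p v. 0" "\<lambda>p v. 0"])
      (use ls in \<open>simp_all add: locally_symmetric_def\<close>)
  ultimately show ?thesis using tb.flat_imp_symmetric flat_tb by blast
qed

end
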